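(* Let $\nu\in\{2,3\}$, let $N\ge 2$ be an integer, and let $\mathcal{C}$ be a (planar) circle of unit radius in $\mathbb{R}^\nu$. Let $\tilde Y\subset\mathcal{C}$ be the set of vertices of a regular $N$-gon inscribed in $\mathcal{C}$ (a pair of antipodal points if $N=2$). Then for every $N$-point set $Y\subset\mathcal{C}$ and every real $\alpha<\alpha_{\mathrm{crit}}$ one has $$\lambda_1(\alpha,Y)\le\lambda_1(\alpha,\tilde Y),$$ and the inequality is strict if and only if $Y$ and $\tilde Y$ are not congruent. Here $\lambda_1(\alpha,Y)$ is the lowest eigenvalue of the point-interaction Hamiltonian $H_{\alpha,Y}$ in $L^2(\mathbb{R}^\nu)$; $\alpha_{\mathrm{crit}}:=\infty$ if $\nu=2$, while for $\nu=3$ we set $\alpha_{\mathrm{crit}}:=\inf_Y\alpha_{\mathrm{crit}}^Y$, the infimum being taken over all $N$-point sets $Y\subset\mathcal{C}$.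
   Context: Point-interaction Hamiltonians. Let $\nu\in\{2,3\}$, let $Y=\{y_j\}_{j=1}^N\subset\mathbb{R}^\nu$ be a set of $N$ distinct points and $\alpha\in\mathbb{R}$. For $\kappa>0$ let $G_{i\kappa}$ be the integral kernel of $(-\Delta+\kappa^2)^{-1}$ in $L^2(\mathbb{R}^\nu)$, that is, $G_{i\kappa}(x)=\frac{1}{2\pi}K_0(\kappa|x|)$ for $\nu=2$ and $G_{i\kappa}(x)=\frac{\mathrm{e}^{-\kappa|x|}}{4\pi|x|}$ for $\nu=3$ ($K_0$ is the Macdonald function). Put $\xi_{i\kappa}=-\frac{1}{2\pi}\left(\ln\frac{\kappa}{2}+\gamma_{\mathrm{E}}\right)$ for $\nu=2$ (with $\gamma_{\mathrm{E}}$ the Euler–Mascheroni constant) and $\xi_{i\kappa}=-\frac{\kappa}{4\pi}$ for $\nu=3$, and define the $N\times N$ matrix $$\Gamma_{\alpha,Y}(i\kappa)=\big[(\alpha-\xi_{i\kappa})\delta_{jj'}-(1-\delta_{jj'})G_{i\kappa}(y_j-y_{j'})\big]_{j,j'=1}^N .$$ The operator $H_{\alpha,Y}$ is the self-adjoint operator in $L^2(\mathbb{R}^\nu)$ whose resolvent is given by Krein's formula $$(H_{\alpha,Y}+\kappa^2)^{-1}=(-\Delta+\kappa^2)^{-1}+\sum_{j,j'=1}^N\big[\Gamma_{\alpha,Y}(i\kappa)^{-1}\big]_{jj'}\big(G_{i\kappa}(\cdot-y_{j'}),\,\cdot\,\big)\,G_{i\kappa}(\cdot-y_j)$$ for all $\kappa>0$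 with $\det\Gamma_{\alpha,Y}(i\kappa)\neq0$. Equivalently, it acts as $-\Delta$ away from $Y$ on functions which near each $y_j$ behave as $\psi(x)=-\frac{c_j}{2\pi}\ln|x-y_j|+\alpha c_j+o(1)$ for $\nu=2$, and as $\psi(x)=\frac{c_j}{4\pi|x-y_j|}+\alpha c_j+o(1)$ for $\nu=3$, with some $c_j\in\mathbb{C}$. The same $\alpha$ is used at all points of $Y$. Spectrum. The essential spectrum of $H_{\alpha,Y}$ is $[0,\infty)$, and $-\kappa^2<0$ is an eigenvalue if and only if $\det\Gamma_{\alpha,Y}(i\kappa)=0$. For $\nu=2$ the discrete spectrum is nonempty for every $\alpha\in\mathbb{R}$. For $\nu=3$ there is a critical value $\alpha_{\mathrm{crit}}^Y\in\mathbb{R}$ such that the discrete spectrum of $H_{\alpha,Y}$ is nonempty if and only if $\alpha<\alpha_{\mathrm{crit}}^Y$. When the discrete spectrum is nonempty, $\lambda_1(\alpha,Y)<0$ denotes the smallest eigenvalue. Two sets are congruent if one is mapped onto the other by an isometry of $\mathbb{R}^\nu$. *)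

theory Defs
  imports "HOL-Analysis.Analysis"
begin

section \<open>Unbounded operators in complex \<open>L\<^sup>2(\<real>\<^sup>\<nu>)\<close>\<close>

text \<open>
  Elements of \<open>L\<^sup>2\<close> are represented by functions, equality in \<open>L\<^sup>2\<close> being equality almost
  everywhere. A (possibly unbounded) operator is represented by its graph, a set of pairs
  of square-integrable functions.
\<close>

definition L2 :: "((real^'n) \<Rightarrow> complex) set" where
  "L2 = {f. f \<in> borel_measurable lborel \<and> integrable lborel (\<lambda>x. (cmod (f x))\<^sup>2)}"

definition L2_norm :: "((real^'n) \<Rightarrow> complex) \<Rightarrow> real" where
  "L2_norm f = sqrt (\<integral>x. (cmod (f x))\<^sup>2 \<partial>lborel)"

type_synonym 'n operator = "(((real^'n) \<Rightarrow> complex) \<times> ((real^'n) \<Rightarrow> complex)) set"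

definition eigenfunctions :: "('n::finite) operator \<Rightarrow> real \<Rightarrow> ((real^'n) \<Rightarrow> complex) set" where
  "eigenfunctions T l = {\<psi>. (\<psi>, \<lambda>x. complex_of_real l * \<psi> x) \<in> T}"

definition eigenvalue :: "('n::finite) operator \<Rightarrow> real \<Rightarrow> bool" where
  "eigenvalue T l \<longleftrightarrow> (\<exists>\<psi>\<in>eigenfunctions T l. \<not> (AE x in lborel. \<psi> x = 0))"

definition finite_multiplicity :: "('n::finite) operator \<Rightarrow> real \<Rightarrow> bool" where
  "finite_multiplicity T l \<longleftrightarrow>
     (\<exists>B. finite B \<and> B \<subseteq> L2 \<and>
        (\<forall>\<psi>\<in>eigenfunctions T l. \<exists>c. AE x in lborel. \<psi> x = (\<Sum>b\<in>B. c b * b x)))"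

text \<open>
  Only self-adjoint operators are considered, whose spectrum is real; hence the
  spectral parameter ranges over the reals. The number \<open>m\<close> is in the resolvent set iff for
  every \<open>f\<close> the equation \<open>(T - m) \<psi> = f\<close> has exactly one solution \<open>\<psi>\<close> in the domain of \<open>T\<close>, and
  the solution operator is bounded.
\<close>

definition resolvent_set :: "('n::finite) operator \<Rightarrow> real set" where
  "resolvent_set T =
     {m. \<exists>K. \<forall>f\<in>L2. \<exists>\<psi>.
        (\<psi>, \<lambda>x. f x + complex_of_real m * \<psi> x) \<in> T \<and> L2_norm \<psi> \<le> K * L2_norm f \<and>
        (\<forall>\<psi>'. (\<psi>', \<lambda>x. f x + complex_of_real m * \<psi>' x) \<in> T \<longrightarrow> (AE x in lborel. \<psi>' x = \<psi> x))}"

definition spectrum :: "('n::finite) operator \<Rightarrow> real set" where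
  "spectrum T = - resolvent_set T"

definition discrete_spectrum :: "('n::finite) operator \<Rightarrow> real set" where
  "discrete_spectrum T =
     {l \<in> spectrum T. \<not> l islimpt spectrum T \<and> eigenvalue T l \<and> finite_multiplicity T l}"


section \<open>Point-interaction Hamiltonians\<close>

text \<open>
  The space is \<open>real ^ 'n\<close> with \<open>\<nu> = CARD('n)\<close>; the definitions below are meant for \<open>\<nu> = 2\<close> and
  \<open>\<nu> = 3\<close> only. An \<open>N\<close>-point set \<open>Y\<close> is given by an injective enumeration \<open>y :: 'N \<Rightarrow> real ^ 'n\<close>
  with \<open>N = CARD('N)\<close>, so that \<open>Y = range y\<close>.
\<close>

definition macdonald_K0 :: "real \<Rightarrow> real" where
  "macdonald_K0 x = (LBINT t:{0..}. exp (- x * cosh t))"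

definition green :: "real \<Rightarrow> real^'n \<Rightarrow> real" where
  "green \<kappa> x =
     (if CARD('n) = 2 then macdonald_K0 (\<kappa> * norm x) / (2 * pi)
      else exp (- \<kappa> * norm x) / (4 * pi * norm x))"

definition xi :: "'n::finite itself \<Rightarrow> real \<Rightarrow> real" where
  "xi _ \<kappa> =
     (if CARD('n) = 2 then - (ln (\<kappa> / 2) + euler_mascheroni) / (2 * pi)
      else - \<kappa> / (4 * pi))"

definition Gamma_matrix :: "real \<Rightarrow> ('N::finite \<Rightarrow> real^'n) \<Rightarrow> real \<Rightarrow> real^'N^'N" where
  "Gamma_matrix \<alpha> y \<kappa> =
     (\<chi> i j. if i = j then \<alpha> - xi TYPE('n) \<kappa> else - green \<kappa> (y i - y j))"

text \<open>The operator \<open>(- \<Delta> + \<kappa>\<^sup>2)\<^sup>-\<^sup>1\<close>, which has the integral kernel \<open>green \<kappa> (x - x')\<close>.\<close>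

definition free_resolvent :: "real \<Rightarrow> ((real^'n) \<Rightarrow> complex) \<Rightarrow> (real^'n) \<Rightarrow> complex" where
  "free_resolvent \<kappa> f x = (\<integral>x'. complex_of_real (green \<kappa> (x - x')) * f x' \<partial>lborel)"

text \<open>The right-hand side of Krein's formula; \<open>green\<close> is real, so the scalar product with it
  needs no complex conjugation.\<close>

definition krein_resolvent ::
  "real \<Rightarrow> ('N::finite \<Rightarrow> real^'n) \<Rightarrow> real \<Rightarrow> ((real^'n) \<Rightarrow> complex) \<Rightarrow> (real^'n) \<Rightarrow> complex" where
  "krein_resolvent \<alpha> y \<kappa> f x =
     free_resolvent \<kappa> f x +
     (\<Sum>j\<in>UNIV. \<Sum>j'\<in>UNIV.
        complex_of_real (matrix_inv (Gamma_matrix \<alpha> y \<kappa>) $ j $ j') *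
        (\<integral>x'. complex_of_real (green \<kappa> (x' - y j')) * f x' \<partial>lborel) *
        complex_of_real (green \<kappa> (x - y j)))"

text \<open>
  \<open>\<psi>\<close> is in the domain of \<open>H\<close> with \<open>H \<psi> = \<phi>\<close> iff \<open>\<psi> = (H + \<kappa>\<^sup>2)\<^sup>-\<^sup>1 (\<phi> + \<kappa>\<^sup>2 \<psi>)\<close>, where the
  resolvent is given by Krein's formula for all \<open>\<kappa> > 0\<close> for which \<open>Gamma_matrix\<close> is regular. An
  operator is determined by its resolvent at a single point; self-adjointness of \<open>H\<close> follows
  from the resolvents being symmetric and bounded.
\<close>

definition point_hamiltonian :: "real \<Rightarrow> ('N::finite \<Rightarrow> real^'n) \<Rightarrow> 'n operator" where
  "point_hamiltonian \<alpha> y =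
     {(\<psi>, \<phi>). \<psi> \<in> L2 \<and> \<phi> \<in> L2 \<and>
        (\<forall>\<kappa>>0. det (Gamma_matrix \<alpha> y \<kappa>) \<noteq> 0 \<longrightarrow>
           (AE x in lborel.
              \<psi> x = krein_resolvent \<alpha> y \<kappa> (\<lambda>x'. \<phi> x' + complex_of_real (\<kappa>\<^sup>2) * \<psi> x') x))}"

definition lambda1 :: "real \<Rightarrow> ('N::finite \<Rightarrow> real^'n) \<Rightarrow> real" where
  "lambda1 \<alpha> y = (LEAST l. eigenvalue (point_hamiltonian \<alpha> y) l)"

text \<open>The critical value of a single configuration, for \<open>\<nu> = 3\<close>.\<close>

definition alpha_crit_of :: "('N::finite \<Rightarrow> real^'n) \<Rightarrow> real" where
  "alpha_crit_of y =
     (THE c. \<forall>\<alpha>. discrete_spectrum (point_hamiltonian \<alpha> y) \<noteq> {} \<longleftrightarrow> \<alpha> < c)"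

definition configurations :: "(real^'n) set \<Rightarrow> ('N::finite \<Rightarrow> real^'n) set" where
  "configurations C = {y. inj y \<and> range y \<subseteq> C}"

definition alpha_crit :: "'N::finite itself \<Rightarrow> (real^'n) set \<Rightarrow> ereal" where
  "alpha_crit _ C =
     (if CARD('n) = 2 then \<infinity>
      else (INF y \<in> (configurations C :: ('N \<Rightarrow> real^'n) set). ereal (alpha_crit_of y)))"


section \<open>Circles, regular polygons, congruence\<close>

definition orthonormal_pair :: "real^'n \<Rightarrow> real^'n \<Rightarrow> bool" where
  "orthonormal_pair u v \<longleftrightarrow> norm u = 1 \<and> norm v = 1 \<and> u \<bullet> v = 0"

definition circle_point :: "real^'n \<Rightarrow> real^'n \<Rightarrow> real^'n \<Rightarrow> real \<Rightarrow> real^'n" where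
  "circle_point p u v t = p + cos t *\<^sub>R u + sin t *\<^sub>R v"

definition is_unit_circle :: "(real^'n) set \<Rightarrow> bool" where
  "is_unit_circle C \<longleftrightarrow> (\<exists>p u v. orthonormal_pair u v \<and> C = range (circle_point p u v))"

definition regular_polygon_in :: "(real^'n) set \<Rightarrow> nat \<Rightarrow> (real^'n) set \<Rightarrow> bool" where
  "regular_polygon_in C N Z \<longleftrightarrow>
     (\<exists>p u v. orthonormal_pair u v \<and> C = range (circle_point p u v) \<and>
        Z = (\<lambda>k. circle_point p u v (2 * pi * real k / real N)) ` {..<N})"

definition congruent_sets :: "(real^'n) set \<Rightarrow> (real^'n) set \<Rightarrow> bool" where
  "congruent_sets A B \<longleftrightarrow>
     (\<exists>f :: real^'n \<Rightarrow> real^'n. (\<forall>x z. dist (f x) (f z) = dist x z) \<and> f ` A = B)"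

end

theory Submission
  imports Defs "HOL-Probability.Probability" "HOL-Complex_Analysis.Complex_Analysis"
begin

text \<open>
  All resolvent identities come from the representation of the Green function as the Laplace transform
  of the heat kernel in the time variable, since heat kernels form a convolution semigroup. They show
  that \<open>-\<kappa>\<^sup>2\<close> is an eigenvalue iff \<open>det \<Gamma>(i\<kappa>) = 0\<close>. As \<open>\<Gamma>(i\<kappa>)\<close> is positive definite for
  large \<open>\<kappa>\<close>, the lowest eigenvalue is \<open>-\<kappa>\<^sup>2\<close> for the largest \<open>\<kappa>\<close> at which \<open>\<Gamma>(i\<kappa>)\<close> is not
  positive definite. For the regular polygon the constant vector minimises the form of \<open>\<Gamma>\<close>, because all row sums
  of the nonnegative matrix \<open>G\<^sub>i\<^sub>\<kappa>(y\<^sub>j - y\<^sub>k)\<close> agree. It therefore suffices to compare the sums of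
  \<open>G\<^sub>i\<^sub>\<kappa>(y\<^sub>j - y\<^sub>k)\<close> over all pairs: \<open>G\<^sub>i\<^sub>\<kappa>\<close> is a strictly convex function of the angle between two
  points of the circle, so Jensen's inequality, applied for each \<open>k\<close> to the angles between
  \<open>k\<close>-th neighbours, whose mean is \<open>2 \<pi> k / N\<close>, favours equal angles.

  For \<open>\<nu> = 3\<close> the hypothesis \<open>\<alpha> < \<alpha>\<^sub>c\<^sub>r\<^sub>i\<^sub>t\<close> must be turned into the existence of an eigenvalue. This
  uses that \<open>(0, \<infinity>)\<close> lies in the spectrum (Weyl sequences of modulated Gaussians) and that the zeros
  of the entire function \<open>det \<Gamma>\<close> are isolated.
\<close>

section \<open>The heat kernel\<close>

text \<open>\<open>point_hamiltonian\<close> is given only through Krein's formula, demanded at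
  every regular \<kappa> simultaneously, so neither boundary conditions nor Sobolev spaces are at
  hand. What makes the formulas at different \<kappa> compatible is one identity: the convolution of
  G_\<kappa> and G_\<kappa>', multiplied by \<kappa>'^2 - \<kappa>^2, is G_\<kappa> - G_\<kappa>'.
  On the diagonal, where both functions are singular, the difference takes the value \<xi>_\<kappa>
  - \<xi>_\<kappa>'; up to an additive constant, \<open>xi\<close> is determined by this
  requirement. Consequently \<Gamma>(i\<kappa>') - \<Gamma>(i\<kappa>) is the matrix of these
  differences. The lowest eigenvalues are compared without being computed. At the largest \<kappa>
  where the form of the polygon is not positive definite, the constant vector is inserted as a trial
  vector into the form of Y. A nonpositive value shows that the largest such parameter of Y is at
  least this \<kappa>; a negative value makes it strictly larger, because the form is continuous in
  \<kappa>.\<close>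

definition heat :: "real \<Rightarrow> real^'n \<Rightarrow> real" where
  "heat t x = exp (- (norm x)\<^sup>2 / (4 * t)) / sqrt (4 * pi * t) ^ CARD('n)"

lemma heat_nonneg [simp]: "0 \<le> t \<Longrightarrow> 0 \<le> heat t x"
  by (simp add: heat_def)

lemma borel_measurable_heat [measurable]:
  assumes [measurable]: "f \<in> borel_measurable M" "g \<in> borel_measurable M"
  shows "(\<lambda>w. heat (f w) (g w)) \<in> borel_measurable M"
  unfolding heat_def by measurable

lemma norm_sq_eq_sum_Basis: "(norm (x::'a::euclidean_space))\<^sup>2 = (\<Sum>b\<in>Basis. (x \<bullet> b)\<^sup>2)"
  by (metis (no_types, lifting) euclidean_inner power2_eq_square power2_norm_eq_inner sum.cong)

text \<open>Each coordinate is an independent centred normal variable of variance 2 * t, so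
  integrals against the heat kernel factor into one-dimensional Gaussian integrals.\<close>

lemma heat_eq_prod:
  assumes t: "t > 0"
  shows "heat t (x::real^'n) = (\<Prod>b\<in>Basis. normal_density 0 (sqrt (2 * t)) (x \<bullet> b))"
proof -
  have "(\<Prod>b\<in>Basis. normal_density 0 (sqrt (2 * t)) (x \<bullet> b)) =
      (\<Prod>b\<in>(Basis::(real^'n) set). exp (- (x \<bullet> b)\<^sup>2 / (4 * t))) / sqrt (4 * pi * t) ^ CARD('n)"
    using t by (simp add: normal_density_def prod.distrib power_divide prod_dividef mult.commute mult.left_commute)
  also have "(\<Prod>b\<in>(Basis::(real^'n) set). exp (- (x \<bullet> b)\<^sup>2 / (4 * t))) = exp (- (norm x)\<^sup>2 / (4 * t))"
    by (simp add: norm_sq_eq_sum_Basis exp_sum sum_negf sum_divide_distrib flip: exp_sum)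
  finally show ?thesis by (simp add: heat_def)
qed

lemma nn_integral_normal_density:
  assumes "0 < \<sigma>" shows "(\<integral>\<^sup>+x. ennreal (normal_density \<mu> \<sigma> x) \<partial>lborel) = 1"
  using assms by (subst nn_integral_eq_integral) auto

text \<open>The substitution x = \<sigma> u reduces to the standard normal law, whose characteristic
  function at k * \<sigma> has this integral as its real part.\<close>

lemma integral_normal_density_cos:
  assumes s: "0 < \<sigma>" shows "(\<integral>x. normal_density 0 \<sigma> x * cos (k * x) \<partial>lborel) = exp (- (k * \<sigma>)\<^sup>2 / 2)"
proof -
  have "(\<integral>x. normal_density 0 \<sigma> x * cos (k * x) \<partial>lborel)
     = \<sigma> * (\<integral>x. normal_density 0 \<sigma> (\<sigma> * x) * cos (k * (\<sigma> * x)) \<partial>lborel)"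
    using s by (subst lborel_integral_real_affine[where c=\<sigma> and t=0]) auto
  also have "\<dots> = (\<integral>x. std_normal_density x * cos (k * \<sigma> * x) \<partial>lborel)"
  proof -
    have "\<sigma> * (normal_density 0 \<sigma> (\<sigma> * x) * cos (k * (\<sigma> * x))) = std_normal_density x * cos (k * \<sigma> * x)" for x
      using s by (simp add: normal_density_def power_mult_distrib real_sqrt_mult mult.assoc)
    then show ?thesis by (simp flip: integral_mult_right_zero)
  qed
  also have "\<dots> = Re (char std_normal_distribution (k * \<sigma>))"
  proof -
    have int: "integrable lborel (\<lambda>x. std_normal_density x *\<^sub>R iexp (k * \<sigma> * x))"
      by (rule Bochner_Integration.integrable_bound[of _ std_normal_density]) auto
    have "char std_normal_distribution (k * \<sigma>) = (CLBINT x. std_normal_density x *\<^sub>R iexp (k * \<sigma> * x))"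
      unfolding char_def by (subst integral_density) auto
    then have "Re (char std_normal_distribution (k * \<sigma>)) = (\<integral>x. Re (std_normal_density x *\<^sub>R iexp (k * \<sigma> * x)) \<partial>lborel)"
      by (simp only: integral_Re[OF int])
    also have "\<dots> = (\<integral>x. std_normal_density x * cos (k * \<sigma> * x) \<partial>lborel)"
      by (simp add: Re_exp)
    finally show ?thesis by simp
  qed
  also have "\<dots> = exp (- (k * \<sigma>)\<^sup>2 / 2)"
    by (simp add: char_std_normal_distribution)
  finally show ?thesis .
qed

lemma nn_integral_heat:
  assumes t: "t > 0" shows "(\<integral>\<^sup>+x. ennreal (heat t (x::real^'n)) \<partial>lborel) = 1"
proof -
  have "(\<integral>\<^sup>+x. ennreal (heat t (x::real^'n)) \<partial>lborel) =
     (\<integral>\<^sup>+x. (\<Prod>b\<in>Basis. ennreal (normal_density 0 (sqrt (2 * t)) ((x::real^'n) \<bullet> b))) \<partial>lborel)"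
    using t by (simp add: heat_eq_prod prod_ennreal)
  also have "\<dots> = 1"
    using t by (subst nn_integral_lborel_prod) (auto simp: nn_integral_normal_density)
  finally show ?thesis .
qed

text \<open>The summand \<open>1\<close> makes the integrand nonnegative, so that Tonelli's theorem applies.\<close>

lemma nn_integral_heat_cos:
  assumes t: "t > 0" and b0: "b0 \<in> Basis"
  shows "(\<integral>\<^sup>+x. ennreal (heat t (x::real^'n) * (1 + cos (k * (x \<bullet> b0)))) \<partial>lborel) = ennreal (1 + exp (- (k\<^sup>2 * t)))"
proof -
  define f where "f = (\<lambda>b s. normal_density 0 (sqrt (2 * t)) s * (if b = b0 then 1 + cos (k * s) else 1))"
  have cosge: "0 \<le> 1 + cos u" for u :: real using cos_ge_minus_one[of u] by linarith
  have f0: "0 \<le> f b s" for b s using cosge by (auto simp: f_def)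
  have [measurable]: "f b \<in> borel_measurable borel" for b unfolding f_def by (cases "b = b0") simp_all
  have "heat t x * (1 + cos (k * (x \<bullet> b0))) = (\<Prod>b\<in>Basis. f b (x \<bullet> b))" for x :: "real^'n"
    using t b0 by (simp add: heat_eq_prod f_def prod.distrib)
  then have "(\<integral>\<^sup>+x. ennreal (heat t (x::real^'n) * (1 + cos (k * (x \<bullet> b0)))) \<partial>lborel) =
     (\<integral>\<^sup>+x. (\<Prod>b\<in>Basis. ennreal (f b ((x::real^'n) \<bullet> b))) \<partial>lborel)"
    using f0 by (simp add: prod_ennreal)
  also have "\<dots> = (\<Prod>b\<in>(Basis::(real^'n) set). (\<integral>\<^sup>+s. ennreal (f b s) \<partial>lborel))"
    by (subst nn_integral_lborel_prod) auto
  also have "\<dots> = (\<Prod>b\<in>(Basis::(real^'n) set). if b = b0 then ennreal (1 + exp (- (k\<^sup>2 * t))) else 1)"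
  proof (rule prod.cong[OF refl])
    fix b :: "real^'n" assume "b \<in> Basis"
    show "(\<integral>\<^sup>+s. ennreal (f b s) \<partial>lborel) = (if b = b0 then ennreal (1 + exp (- (k\<^sup>2 * t))) else 1)"
    proof (cases "b = b0")
      case True
      have i1: "integrable lborel (normal_density 0 (sqrt (2 * t)))" using t by auto
      have i2: "integrable lborel (\<lambda>s. normal_density 0 (sqrt (2 * t)) s * cos (k * s))"
        by (rule Bochner_Integration.integrable_bound[OF i1])
          (auto intro!: mult_left_le simp: abs_mult)
      have "f b = (\<lambda>s. normal_density 0 (sqrt (2 * t)) s + normal_density 0 (sqrt (2 * t)) s * cos (k * s))"
        using True by (auto simp: f_def algebra_simps)
      then have "integrable lborel (f b)" "integral\<^sup>L lborel (f b) = 1 + exp (- (k\<^sup>2 * t))"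
        using i1 i2 t by (auto simp: integral_normal_density_cos power_mult_distrib)
      then show ?thesis using True f0 by (subst nn_integral_eq_integral) auto
    next
      case False
      then show ?thesis using t by (simp add: f_def nn_integral_normal_density)
    qed
  qed
  also have "\<dots> = ennreal (1 + exp (- (k\<^sup>2 * t)))"
    using b0 by simp
  finally show ?thesis .
qed

section \<open>Invariance of Lebesgue measure and the semigroup law of the heat kernel\<close>

lemma nn_integral_lborel_translate:
  fixes f :: "'a::euclidean_space \<Rightarrow> ennreal"
  assumes [measurable]: "f \<in> borel_measurable borel"
  shows "(\<integral>\<^sup>+x. f (c + x) \<partial>lborel) = (\<integral>\<^sup>+x. f x \<partial>lborel)"
proof -
  have "(\<integral>\<^sup>+x. f x \<partial>lborel) = (\<integral>\<^sup>+x. f x \<partial>(distr lborel borel ((+) c)))"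
    by (simp add: lborel_distr_plus)
  also have "\<dots> = (\<integral>\<^sup>+x. f (c + x) \<partial>lborel)"
    by (rule nn_integral_distr) auto
  finally show ?thesis by simp
qed

lemma nn_integral_lborel_reflect:
  fixes f :: "'a::euclidean_space \<Rightarrow> ennreal"
  assumes [measurable]: "f \<in> borel_measurable borel"
  shows "(\<integral>\<^sup>+x. f (c - x) \<partial>lborel) = (\<integral>\<^sup>+x. f x \<partial>lborel)"
proof -
  have "(lborel :: 'a measure) = distr lborel borel (\<lambda>x. c - x)"
    using lborel_affine[of "-1" c] by (simp add: density_1)
  then have "(\<integral>\<^sup>+x. f x \<partial>lborel) = (\<integral>\<^sup>+x. f x \<partial>(distr lborel borel (\<lambda>x. c - x)))"
    by simp
  also have "\<dots> = (\<integral>\<^sup>+x. f (c - x) \<partial>lborel)"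
    by (rule nn_integral_distr) auto
  finally show ?thesis by simp
qed

text \<open>Completing the square in z: the product of two Gaussians is a Gaussian in z around a
  weighted mean of x and y, with time s * t / (s + t), times a factor free of z. Integration over z
  then leaves the semigroup law.\<close>

lemma heat_mult:
  assumes s: "s > 0" and t: "t > 0"
  shows "heat s (x - z) * heat t (z - y) =
    heat (s + t) (x - y) * heat (s * t / (s + t)) ((- ((t / (s + t)) *\<^sub>R x + (s / (s + t)) *\<^sub>R y)) + (z::real^'n))"
proof -
  have st: "s + t > 0" using s t by simp
  define m where "m = (t / (s + t)) *\<^sub>R x + (s / (s + t)) *\<^sub>R y"
  have "(norm (x - z))\<^sup>2 / (4 * s) + (norm (z - y))\<^sup>2 / (4 * t)
      = (norm (x - y))\<^sup>2 / (4 * (s + t)) + (norm (z - m))\<^sup>2 / (4 * (s * t / (s + t)))"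
  proof -
    have e: "(norm (x - z))\<^sup>2 = x \<bullet> x - 2 * (x \<bullet> z) + z \<bullet> z"
      "(norm (z - y))\<^sup>2 = z \<bullet> z - 2 * (y \<bullet> z) + y \<bullet> y"
      "(norm (x - y))\<^sup>2 = x \<bullet> x - 2 * (x \<bullet> y) + y \<bullet> y"
      by (simp_all add: power2_norm_eq_inner inner_diff_left inner_diff_right inner_commute)
    have e4: "(norm (z - m))\<^sup>2 = z \<bullet> z - 2 * (t / (s + t) * (x \<bullet> z) + s / (s + t) * (y \<bullet> z))
       + (t / (s + t))\<^sup>2 * (x \<bullet> x) + 2 * (t / (s + t)) * (s / (s + t)) * (x \<bullet> y) + (s / (s + t))\<^sup>2 * (y \<bullet> y)"
      unfolding m_def power2_norm_eq_inner
      by (simp add: inner_diff_left inner_diff_right inner_add_left inner_add_right inner_commute power2_eq_square algebra_simps)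
    show ?thesis unfolding e e4 using s t st
      by (simp add: divide_simps power2_eq_square) algebra
  qed
  moreover have "sqrt (4 * pi * s) * sqrt (4 * pi * t) = sqrt (4 * pi * (s + t)) * sqrt (4 * pi * (s * t / (s + t)))"
    using s t st by (simp add: divide_simps flip: real_sqrt_mult)
  ultimately show ?thesis
    by (simp add: heat_def m_def[symmetric] mult_exp_exp power_mult_distrib[symmetric] add_divide_distrib minus_divide_left[symmetric])
qed

lemma nn_integral_heat_conv:
  assumes s: "s > 0" and t: "t > 0"
  shows "(\<integral>\<^sup>+z. ennreal (heat s (x - z)) * ennreal (heat t (z - y)) \<partial>lborel) = ennreal (heat (s + t) (x - (y::real^'n)))"
proof -
  let ?r = "s * t / (s + t)"
  have r: "?r > 0" using s t by simp
  define m where "m = - ((t / (s + t)) *\<^sub>R x + (s / (s + t)) *\<^sub>R y)"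
  have "ennreal (heat s (x - z)) * ennreal (heat t (z - y)) = ennreal (heat (s + t) (x - y)) * ennreal (heat ?r (m + z))" for z
    using s t r heat_mult[OF s t, of x z y] unfolding m_def[symmetric] by (subst (1 2) ennreal_mult[symmetric]) auto
  then have "(\<integral>\<^sup>+z. ennreal (heat s (x - z)) * ennreal (heat t (z - y)) \<partial>lborel) =
    (\<integral>\<^sup>+z. ennreal (heat (s + t) (x - y)) * ennreal (heat ?r (m + z)) \<partial>lborel)"
    by simp
  also have "\<dots> = ennreal (heat (s + t) (x - y)) * (\<integral>\<^sup>+z. ennreal (heat ?r (z::real^'n)) \<partial>lborel)"
    by (simp add: nn_integral_cmult nn_integral_lborel_translate[of "\<lambda>z. ennreal (heat ?r (z::real^'n))"])
  also have "\<dots> = ennreal (heat (s + t) (x - y))"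
    using nn_integral_heat[OF r, where 'n='n] by simp
  finally show ?thesis .
qed

section \<open>Substitutions in Lebesgue integrals\<close>

text \<open>Monotone convergence extends the substitution rule from compact intervals to the real line.\<close>

lemma nn_integral_substitution_real_line:
  fixes f g g' :: "real \<Rightarrow> real"
  assumes [measurable]: "f \<in> borel_measurable borel" "g \<in> borel_measurable borel"
    and g: "\<And>x. (g has_real_derivative g' x) (at x)"
    and cont: "continuous_on UNIV g'"
    and nonneg: "\<And>x. 0 \<le> g' x"
    and range: "(\<Union>n::nat. {g (- real n)..g (real n)}) = A"
  shows "(\<integral>\<^sup>+x. ennreal (f x) * indicator A x \<partial>lborel) = (\<integral>\<^sup>+u. ennreal (f (g u) * g' u) \<partial>lborel)"
proof -
  have [measurable]: "g' \<in> borel_measurable borel"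
    using cont by (rule borel_measurable_continuous_onI)
  have mono: "g a \<le> g b" if "a \<le> b" for a b
    using deriv_nonneg_imp_mono[of a b g g'] g nonneg that by auto
  have inc1: "incseq (\<lambda>n::nat. \<lambda>x. ennreal (f x) * indicator {g (- real n)..g (real n)} x)"
  proof (rule incseq_SucI, rule le_funI)
    fix n :: nat and x :: real
    have "g (- real (Suc n)) \<le> g (- real n)" "g (real n) \<le> g (real (Suc n))"
      by (auto intro: mono)
    then show "ennreal (f x) * indicator {g (- real n)..g (real n)} x \<le> ennreal (f x) * indicator {g (- real (Suc n))..g (real (Suc n))} x"
      by (intro mult_left_mono) (auto simp: indicator_def)
  qed
  have inc2: "incseq (\<lambda>n::nat. \<lambda>u. ennreal (f (g u) * g' u) * indicator {- real n..real n} u)"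
    by (intro incseq_SucI le_funI mult_left_mono) (auto simp: indicator_def)
  have sup1: "(SUP n::nat. ennreal (f x) * indicator {g (- real n)..g (real n)} x) = ennreal (f x) * indicator A x" for x
  proof -
    have "(SUP n::nat. indicator {g (- real n)..g (real n)} x :: ennreal) = indicator A x"
    proof (cases "x \<in> A")
      case True
      then obtain n :: nat where "x \<in> {g (- real n)..g (real n)}" using range by auto
      then have "1 \<le> (SUP n::nat. indicator {g (- real n)..g (real n)} x :: ennreal)"
        by (intro SUP_upper2[of n]) auto
      moreover have "(SUP n::nat. indicator {g (- real n)..g (real n)} x :: ennreal) \<le> 1"
        by (intro SUP_least) (auto simp: indicator_def)
      ultimately have "(SUP n::nat. indicator {g (- real n)..g (real n)} x :: ennreal) = 1"
        by (rule antisym[rotated])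
      then show ?thesis using True by simp
    next
      case False
      then have "x \<notin> {g (- real n)..g (real n)}" for n using range by auto
      then show ?thesis using False by (simp add: indicator_def del: atLeastAtMost_iff)
    qed
    then show ?thesis by (simp only: SUP_mult_left_ennreal[symmetric])
  qed
  have sup2: "(SUP n::nat. ennreal (f (g u) * g' u) * indicator {- real n..real n} u) = ennreal (f (g u) * g' u)" for u
  proof -
    obtain n :: nat where "\<bar>u\<bar> \<le> real n" using real_arch_simple by blast
    then have "u \<in> {- real n..real n}" by auto
    then have "1 \<le> (SUP n::nat. indicator {- real n..real n} u :: ennreal)"
      by (intro SUP_upper2[of n]) auto
    moreover have "(SUP n::nat. indicator {- real n..real n} u :: ennreal) \<le> 1"
      by (intro SUP_least) (auto simp: indicator_def)
    ultimately have "(SUP n::nat. indicator {- real n..real n} u :: ennreal) = 1" by (rule antisym[rotated])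
    then show ?thesis by (simp only: SUP_mult_left_ennreal[symmetric] mult_1_right)
  qed
  have "(\<integral>\<^sup>+x. ennreal (f x) * indicator A x \<partial>lborel)
      = (SUP n::nat. \<integral>\<^sup>+x. ennreal (f x) * indicator {g (- real n)..g (real n)} x \<partial>lborel)"
    by (subst nn_integral_monotone_convergence_SUP[symmetric]) (use inc1 sup1 in simp_all)
  also have "\<dots> = (SUP n::nat. \<integral>\<^sup>+u. ennreal (f (g u) * g' u) * indicator {- real n..real n} u \<partial>lborel)"
  proof (intro SUP_cong refl)
    fix n :: nat
    have ind: "ennreal (h x * indicator S x) = ennreal (h x) * indicator S x" for x :: real and S :: "real set" and h :: "real \<Rightarrow> real"
      by (auto simp: indicator_def)
    have "(\<integral>\<^sup>+x. ennreal (f x * indicator {g (- real n)..g (real n)} x) \<partial>lborel)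
       = (\<integral>\<^sup>+u. ennreal (f (g u) * g' u * indicator {- real n..real n} u) \<partial>lborel)"
      by (rule nn_integral_substitution)
        (auto simp: set_borel_measurable_def g nonneg intro: continuous_on_subset[OF cont])
    then show "(\<integral>\<^sup>+x. ennreal (f x) * indicator {g (- real n)..g (real n)} x \<partial>lborel)
       = (\<integral>\<^sup>+u. ennreal (f (g u) * g' u) * indicator {- real n..real n} u \<partial>lborel)"
      by (simp only: ind[where h=f] ind[where h="\<lambda>u. f (g u) * g' u"])
  qed
  also have "\<dots> = (\<integral>\<^sup>+u. ennreal (f (g u) * g' u) \<partial>lborel)"
    by (subst nn_integral_monotone_convergence_SUP[symmetric]) (use inc2 sup2 in simp_all)
  finally show ?thesis .
qed

text \<open>The scale c stays free so that a later choice can make the exponent symmetric in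
  u.\<close>

lemma nn_integral_substitution_exp:
  fixes f :: "real \<Rightarrow> real"
  assumes [measurable]: "f \<in> borel_measurable borel" and c: "c > 0"
  shows "(\<integral>\<^sup>+t. ennreal (f t) * indicator {0<..} t \<partial>lborel) = (\<integral>\<^sup>+u. ennreal (f (c * exp u) * (c * exp u)) \<partial>lborel)"
proof (rule nn_integral_substitution_real_line)
  show "(\<Union>n::nat. {c * exp (- real n)..c * exp (real n)}) = {0<..}"
  proof safe
    fix n :: nat and x assume "x \<in> {c * exp (- real n)..c * exp (real n)}"
    moreover have "0 < c * exp (- real n)" using c by simp
    ultimately show "0 < x" by (meson atLeastAtMost_iff less_le_trans)
  next
    fix x :: real assume "0 < x"
    obtain n :: nat where n: "\<bar>ln (x / c)\<bar> \<le> real n" using real_arch_simple by blast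
    have x: "x = c * exp (ln (x / c))" using c \<open>0 < x\<close> by simp
    have "c * exp (- real n) \<le> c * exp (ln (x / c))" "c * exp (ln (x / c)) \<le> c * exp (real n)"
      using n c by (auto simp only: mult_le_cancel_left_pos exp_le_cancel_iff)
    then show "x \<in> (\<Union>n::nat. {c * exp (- real n)..c * exp (real n)})" using x by auto
  qed
qed (use c in \<open>auto intro!: derivative_eq_intros continuous_intros\<close>)

section \<open>Integrals of exponentials of the hyperbolic cosine\<close>

lemma borel_measurable_cosh [measurable]: "(cosh :: real \<Rightarrow> real) \<in> borel_measurable borel"
  by (intro borel_measurable_continuous_onI continuous_intros)

text \<open>A crude bound, but it dominates exp (- x * cosh u) by a Gaussian and thereby gives
  integrability.\<close>

lemma cosh_ge_quadratic: "u\<^sup>2 / 4 \<le> cosh (u::real)"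
proof -
  have "1 + \<bar>u\<bar> + \<bar>u\<bar>\<^sup>2 / 2 \<le> exp \<bar>u\<bar>" by (rule exp_lower_Taylor_quadratic) simp
  then have "u\<^sup>2 / 2 \<le> exp \<bar>u\<bar>" by (simp add: power2_abs)
  moreover have "exp \<bar>u\<bar> \<le> 2 * cosh u" by (auto simp: cosh_def abs_if)
  ultimately show ?thesis by linarith
qed

lemma nn_integral_gaussian:
  assumes a: "a > 0" shows "(\<integral>\<^sup>+x. ennreal (exp (- a * x\<^sup>2)) \<partial>lborel) = ennreal (sqrt (pi / a))"
proof -
  define s where "s = sqrt (1 / (2 * a))"
  have s: "s > 0" "s\<^sup>2 = 1 / (2 * a)" using a by (auto simp: s_def)
  have "x\<^sup>2 / (2 * s\<^sup>2) = a * x\<^sup>2" "2 * pi * s\<^sup>2 = pi / a" for x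
    using a by (simp_all add: s(2))
  then have "exp (- a * x\<^sup>2) = sqrt (pi / a) * normal_density 0 s x" for x
    using a by (simp add: normal_density_def)
  then have "(\<integral>\<^sup>+x. ennreal (exp (- a * x\<^sup>2)) \<partial>lborel) = (\<integral>\<^sup>+x. ennreal (sqrt (pi / a)) * ennreal (normal_density 0 s x) \<partial>lborel)"
    using a by (simp add: ennreal_mult)
  also have "\<dots> = ennreal (sqrt (pi / a)) * (\<integral>\<^sup>+x. ennreal (normal_density 0 s x) \<partial>lborel)"
    by (rule nn_integral_cmult) simp
  also have "(\<integral>\<^sup>+x. ennreal (normal_density 0 s x) \<partial>lborel) = 1"
    using s by (subst nn_integral_eq_integral) auto
  finally show ?thesis by simp
qed

lemma integrable_exp_cosh:
  assumes x: "(x::real) > 0" shows "integrable lborel (\<lambda>u::real. exp (- x * cosh u))"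
proof (rule integrableI_bounded)
  have "(\<integral>\<^sup>+u. ennreal (norm (exp (- x * cosh u))) \<partial>lborel) \<le> (\<integral>\<^sup>+u. ennreal (exp (- (x / 4) * u\<^sup>2)) \<partial>lborel)"
    using cosh_ge_quadratic x by (intro nn_integral_mono) (simp add: field_simps)
  also have "\<dots> < \<infinity>" using x by (subst nn_integral_gaussian) auto
  finally show "(\<integral>\<^sup>+u. ennreal (norm (exp (- x * cosh u))) \<partial>lborel) < \<infinity>" .
qed simp

lemma set_integrable_K0: "(x::real) > 0 \<Longrightarrow> set_integrable lborel {0..} (\<lambda>t::real. exp (- x * cosh t))"
  unfolding set_integrable_def by (intro integrable_mult_indicator integrable_exp_cosh) simp_all

lemma nn_integral_exp_cosh:
  assumes x: "x > 0" shows "(\<integral>\<^sup>+u. ennreal (exp (- x * cosh u)) \<partial>lborel) = ennreal (2 * macdonald_K0 x)"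
proof -
  let ?f = "\<lambda>u. exp (- x * cosh u)"
  have K: "macdonald_K0 x = (\<integral>u. indicator {0..} u * ?f u \<partial>lborel)"
    by (simp add: macdonald_K0_def set_lebesgue_integral_def)
  have i: "integrable lborel (\<lambda>u. indicator {0..} u * ?f u)"
    using set_integrable_K0[OF x] by (simp add: set_integrable_def)
  have i': "integrable lborel (\<lambda>u. indicator {0..} (- u) * ?f (- u))"
    using lborel_integrable_real_affine[OF i, of "-1" 0] by simp
  have "(\<integral>u. ?f u \<partial>lborel) = (\<integral>u. indicator {0..} u * ?f u + indicator {0..} (- u) * ?f (- u) \<partial>lborel)"
  proof (rule integral_cong_AE)
    show "AE u in lborel. ?f u = indicator {0..} u * ?f u + indicator {0..} (- u) * ?f (- u)"
      using AE_lborel_singleton[of 0] by eventually_elim (auto simp: indicator_def)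
  qed auto
  also have "\<dots> = macdonald_K0 x + (\<integral>u. indicator {0..} (- u) * ?f (- u) \<partial>lborel)"
    using i i' K by simp
  also have "(\<integral>u. indicator {0..} (- u) * ?f (- u) \<partial>lborel) = macdonald_K0 x"
    unfolding K by (subst lborel_integral_real_affine[where c="-1" and t=0]) auto
  finally show ?thesis
    using nn_integral_eq_integral[OF integrable_exp_cosh[OF x]] by simp
qed

text \<open>This is the elementary Macdonald function of order 1/2. Adding the integral reflected by
  u to - u produces the factor cosh (u / 2), which up to a constant is the derivative of w = sinh (u
  / 2); as cosh u = 1 + 2 w^2, a Gaussian integral in w remains.\<close>

lemma nn_integral_exp_cosh_half:
  assumes x: "x > 0"
  shows "(\<integral>\<^sup>+u. ennreal (exp (- x * cosh u - u / 2)) \<partial>lborel) = ennreal (sqrt (2 * pi / x) * exp (- x))"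
proof -
  let ?I = "\<integral>\<^sup>+u. ennreal (exp (- x * cosh u - u / 2)) \<partial>lborel"
  have x2: "2 * x > 0" using x by simp
  have "?I = (\<integral>\<^sup>+u. ennreal (exp (- x * cosh u + u / 2)) \<partial>lborel)"
    by (subst nn_integral_real_affine[where c="-1" and t=0]) auto
  then have "?I + ?I = (\<integral>\<^sup>+u. ennreal (exp (- x * cosh u - u / 2)) + ennreal (exp (- x * cosh u + u / 2)) \<partial>lborel)"
    by (subst nn_integral_add) auto
  also have "\<dots> = (\<integral>\<^sup>+u. ennreal (4 * exp (- x) * exp (- (2 * x) * (sinh (u / 2))\<^sup>2) * (cosh (u / 2) / 2)) \<partial>lborel)"
  proof (intro nn_integral_cong)
    fix u :: real
    have E: "a * b * (2 * c) = 4 * a * b * (c / 2)" for a b c :: real by simp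
    have c: "cosh u = 1 + 2 * (sinh (u / 2))\<^sup>2"
      using cosh_double_cosh[of "u / 2"] cosh_square_eq[of "u / 2"] by simp
    have "exp (- x * cosh u - u / 2) + exp (- x * cosh u + u / 2) = exp (- x * cosh u) * (2 * cosh (u / 2))"
    proof -
      have "exp (- x * cosh u - u / 2) = exp (- x * cosh u) * exp (- (u / 2))"
        "exp (- x * cosh u + u / 2) = exp (- x * cosh u) * exp (u / 2)"
        by (simp_all only: mult_exp_exp) simp
      then show ?thesis by (simp add: cosh_def field_simps)
    qed
    also have "exp (- x * cosh u) = exp (- x) * exp (- (2 * x) * (sinh (u / 2))\<^sup>2)"
      unfolding c mult_exp_exp by (simp add: algebra_simps)
    also have "exp (- x) * exp (- (2 * x) * (sinh (u / 2))\<^sup>2) * (2 * cosh (u / 2)) = 4 * exp (- x) * exp (- (2 * x) * (sinh (u / 2))\<^sup>2) * (cosh (u / 2) / 2)"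
      by (rule E)
    finally show "ennreal (exp (- x * cosh u - u / 2)) + ennreal (exp (- x * cosh u + u / 2)) =
        ennreal (4 * exp (- x) * exp (- (2 * x) * (sinh (u / 2))\<^sup>2) * (cosh (u / 2) / 2))"
      by (subst ennreal_plus[symmetric]) (simp_all only: exp_ge_zero)
  qed
  also have "\<dots> = (\<integral>\<^sup>+w. ennreal (4 * exp (- x) * exp (- (2 * x) * w\<^sup>2)) * indicator UNIV w \<partial>lborel)"
  proof (rule nn_integral_substitution_real_line[symmetric])
    show "(\<Union>n::nat. {sinh (- real n / 2)..sinh (real n / 2)}) = UNIV"
    proof safe
      fix w :: real
      obtain n :: nat where n: "\<bar>2 * arsinh w\<bar> \<le> real n" using real_arch_simple by blast
      have "sinh (- real n / 2) \<le> sinh (arsinh w)" "sinh (arsinh w) \<le> sinh (real n / 2)"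
        using n by (simp_all only: sinh_real_le_iff)
      then show "w \<in> (\<Union>n::nat. {sinh (- real n / 2)..sinh (real n / 2)})" by (auto intro!: exI[of _ n])
    qed simp
  qed (auto intro!: derivative_eq_intros continuous_intros borel_measurable_continuous_onI)
  also have "\<dots> = (\<integral>\<^sup>+w. ennreal (4 * exp (- x)) * ennreal (exp (- (2 * x) * w\<^sup>2)) \<partial>lborel)"
    by (simp add: ennreal_mult mult.assoc)
  also have "\<dots> = ennreal (4 * exp (- x)) * ennreal (sqrt (pi / (2 * x)))"
    by (subst nn_integral_cmult) (simp_all only: nn_integral_gaussian[OF x2], measurable)
  also have "\<dots> = ennreal (2 * (sqrt (2 * pi / x) * exp (- x)))"
  proof -
    have "sqrt (2 * pi / x) = sqrt (2\<^sup>2 * (pi / (2 * x)))" by (simp add: power2_eq_square)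
    also have "\<dots> = 2 * sqrt (pi / (2 * x))" by (simp only: real_sqrt_mult) simp
    finally have q: "sqrt (2 * pi / x) = 2 * sqrt (pi / (2 * x))" .
    have "4 * e * s = 2 * (2 * s * e)" for e s :: real by simp
    then show ?thesis unfolding q using x by (subst ennreal_mult[symmetric]) simp_all
  qed
  finally have "2 * ?I = 2 * ennreal (sqrt (2 * pi / x) * exp (- x))"
    using x by (subst (2) ennreal_numeral[symmetric], subst ennreal_mult[symmetric]) (simp_all add: mult_2[symmetric])
  then show ?thesis
    by (simp add: ennreal_mult_cancel_left)
qed

section \<open>The Green function as a Laplace transform of the heat kernel\<close>

text \<open>For \<nu> = 2 and \<nu> = 3 the value at the origin is infinite, whereas
  \<open>green\<close> is 0 there by the conventions for division by zero and for integrals of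
  nonintegrable functions. The two functions are therefore identified only off the origin, or almost
  everywhere.\<close>

definition heat_laplace :: "real \<Rightarrow> real^'n \<Rightarrow> ennreal" where
  "heat_laplace \<kappa> w = (\<integral>\<^sup>+t. ennreal (exp (- \<kappa>\<^sup>2 * t) * heat t w) * indicator {0<..} t \<partial>lborel)"

lemma macdonald_K0_nonneg: "0 \<le> macdonald_K0 x"
  unfolding macdonald_K0_def set_lebesgue_integral_def by (intro Bochner_Integration.integral_nonneg) simp

lemma borel_measurable_K0 [measurable]: "macdonald_K0 \<in> borel_measurable borel"
  unfolding macdonald_K0_def set_lebesgue_integral_def by measurable

lemma green_nonneg [simp]: "0 \<le> green \<kappa> (x :: real^'n)"
  by (simp add: green_def macdonald_K0_nonneg)

lemma green_minus: "green \<kappa> (- (x :: real^'n)) = green \<kappa> x"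
  by (simp add: green_def)

lemma green_commute: "green \<kappa> (x - y :: real^'n) = green \<kappa> (y - x)"
  by (simp add: green_def norm_minus_commute)

lemma borel_measurable_green [measurable]: "(green \<kappa> :: real^'n \<Rightarrow> real) \<in> borel_measurable borel"
  unfolding green_def by (cases "CARD('n) = 2") simp_all

lemma sqrt_exp: "sqrt (exp u) = exp (u / 2)"
  by (rule real_sqrt_unique) (simp_all flip: exp_double)

text \<open>In dimension two the factor 1 / t of the heat kernel cancels the Jacobian and leaves the
  integral of \<open>macdonald_K0\<close>; in dimension three an extra exp (- u / 2) remains, for
  which the integral is elementary.\<close>

lemma heat_laplace_eq_green:
  assumes "CARD('n) = 2 \<or> CARD('n) = 3" and k: "\<kappa> > 0" and x: "x \<noteq> (0 :: real^'n)"
  shows "heat_laplace \<kappa> x = ennreal (green \<kappa> x)"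
proof -
  define r where "r = norm x"
  have r: "r > 0" using x by (simp add: r_def)
  \<comment> \<open>At t = c the two exponents \<kappa>^2 * t and r^2 / (4 * t) agree, so that t = c
    * exp u turns their sum into \<kappa> * r * cosh u.\<close>
  define c where "c = r / (2 * \<kappa>)"
  have c: "c > 0" using r k by (simp add: c_def)
  have ex: "exp (- \<kappa>\<^sup>2 * (c * exp u)) * exp (- r\<^sup>2 / (4 * (c * exp u))) = exp (- (\<kappa> * r) * cosh u)" for u
    unfolding mult_exp_exp using r k
    by (simp add: c_def cosh_def exp_minus field_simps power2_eq_square)
  have "heat_laplace \<kappa> x = (\<integral>\<^sup>+u. ennreal (exp (- \<kappa>\<^sup>2 * (c * exp u)) * heat (c * exp u) x * (c * exp u)) \<partial>lborel)"
    unfolding heat_laplace_def using c by (intro nn_integral_substitution_exp) simp_all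
  also have "\<dots> = ennreal (green \<kappa> x)"
    using assms(1)
  proof
    assume d: "CARD('n) = 2"
    have "exp (- \<kappa>\<^sup>2 * (c * exp u)) * heat (c * exp u) x * (c * exp u) = 1 / (4 * pi) * exp (- (\<kappa> * r) * cosh u)" for u
    proof -
      have "heat (c * exp u) x * (c * exp u) = 1 / (4 * pi) * exp (- r\<^sup>2 / (4 * (c * exp u)))"
        using c by (simp add: heat_def d r_def[symmetric])
      then show ?thesis
        unfolding ex[symmetric] by (simp only: mult.assoc) (simp only: mult_ac)
    qed
    then have "(\<integral>\<^sup>+u. ennreal (exp (- \<kappa>\<^sup>2 * (c * exp u)) * heat (c * exp u) x * (c * exp u)) \<partial>lborel) =
      (\<integral>\<^sup>+u. ennreal (1 / (4 * pi)) * ennreal (exp (- (\<kappa> * r) * cosh u)) \<partial>lborel)"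
      by (simp only: ennreal_mult'' exp_ge_zero)
    also have "\<dots> = ennreal (1 / (4 * pi)) * ennreal (2 * macdonald_K0 (\<kappa> * r))"
      using r k nn_integral_exp_cosh[of "\<kappa> * r"] by (subst nn_integral_cmult) simp_all
    also have "\<dots> = ennreal (green \<kappa> x)"
      using macdonald_K0_nonneg[of "\<kappa> * r"] by (subst ennreal_mult[symmetric]) (auto simp: green_def d r_def)
    finally show ?thesis .
  next
    assume d: "CARD('n) = 3"
    define A where "A = 1 / (4 * pi * sqrt (4 * pi * c))"
    have A: "A > 0" using c by (simp add: A_def)
    have "exp (- \<kappa>\<^sup>2 * (c * exp u)) * heat (c * exp u) x * (c * exp u) = A * exp (- (\<kappa> * r) * cosh u - u / 2)" for u
    proof -
      have "sqrt (4 * pi * (c * exp u)) ^ 3 = 4 * pi * (c * exp u) * sqrt (4 * pi * (c * exp u))" using c by (simp add: power3_eq_cube)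
      moreover have "sqrt (4 * pi * (c * exp u)) = sqrt (4 * pi * c) * exp (u / 2)"
        using c by (simp add: real_sqrt_mult sqrt_exp)
      ultimately have "sqrt (4 * pi * (c * exp u)) ^ 3 = 4 * pi * (c * exp u) * (sqrt (4 * pi * c) * exp (u / 2))" by metis
      then have q: "sqrt (4 * pi * (c * exp u)) ^ 3 = c * exp u * exp (u / 2) / A" by (simp add: A_def)
      have "heat (c * exp u) x * (c * exp u) = A * exp (- r\<^sup>2 / (4 * (c * exp u))) * exp (- (u / 2))"
        unfolding heat_def d q r_def[symmetric] using c by (simp add: exp_minus divide_simps)
      then have "exp (- \<kappa>\<^sup>2 * (c * exp u)) * (heat (c * exp u) x * (c * exp u)) = A * exp (- (\<kappa> * r) * cosh u) * exp (- (u / 2))"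
        unfolding ex[symmetric] by simp
      also have "\<dots> = A * exp (- (\<kappa> * r) * cosh u - u / 2)"
        by (simp only: mult.assoc mult_exp_exp diff_conv_add_uminus)
      finally show ?thesis by (simp only: mult.assoc)
    qed
    then have "(\<integral>\<^sup>+u. ennreal (exp (- \<kappa>\<^sup>2 * (c * exp u)) * heat (c * exp u) x * (c * exp u)) \<partial>lborel) =
      (\<integral>\<^sup>+u. ennreal A * ennreal (exp (- (\<kappa> * r) * cosh u - u / 2)) \<partial>lborel)"
      by (simp only: ennreal_mult'' exp_ge_zero)
    also have "\<dots> = ennreal A * ennreal (sqrt (2 * pi / (\<kappa> * r)) * exp (- (\<kappa> * r)))"
      using r k nn_integral_exp_cosh_half[of "\<kappa> * r"] by (subst nn_integral_cmult) simp_all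
    also have "\<dots> = ennreal (A * (sqrt (2 * pi / (\<kappa> * r)) * exp (- (\<kappa> * r))))"
      using A k r by (subst ennreal_mult[symmetric]) simp_all
    also have "A * (sqrt (2 * pi / (\<kappa> * r)) * exp (- (\<kappa> * r))) = green \<kappa> x"
    proof -
      have "sqrt (2 * pi / (\<kappa> * r)) = sqrt (4 * pi * c / r\<^sup>2)"
        using r k by (simp add: c_def power2_eq_square divide_simps)
      also have "\<dots> = sqrt (4 * pi * c) / r" using r by (simp add: real_sqrt_divide)
      finally have q: "sqrt (2 * pi / (\<kappa> * r)) = sqrt (4 * pi * c) / r" .
      have "sqrt (4 * pi * c) > 0" using c by simp
      then show ?thesis unfolding q A_def green_def d r_def[symmetric] using r c by (simp add: divide_simps)
    qed
    finally show ?thesis .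
  qed
  finally show ?thesis .
qed

lemma nn_integral_exp_Ioi:
  assumes a: "a > 0"
  shows "(\<integral>\<^sup>+t. ennreal (exp (- a * t)) * indicator {0<..} t \<partial>lborel) = ennreal (1 / a)"
proof -
  have "(\<integral>\<^sup>+t. ennreal (exp (- a * t)) * indicator {0<..} t \<partial>lborel) = (\<integral>\<^sup>+t. ennreal (exp (- a * t)) * indicator {0..} t \<partial>lborel)"
    by (intro nn_integral_cong_AE, use AE_lborel_singleton[of 0] in eventually_elim) (auto simp: indicator_def)
  also have "\<dots> = ennreal (0 - (- exp (- a * 0) / a))"
  proof (rule nn_integral_FTC_atLeast)
    have "((\<lambda>t. - exp (- (a * t)) / a) \<longlongrightarrow> 0) at_top"
      using a by real_asymp
    then show "((\<lambda>t. - exp (- a * t) / a) \<longlongrightarrow> 0) at_top" by simp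
  qed (use a in \<open>auto intro!: derivative_eq_intros\<close>)
  finally show ?thesis by simp
qed

text \<open>Tonelli's theorem lets space be integrated before time, so that h meets only a
  Gaussian.\<close>

lemma nn_integral_heat_laplace_weighted:
  assumes [measurable]: "h \<in> borel_measurable borel"
  shows "(\<integral>\<^sup>+x. heat_laplace \<kappa> (x::real^'n) * h x \<partial>lborel) =
    (\<integral>\<^sup>+t. ennreal (exp (- \<kappa>\<^sup>2 * t)) * indicator {0<..} t * (\<integral>\<^sup>+x. ennreal (heat t (x::real^'n)) * h x \<partial>lborel) \<partial>lborel)"
proof -
  have "heat_laplace \<kappa> x * h x = (\<integral>\<^sup>+t. ennreal (exp (- \<kappa>\<^sup>2 * t)) * indicator {0<..} t * (ennreal (heat t x) * h x) \<partial>lborel)" for x :: "real^'n"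
    unfolding heat_laplace_def
    by (subst nn_integral_multc[symmetric])
       (auto intro!: nn_integral_cong simp: ennreal_mult indicator_def mult_ac)
  then have "(\<integral>\<^sup>+x. heat_laplace \<kappa> (x::real^'n) * h x \<partial>lborel) =
     (\<integral>\<^sup>+x. \<integral>\<^sup>+t. ennreal (exp (- \<kappa>\<^sup>2 * t)) * indicator {0<..} t * (ennreal (heat t (x::real^'n)) * h x) \<partial>lborel \<partial>lborel)"
    by simp
  also have "\<dots> = (\<integral>\<^sup>+t. \<integral>\<^sup>+x. ennreal (exp (- \<kappa>\<^sup>2 * t)) * indicator {0<..} t * (ennreal (heat t (x::real^'n)) * h x) \<partial>lborel \<partial>lborel)"
    by (rule lborel_pair.Fubini') measurable
  finally show ?thesis by (simp add: nn_integral_cmult)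
qed

lemma AE_heat_laplace_green:
  assumes "CARD('n) = 2 \<or> CARD('n) = 3" "\<kappa> > 0"
  shows "AE x in lborel. ennreal (green \<kappa> (x :: real^'n)) = heat_laplace \<kappa> x"
  using AE_lborel_singleton[of 0] by eventually_elim (simp add: heat_laplace_eq_green assms)

lemma nn_integral_green:
  assumes d: "CARD('n) = 2 \<or> CARD('n) = 3" and k: "\<kappa> > 0"
  shows "(\<integral>\<^sup>+x. ennreal (green \<kappa> (x :: real^'n)) \<partial>lborel) = ennreal (1 / \<kappa>\<^sup>2)"
proof -
  have "(\<integral>\<^sup>+x. ennreal (green \<kappa> (x :: real^'n)) \<partial>lborel) = (\<integral>\<^sup>+x. heat_laplace \<kappa> (x :: real^'n) * 1 \<partial>lborel)"
    by (intro nn_integral_cong_AE, use AE_heat_laplace_green[OF d k] in eventually_elim) simp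
  also have "\<dots> = (\<integral>\<^sup>+t. ennreal (exp (- \<kappa>\<^sup>2 * t)) * indicator {0<..} t \<partial>lborel)"
    by (subst nn_integral_heat_laplace_weighted)
       (auto intro!: nn_integral_cong simp: nn_integral_heat[where 'n='n] indicator_def)
  also have "\<dots> = ennreal (1 / \<kappa>\<^sup>2)"
    using k by (intro nn_integral_exp_Ioi) simp
  finally show ?thesis .
qed

text \<open>The Fourier transform of the heat kernel is exp (- k^2 * t), and its Laplace transform 1
  / (\<kappa>^2 + k^2) is the symbol of the free resolvent. The summand 1, kept for positivity,
  contributes the total mass 1 / \<kappa>^2.\<close>

lemma nn_integral_green_cos:
  assumes d: "CARD('n) = 2 \<or> CARD('n) = 3" and \<kappa>: "\<kappa> > 0" and b: "b \<in> Basis"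
  shows "(\<integral>\<^sup>+x. ennreal (green \<kappa> (x :: real^'n) * (1 + cos (k * (x \<bullet> b)))) \<partial>lborel) = ennreal (1 / \<kappa>\<^sup>2 + 1 / (\<kappa>\<^sup>2 + k\<^sup>2))"
proof -
  have cosge: "0 \<le> 1 + cos u" for u :: real using cos_ge_minus_one[of u] by linarith
  have k2: "\<kappa>\<^sup>2 + k\<^sup>2 > 0" "\<kappa>\<^sup>2 > 0" using \<kappa> by (auto simp: add_pos_nonneg)
  have "(\<integral>\<^sup>+x. ennreal (green \<kappa> (x :: real^'n) * (1 + cos (k * (x \<bullet> b)))) \<partial>lborel)
     = (\<integral>\<^sup>+x. heat_laplace \<kappa> (x :: real^'n) * ennreal (1 + cos (k * (x \<bullet> b))) \<partial>lborel)"
    by (intro nn_integral_cong_AE, use AE_heat_laplace_green[OF d \<kappa>] in eventually_elim) (metis ennreal_mult green_nonneg cosge)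
  also have "\<dots> = (\<integral>\<^sup>+t. ennreal (exp (- \<kappa>\<^sup>2 * t)) * indicator {0<..} t * ennreal (1 + exp (- (k\<^sup>2 * t))) \<partial>lborel)"
  proof (subst nn_integral_heat_laplace_weighted, simp, intro nn_integral_cong)
    fix t :: real
    have "(\<integral>\<^sup>+x. ennreal (heat t x) * ennreal (1 + cos (k * (x \<bullet> b))) \<partial>lborel) = ennreal (1 + exp (- (k\<^sup>2 * t)))" if "t > 0"
      using nn_integral_heat_cos[OF that b, of k] that cosge by (simp only: ennreal_mult heat_nonneg less_imp_le)
    then show "ennreal (exp (- \<kappa>\<^sup>2 * t)) * indicator {0<..} t * (\<integral>\<^sup>+x. ennreal (heat t x) * ennreal (1 + cos (k * (x \<bullet> b))) \<partial>lborel)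
       = ennreal (exp (- \<kappa>\<^sup>2 * t)) * indicator {0<..} t * ennreal (1 + exp (- (k\<^sup>2 * t)))"
      by (cases "t > 0") simp_all
  qed
  also have "\<dots> = (\<integral>\<^sup>+t. ennreal (exp (- \<kappa>\<^sup>2 * t)) * indicator {0<..} t + ennreal (exp (- (\<kappa>\<^sup>2 + k\<^sup>2) * t)) * indicator {0<..} t \<partial>lborel)"
  proof (intro nn_integral_cong)
    fix t :: real
    have "exp (- \<kappa>\<^sup>2 * t) * (1 + exp (- (k\<^sup>2 * t))) = exp (- \<kappa>\<^sup>2 * t) + exp (- (\<kappa>\<^sup>2 + k\<^sup>2) * t)"
      by (simp add: distrib_left mult_exp_exp algebra_simps)
    then have "ennreal (exp (- \<kappa>\<^sup>2 * t)) * ennreal (1 + exp (- (k\<^sup>2 * t))) = ennreal (exp (- \<kappa>\<^sup>2 * t)) + ennreal (exp (- (\<kappa>\<^sup>2 + k\<^sup>2) * t))"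
      by (subst ennreal_mult[symmetric]) (simp_all add: ennreal_plus[symmetric] del: ennreal_plus)
    then show "ennreal (exp (- \<kappa>\<^sup>2 * t)) * indicator {0<..} t * ennreal (1 + exp (- (k\<^sup>2 * t)))
       = ennreal (exp (- \<kappa>\<^sup>2 * t)) * indicator {0<..} t + ennreal (exp (- (\<kappa>\<^sup>2 + k\<^sup>2) * t)) * indicator {0<..} t"
      by (cases "t > 0") simp_all
  qed
  also have "\<dots> = ennreal (1 / \<kappa>\<^sup>2) + ennreal (1 / (\<kappa>\<^sup>2 + k\<^sup>2))"
    by (subst nn_integral_add) (simp_all only: nn_integral_exp_Ioi[OF k2(1)] nn_integral_exp_Ioi[OF k2(2)], measurable)
  finally show ?thesis using k2 by (simp only: ennreal_plus zero_le_divide_1_iff less_imp_le)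
qed

section \<open>Convolutions of Green functions\<close>

text \<open>In the double time integral the semigroup law removes z and leaves a heat kernel at time
  \<tau> = s + t. Integrating exp (- \<kappa>^2 s - \<kappa>'^2 (\<tau> - s)) over 0 < s < \<tau>
  gives the divided difference of the two exponentials.\<close>

lemma nn_integral_heat_laplace_conv:
  assumes k: "0 < \<kappa>" "\<kappa> < \<kappa>'"
  shows "(\<integral>\<^sup>+z. heat_laplace \<kappa> (x - z) * heat_laplace \<kappa>' (z - y) \<partial>lborel) =
    (\<integral>\<^sup>+\<tau>. ennreal (heat \<tau> (x - y)) * ennreal ((exp (- \<kappa>\<^sup>2 * \<tau>) - exp (- \<kappa>'\<^sup>2 * \<tau>)) / (\<kappa>'\<^sup>2 - \<kappa>\<^sup>2)) * indicator {0<..} \<tau> \<partial>lborel)"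
    (is "?L = _")
proof -
  define d where "d = \<kappa>'\<^sup>2 - \<kappa>\<^sup>2"
  have d: "d > 0" using k by (simp add: d_def power_strict_mono)
  define a where "a s t = ennreal (exp (- \<kappa>\<^sup>2 * s)) * indicator {0<..} s * (ennreal (exp (- \<kappa>'\<^sup>2 * t)) * indicator {0<..} t)" for s t :: real
  have [measurable]: "(\<lambda>(s, t). a s t) \<in> borel_measurable (lborel \<Otimes>\<^sub>M lborel)"
    unfolding a_def by measurable
  have [measurable]: "(\<lambda>w. a (f w) (g w)) \<in> borel_measurable M" if [measurable]: "f \<in> borel_measurable M" "g \<in> borel_measurable M" for f g and M :: "'z measure"
    unfolding a_def by measurable
  have "?L = (\<integral>\<^sup>+z. \<integral>\<^sup>+s. \<integral>\<^sup>+t. a s t * (ennreal (heat s (x - z)) * ennreal (heat t (z - y))) \<partial>lborel \<partial>lborel \<partial>lborel)"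
    unfolding heat_laplace_def
    by (subst nn_integral_multc[symmetric], simp, subst nn_integral_cmult[symmetric], simp,
        intro nn_integral_cong) (auto simp: a_def ennreal_mult indicator_def mult_ac)
  also have "\<dots> = (\<integral>\<^sup>+s. \<integral>\<^sup>+z. \<integral>\<^sup>+t. a s t * (ennreal (heat s (x - z)) * ennreal (heat t (z - y))) \<partial>lborel \<partial>lborel \<partial>lborel)"
    by (rule lborel_pair.Fubini') (unfold a_def, measurable)
  also have "\<dots> = (\<integral>\<^sup>+s. \<integral>\<^sup>+t. \<integral>\<^sup>+z. a s t * (ennreal (heat s (x - z)) * ennreal (heat t (z - y))) \<partial>lborel \<partial>lborel \<partial>lborel)"
    by (intro nn_integral_cong lborel_pair.Fubini') (unfold a_def, measurable)
  also have "\<dots> = (\<integral>\<^sup>+s. \<integral>\<^sup>+t. a s t * ennreal (heat (s + t) (x - y)) \<partial>lborel \<partial>lborel)"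
  proof (intro nn_integral_cong)
    fix s t :: real
    show "(\<integral>\<^sup>+z. a s t * (ennreal (heat s (x - z)) * ennreal (heat t (z - y))) \<partial>lborel) = a s t * ennreal (heat (s + t) (x - y))"
      by (cases "s > 0 \<and> t > 0") (auto simp: nn_integral_cmult nn_integral_heat_conv, auto simp: a_def)
  qed
  also have "\<dots> = (\<integral>\<^sup>+s. \<integral>\<^sup>+\<tau>. a s (\<tau> - s) * ennreal (heat \<tau> (x - y)) \<partial>lborel \<partial>lborel)"
  proof (rule nn_integral_cong)
    fix s :: real
    show "(\<integral>\<^sup>+t. a s t * ennreal (heat (s + t) (x - y)) \<partial>lborel) = (\<integral>\<^sup>+\<tau>. a s (\<tau> - s) * ennreal (heat \<tau> (x - y)) \<partial>lborel)"
      by (subst nn_integral_lborel_translate[where c="- s", symmetric]) (simp_all add: algebra_simps)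
  qed
  also have "\<dots> = (\<integral>\<^sup>+\<tau>. \<integral>\<^sup>+s. a s (\<tau> - s) * ennreal (heat \<tau> (x - y)) \<partial>lborel \<partial>lborel)"
    by (rule lborel_pair.Fubini') (unfold a_def, measurable)
  also have "\<dots> = (\<integral>\<^sup>+\<tau>. ennreal (heat \<tau> (x - y)) * ennreal ((exp (- \<kappa>\<^sup>2 * \<tau>) - exp (- \<kappa>'\<^sup>2 * \<tau>)) / d) * indicator {0<..} \<tau> \<partial>lborel)"
  proof (intro nn_integral_cong)
    fix \<tau> :: real
    show "(\<integral>\<^sup>+s. a s (\<tau> - s) * ennreal (heat \<tau> (x - y)) \<partial>lborel)
      = ennreal (heat \<tau> (x - y)) * ennreal ((exp (- \<kappa>\<^sup>2 * \<tau>) - exp (- \<kappa>'\<^sup>2 * \<tau>)) / d) * indicator {0<..} \<tau>"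
    proof (cases "\<tau> > 0")
      case True
      have "(\<integral>\<^sup>+s. a s (\<tau> - s) \<partial>lborel) = (\<integral>\<^sup>+s. ennreal (exp (d * s - \<kappa>'\<^sup>2 * \<tau>)) * indicator {0..\<tau>} s \<partial>lborel)"
      proof (rule nn_integral_cong_AE)
        show "AE s in lborel. a s (\<tau> - s) = ennreal (exp (d * s - \<kappa>'\<^sup>2 * \<tau>)) * indicator {0..\<tau>} s"
          using AE_lborel_singleton[of 0] AE_lborel_singleton[of \<tau>]
        proof eventually_elim
          case (elim s)
          have "exp (- \<kappa>\<^sup>2 * s) * exp (- \<kappa>'\<^sup>2 * (\<tau> - s)) = exp (d * s - \<kappa>'\<^sup>2 * \<tau>)"
            unfolding mult_exp_exp by (simp add: d_def algebra_simps)
          then have "ennreal (exp (- \<kappa>\<^sup>2 * s)) * ennreal (exp (- \<kappa>'\<^sup>2 * (\<tau> - s))) = ennreal (exp (d * s - \<kappa>'\<^sup>2 * \<tau>))"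
            by (subst ennreal_mult[symmetric]) simp_all
          then show ?case using elim by (auto simp: a_def indicator_def)
        qed
      qed
      also have "\<dots> = ennreal (exp (d * \<tau> - \<kappa>'\<^sup>2 * \<tau>) / d - exp (d * 0 - \<kappa>'\<^sup>2 * \<tau>) / d)"
        using d True by (intro nn_integral_FTC_Icc) (auto intro!: derivative_eq_intros)
      also have "exp (d * \<tau> - \<kappa>'\<^sup>2 * \<tau>) / d - exp (d * 0 - \<kappa>'\<^sup>2 * \<tau>) / d = (exp (- \<kappa>\<^sup>2 * \<tau>) - exp (- \<kappa>'\<^sup>2 * \<tau>)) / d"
        by (simp add: d_def algebra_simps diff_divide_distrib)
      finally show ?thesis using True by (simp add: nn_integral_multc mult.commute)
    next
      case False
      then have "a s (\<tau> - s) = 0" for s by (auto simp: a_def indicator_def)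
      then show ?thesis using False by simp
    qed
  qed
  finally show ?thesis unfolding d_def .
qed

text \<open>The factor t / sqrt (4 * pi * t) ^ 3 is t times the three-dimensional heat kernel at the
  origin, hence a multiple of t^(-1/2), and the integral is a rescaled Gamma (1/2).\<close>

lemma nn_integral_Gamma_half:
  assumes s: "(s::real) > 0"
  shows "(\<integral>\<^sup>+t. ennreal (t / sqrt (4 * pi * t) ^ 3 * exp (- s * t)) * indicator {0<..} t \<partial>lborel) = ennreal (1 / (8 * pi * sqrt s))"
proof -
  have "ennreal (sqrt pi) = (\<integral>\<^sup>+t. ennreal (indicator {0..} t * t powr (1 / 2 - 1) / exp t) \<partial>lborel)"
    using Gamma_conv_nn_integral_real[of "1/2"] by (simp add: Gamma_one_half_real)
  also have "\<dots> = ennreal s * (\<integral>\<^sup>+t. ennreal (indicator {0..} (s * t) * (s * t) powr (1 / 2 - 1) / exp (s * t)) \<partial>lborel)"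
    using s by (subst nn_integral_real_affine[where c=s and t=0]) auto
  also have "\<dots> = (\<integral>\<^sup>+t. ennreal s * ennreal (indicator {0..} (s * t) * (s * t) powr (1 / 2 - 1) / exp (s * t)) \<partial>lborel)"
    by (subst nn_integral_cmult) auto
  also have "\<dots> = (\<integral>\<^sup>+t. ennreal (8 * pi * sqrt pi * sqrt s) * (ennreal (t / sqrt (4 * pi * t) ^ 3 * exp (- s * t)) * indicator {0<..} t) \<partial>lborel)"
  proof (rule nn_integral_cong_AE)
    show "AE t in lborel. ennreal s * ennreal (indicator {0..} (s * t) * (s * t) powr (1 / 2 - 1) / exp (s * t))
       = ennreal (8 * pi * sqrt pi * sqrt s) * (ennreal (t / sqrt (4 * pi * t) ^ 3 * exp (- s * t)) * indicator {0<..} t)"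
      using AE_lborel_singleton[of 0]
    proof eventually_elim
      case (elim t)
      show ?case
      proof (cases "t > 0")
        case True
        have p: "(s * t) powr (1 / 2 - 1) = 1 / (sqrt s * sqrt t)"
          using s True by (simp add: powr_minus powr_half_sqrt real_sqrt_mult inverse_eq_divide)
        have q: "sqrt (4 * pi * t) ^ 3 = 8 * pi * t * (sqrt pi * sqrt t)"
          using True by (simp add: power3_eq_cube real_sqrt_mult mult.left_commute mult.assoc[symmetric])
        have "s / sqrt s = sqrt s" using s by (simp add: real_div_sqrt)
        then have "s * (1 / (sqrt s * sqrt t) / exp (s * t)) = 8 * pi * sqrt pi * sqrt s * (t / (8 * pi * t * (sqrt pi * sqrt t)) * exp (- s * t))"
          using s True by (simp add: exp_minus field_simps)
        then show ?thesis using s True elim unfolding p q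
          by (simp add: ennreal_mult[symmetric])
      next
        case False
        then have "s * t < 0" using s elim by (simp add: mult_pos_neg)
        then show ?thesis using False by simp
      qed
    qed
  qed
  also have "\<dots> = ennreal (8 * pi * sqrt pi * sqrt s) * (\<integral>\<^sup>+t. ennreal (t / sqrt (4 * pi * t) ^ 3 * exp (- s * t)) * indicator {0<..} t \<partial>lborel)"
    by (subst nn_integral_cmult) auto
  finally have e: "ennreal (sqrt pi) = ennreal (8 * pi * sqrt pi * sqrt s) * (\<integral>\<^sup>+t. ennreal (t / sqrt (4 * pi * t) ^ 3 * exp (- s * t)) * indicator {0<..} t \<partial>lborel)" .
  have "sqrt pi = 8 * pi * sqrt pi * sqrt s * (1 / (8 * pi * sqrt s))" using s by simp
  then have "ennreal (sqrt pi) = ennreal (8 * pi * sqrt pi * sqrt s) * ennreal (1 / (8 * pi * sqrt s))"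
    using s by (subst ennreal_mult[symmetric]) simp_all
  with e show ?thesis using s by (simp add: ennreal_mult_cancel_left)
qed

text \<open>Writing the difference of exponentials as the integral of \<tau> exp (- s \<tau>) over s
  from \<kappa>^2 to \<kappa>'^2 supplies the factor \<tau> that tames the singularity of
  \<open>heat \<tau> 0\<close> at \<tau> = 0.\<close>

lemma nn_integral_heat_diagonal:
  assumes dim: "CARD('n::finite) = 2 \<or> CARD('n) = 3" and k: "0 < \<kappa>" "\<kappa> < \<kappa>'"
  shows "(\<integral>\<^sup>+\<tau>. ennreal (heat \<tau> (0::real^'n)) * ennreal (exp (- \<kappa>\<^sup>2 * \<tau>) - exp (- \<kappa>'\<^sup>2 * \<tau>)) * indicator {0<..} \<tau> \<partial>lborel)
    = ennreal (xi TYPE('n) \<kappa> - xi TYPE('n) \<kappa>')"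
proof -
  \<comment> \<open>The derivative of - \<open>xi\<close> with respect to s = \<kappa>^2; its
    primitive is a logarithm in dimension two and a square root in dimension three.\<close>
  define D where "D s = (if CARD('n) = 2 then 1 / (4 * pi * s) else 1 / (8 * pi * sqrt s))" for s :: real
  have D: "(\<integral>\<^sup>+t. ennreal (t * heat t (0::real^'n) * exp (- s * t)) * indicator {0<..} t \<partial>lborel) = ennreal (D s)" if s: "s > 0" for s
  proof (cases "CARD('n) = 2")
    case True
    have "(\<integral>\<^sup>+t. ennreal (t * heat t (0::real^'n) * exp (- s * t)) * indicator {0<..} t \<partial>lborel)
       = (\<integral>\<^sup>+t. ennreal (1 / (4 * pi)) * (ennreal (exp (- s * t)) * indicator {0<..} t) \<partial>lborel)"
      by (intro nn_integral_cong) (auto simp: heat_def True indicator_def ennreal_mult[symmetric])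
    also have "\<dots> = ennreal (1 / (4 * pi)) * ennreal (1 / s)"
      by (subst nn_integral_cmult) (simp_all only: nn_integral_exp_Ioi[OF s], measurable)
    also have "\<dots> = ennreal (D s)"
      using s by (subst ennreal_mult[symmetric]) (simp_all add: D_def True)
    finally show ?thesis .
  next
    case False
    then have c: "CARD('n) = 3" using dim by simp
    show ?thesis using nn_integral_Gamma_half[OF s] by (simp add: heat_def c D_def)
  qed
  have sq: "\<kappa>\<^sup>2 < \<kappa>'\<^sup>2" "\<kappa>\<^sup>2 > 0" using k by (simp_all add: power_strict_mono)
  have pos: "s > 0" if "\<kappa>\<^sup>2 \<le> s" for s using sq(2) that by linarith
  have ft: "ennreal (exp (- \<kappa>\<^sup>2 * \<tau>) - exp (- \<kappa>'\<^sup>2 * \<tau>)) = (\<integral>\<^sup>+s. ennreal (\<tau> * exp (- s * \<tau>)) * indicator {\<kappa>\<^sup>2..\<kappa>'\<^sup>2} s \<partial>lborel)"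
    if "\<tau> > 0" for \<tau>
  proof -
    have "(\<integral>\<^sup>+s. ennreal (\<tau> * exp (- s * \<tau>)) * indicator {\<kappa>\<^sup>2..\<kappa>'\<^sup>2} s \<partial>lborel) = ennreal (- exp (- \<kappa>'\<^sup>2 * \<tau>) - (- exp (- \<kappa>\<^sup>2 * \<tau>)))"
      using sq that by (intro nn_integral_FTC_Icc) (auto intro!: derivative_eq_intros)
    then show ?thesis by simp
  qed
  have "(\<integral>\<^sup>+\<tau>. ennreal (heat \<tau> (0::real^'n)) * ennreal (exp (- \<kappa>\<^sup>2 * \<tau>) - exp (- \<kappa>'\<^sup>2 * \<tau>)) * indicator {0<..} \<tau> \<partial>lborel)
    = (\<integral>\<^sup>+\<tau>. \<integral>\<^sup>+s. ennreal (\<tau> * heat \<tau> (0::real^'n) * exp (- s * \<tau>)) * indicator {0<..} \<tau> * indicator {\<kappa>\<^sup>2..\<kappa>'\<^sup>2} s \<partial>lborel \<partial>lborel)"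
  proof (intro nn_integral_cong)
    fix \<tau> :: real
    show "ennreal (heat \<tau> (0::real^'n)) * ennreal (exp (- \<kappa>\<^sup>2 * \<tau>) - exp (- \<kappa>'\<^sup>2 * \<tau>)) * indicator {0<..} \<tau>
      = (\<integral>\<^sup>+s. ennreal (\<tau> * heat \<tau> (0::real^'n) * exp (- s * \<tau>)) * indicator {0<..} \<tau> * indicator {\<kappa>\<^sup>2..\<kappa>'\<^sup>2} s \<partial>lborel)"
    proof (cases "\<tau> > 0")
      case True
      then show ?thesis unfolding ft[OF True]
        by (subst nn_integral_cmult[symmetric], simp, simp, intro nn_integral_cong)
          (auto simp: indicator_def ennreal_mult[symmetric] mult_ac)
    qed simp
  qed
  also have "\<dots> = (\<integral>\<^sup>+s. \<integral>\<^sup>+\<tau>. ennreal (\<tau> * heat \<tau> (0::real^'n) * exp (- s * \<tau>)) * indicator {0<..} \<tau> * indicator {\<kappa>\<^sup>2..\<kappa>'\<^sup>2} s \<partial>lborel \<partial>lborel)"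
    by (rule lborel_pair.Fubini') measurable
  also have "\<dots> = (\<integral>\<^sup>+s. ennreal (D s) * indicator {\<kappa>\<^sup>2..\<kappa>'\<^sup>2} s \<partial>lborel)"
  proof (intro nn_integral_cong)
    fix s :: real
    show "(\<integral>\<^sup>+\<tau>. ennreal (\<tau> * heat \<tau> (0::real^'n) * exp (- s * \<tau>)) * indicator {0<..} \<tau> * indicator {\<kappa>\<^sup>2..\<kappa>'\<^sup>2} s \<partial>lborel)
      = ennreal (D s) * indicator {\<kappa>\<^sup>2..\<kappa>'\<^sup>2} s"
    proof (cases "s \<in> {\<kappa>\<^sup>2..\<kappa>'\<^sup>2}")
      case True
      then have "s > 0" using sq by (meson atLeastAtMost_iff less_le_trans)
      then show ?thesis using D[of s] True by simp
    qed simp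
  qed
  also have "\<dots> = ennreal (xi TYPE('n) \<kappa> - xi TYPE('n) \<kappa>')"
  proof (cases "CARD('n) = 2")
    case True
    have "(\<integral>\<^sup>+s. ennreal (D s) * indicator {\<kappa>\<^sup>2..\<kappa>'\<^sup>2} s \<partial>lborel) = ennreal (ln (\<kappa>'\<^sup>2) / (4 * pi) - ln (\<kappa>\<^sup>2) / (4 * pi))"
    proof (intro nn_integral_FTC_Icc[where F="\<lambda>s. ln s / (4 * pi)"])
      fix s assume "s \<in> {\<kappa>\<^sup>2..\<kappa>'\<^sup>2}"
      then have s: "s > 0" using pos[of s] by simp
      have "DERIV (\<lambda>s. ln s / (4 * pi)) s :> inverse s / (4 * pi)"
        using s by (intro DERIV_cdivide DERIV_ln)
      also have "inverse s / (4 * pi) = D s"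
        by (simp add: D_def True inverse_eq_divide)
      finally show "DERIV (\<lambda>s. ln s / (4 * pi)) s :> D s" .
      show "0 \<le> D s" using s by (simp add: D_def True)
    qed (use sq in \<open>simp_all add: D_def[abs_def] True\<close>)
    also have "ln (\<kappa>'\<^sup>2) / (4 * pi) - ln (\<kappa>\<^sup>2) / (4 * pi) = xi TYPE('n) \<kappa> - xi TYPE('n) \<kappa>'"
      using k by (simp add: xi_def True ln_realpow ln_div field_simps)
    finally show ?thesis .
  next
    case False
    have "(\<integral>\<^sup>+s. ennreal (D s) * indicator {\<kappa>\<^sup>2..\<kappa>'\<^sup>2} s \<partial>lborel) = ennreal (sqrt (\<kappa>'\<^sup>2) / (4 * pi) - sqrt (\<kappa>\<^sup>2) / (4 * pi))"
    proof (intro nn_integral_FTC_Icc[where F="\<lambda>s. sqrt s / (4 * pi)"])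
      fix s assume "s \<in> {\<kappa>\<^sup>2..\<kappa>'\<^sup>2}"
      then have s: "s > 0" using pos[of s] by simp
      have "DERIV (\<lambda>s. sqrt s / (4 * pi)) s :> inverse (sqrt s) / 2 / (4 * pi)"
        using s by (intro DERIV_cdivide DERIV_real_sqrt)
      also have "inverse (sqrt s) / 2 / (4 * pi) = D s"
        by (simp add: D_def False inverse_eq_divide)
      finally show "DERIV (\<lambda>s. sqrt s / (4 * pi)) s :> D s" .
      show "0 \<le> D s" using s by (simp add: D_def False)
    qed (use sq in \<open>simp_all add: D_def[abs_def] False\<close>)
    also have "sqrt (\<kappa>'\<^sup>2) / (4 * pi) - sqrt (\<kappa>\<^sup>2) / (4 * pi) = xi TYPE('n) \<kappa> - xi TYPE('n) \<kappa>'"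
      using k by (simp add: xi_def False)
    finally show ?thesis .
  qed
  finally show ?thesis .
qed

text \<open>The difference of two Green functions extends continuously to the origin, with value given by \<^const>\<open>xi\<close>.\<close>

definition green_diff :: "real \<Rightarrow> real \<Rightarrow> real^'n \<Rightarrow> real" where
  "green_diff \<kappa> \<kappa>' w = (if w = 0 then xi TYPE('n) \<kappa> - xi TYPE('n) \<kappa>' else green \<kappa> w - green \<kappa>' w)"

locale low_dim =
  fixes dim :: "'n::finite itself"
  assumes card_dim: "CARD('n) = 2 \<or> CARD('n) = 3"
begin

lemma green_diff_nn_integral:
  assumes k: "0 < \<kappa>" "\<kappa> < \<kappa>'"
  shows "0 \<le> green_diff \<kappa> \<kappa>' (w::real^'n)"
    and "(\<integral>\<^sup>+\<tau>. ennreal (heat \<tau> w) * ennreal (exp (- \<kappa>\<^sup>2 * \<tau>) - exp (- \<kappa>'\<^sup>2 * \<tau>)) * indicator {0<..} \<tau> \<partial>lborel)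
      = ennreal (green_diff \<kappa> \<kappa>' w)" (is "?I = _")
proof -
  have sq: "\<kappa>\<^sup>2 < \<kappa>'\<^sup>2" using k by (simp add: power_strict_mono)
  have "0 \<le> green_diff \<kappa> \<kappa>' w \<and> ?I = ennreal (green_diff \<kappa> \<kappa>' w)"
  proof (cases "w = 0")
    case True
    have "xi TYPE('n) \<kappa>' \<le> xi TYPE('n) \<kappa>" using k by (simp add: xi_def divide_right_mono)
    then show ?thesis using nn_integral_heat_diagonal[OF card_dim k] True by (simp add: green_diff_def)
  next
    case False
    \<comment> \<open>Stated as a sum, since subtraction of extended nonnegative reals truncates.
      The equation then also yields that \<open>green\<close> decreases in the spectral
      parameter.\<close>
    have "?I + heat_laplace \<kappa>' w = heat_laplace \<kappa> w"
      unfolding heat_laplace_def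
    proof (subst nn_integral_add[symmetric], simp, simp, intro nn_integral_cong)
      fix \<tau> :: real
      show "ennreal (heat \<tau> w) * ennreal (exp (- \<kappa>\<^sup>2 * \<tau>) - exp (- \<kappa>'\<^sup>2 * \<tau>)) * indicator {0<..} \<tau> +
         ennreal (exp (- \<kappa>'\<^sup>2 * \<tau>) * heat \<tau> w) * indicator {0<..} \<tau> = ennreal (exp (- \<kappa>\<^sup>2 * \<tau>) * heat \<tau> w) * indicator {0<..} \<tau>"
      proof (cases "\<tau> > 0")
        case True
        have "0 \<le> exp (- \<kappa>\<^sup>2 * \<tau>) - exp (- \<kappa>'\<^sup>2 * \<tau>)" using sq True by simp
        then have "ennreal (heat \<tau> w) * ennreal (exp (- \<kappa>\<^sup>2 * \<tau>) - exp (- \<kappa>'\<^sup>2 * \<tau>)) + ennreal (exp (- \<kappa>'\<^sup>2 * \<tau>) * heat \<tau> w)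
          = ennreal (heat \<tau> w * (exp (- \<kappa>\<^sup>2 * \<tau>) - exp (- \<kappa>'\<^sup>2 * \<tau>)) + exp (- \<kappa>'\<^sup>2 * \<tau>) * heat \<tau> w)"
          using True by (subst ennreal_mult[symmetric]) (simp_all only: heat_nonneg less_imp_le ennreal_plus mult_nonneg_nonneg exp_ge_zero)
        also have "heat \<tau> w * (exp (- \<kappa>\<^sup>2 * \<tau>) - exp (- \<kappa>'\<^sup>2 * \<tau>)) + exp (- \<kappa>'\<^sup>2 * \<tau>) * heat \<tau> w = exp (- \<kappa>\<^sup>2 * \<tau>) * heat \<tau> w"
          by (simp add: algebra_simps)
        finally show ?thesis using True by simp
      qed simp
    qed
    then have e: "?I + ennreal (green \<kappa>' w) = ennreal (green \<kappa> w)"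
      using k False by (simp add: heat_laplace_eq_green[OF card_dim])
    then have "ennreal (green \<kappa>' w) \<le> ennreal (green \<kappa> w)" by (subst e[symmetric]) (rule add_increasing, simp_all)
    then have le: "green \<kappa>' w \<le> green \<kappa> w" by simp
    have "?I = ?I + ennreal (green \<kappa>' w) - ennreal (green \<kappa>' w)" by simp
    also have "\<dots> = ennreal (green \<kappa> w - green \<kappa>' w)" unfolding e by (simp add: ennreal_minus)
    finally show ?thesis using False le by (simp add: green_diff_def)
  qed
  then show "0 \<le> green_diff \<kappa> \<kappa>' w" "?I = ennreal (green_diff \<kappa> \<kappa>' w)" by auto
qed

text \<open>The resolvent identity for kernels: the divided difference of exponentials, integrated
  against the heat kernel, becomes the divided difference of Green functions. The case x = y is
  included, and there \<open>xi\<close> enters. With \<kappa> < \<kappa>' all factors are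
  nonnegative.\<close>

lemma green_conv_less:
  assumes k: "0 < \<kappa>" "\<kappa> < \<kappa>'"
  shows "(\<integral>\<^sup>+z. ennreal (green \<kappa> (x - z)) * ennreal (green \<kappa>' (z - (y::real^'n))) \<partial>lborel)
     = ennreal (green_diff \<kappa> \<kappa>' (x - y) / (\<kappa>'\<^sup>2 - \<kappa>\<^sup>2))" (is "?L = _")
proof -
  define d where "d = \<kappa>'\<^sup>2 - \<kappa>\<^sup>2"
  have d: "d > 0" using k by (simp add: d_def power_strict_mono)
  have "?L = (\<integral>\<^sup>+z. heat_laplace \<kappa> (x - z) * heat_laplace \<kappa>' (z - y) \<partial>lborel)"
  proof (intro nn_integral_cong_AE, use AE_lborel_singleton[of x] AE_lborel_singleton[of y] in eventually_elim)
    case (elim z)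
    have "heat_laplace \<kappa> (x - z) = ennreal (green \<kappa> (x - z))" "heat_laplace \<kappa>' (z - y) = ennreal (green \<kappa>' (z - y))"
      using elim k by (auto intro!: heat_laplace_eq_green[OF card_dim])
    then show ?case by simp
  qed
  also have "\<dots> = (\<integral>\<^sup>+\<tau>. ennreal (1 / d) * (ennreal (heat \<tau> (x - y)) * ennreal (exp (- \<kappa>\<^sup>2 * \<tau>) - exp (- \<kappa>'\<^sup>2 * \<tau>)) * indicator {0<..} \<tau>) \<partial>lborel)"
    unfolding nn_integral_heat_laplace_conv[OF k] d_def[symmetric]
  proof (intro nn_integral_cong)
    fix \<tau> :: real
    have e: "ennreal (u / d) = ennreal (1 / d) * ennreal u" for u
      using d by (subst ennreal_mult'[symmetric]) simp_all
    show "ennreal (heat \<tau> (x - y)) * ennreal ((exp (- \<kappa>\<^sup>2 * \<tau>) - exp (- \<kappa>'\<^sup>2 * \<tau>)) / d) * indicator {0<..} \<tau>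
        = ennreal (1 / d) * (ennreal (heat \<tau> (x - y)) * ennreal (exp (- \<kappa>\<^sup>2 * \<tau>) - exp (- \<kappa>'\<^sup>2 * \<tau>)) * indicator {0<..} \<tau>)"
      by (subst e) (simp only: mult_ac)
  qed
  also have "\<dots> = ennreal (1 / d) * ennreal (green_diff \<kappa> \<kappa>' (x - y))"
    by (subst nn_integral_cmult) (simp_all only: green_diff_nn_integral[OF k], measurable)
  also have "\<dots> = ennreal (green_diff \<kappa> \<kappa>' (x - y) / d)"
    using d by (subst ennreal_mult'[symmetric]) simp_all
  finally show ?thesis by (simp add: d_def)
qed

lemma green_diff_swap: "green_diff \<kappa>' \<kappa> w = - green_diff \<kappa> \<kappa>' w"
  by (simp add: green_diff_def)

text \<open>The reflection of z to x + y - z exchanges the roles of the two parameters and so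
  reduces to \<kappa> < \<kappa>'.\<close>

lemma green_conv:
  assumes k: "0 < \<kappa>" "0 < \<kappa>'" "\<kappa> \<noteq> \<kappa>'"
  shows "(\<integral>\<^sup>+z. ennreal (green \<kappa> (x - z)) * ennreal (green \<kappa>' (z - (y::real^'n))) \<partial>lborel)
     = ennreal (green_diff \<kappa> \<kappa>' (x - y) / (\<kappa>'\<^sup>2 - \<kappa>\<^sup>2))"
proof (cases "\<kappa> < \<kappa>'")
  case True
  then show ?thesis using green_conv_less k by simp
next
  case False
  have "(\<integral>\<^sup>+z. ennreal (green \<kappa> (x - z)) * ennreal (green \<kappa>' (z - y)) \<partial>lborel)
    = (\<integral>\<^sup>+z. ennreal (green \<kappa> (x - (x + y - z))) * ennreal (green \<kappa>' ((x + y - z) - y)) \<partial>lborel)"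
    by (rule nn_integral_lborel_reflect[symmetric]) measurable
  also have "\<dots> = (\<integral>\<^sup>+z. ennreal (green \<kappa>' (x - z)) * ennreal (green \<kappa> (z - y)) \<partial>lborel)"
    by (simp add: mult.commute)
  also have "\<dots> = ennreal (green_diff \<kappa>' \<kappa> (x - y) / (\<kappa>\<^sup>2 - \<kappa>'\<^sup>2))"
    using False k by (intro green_conv_less) auto
  also have "green_diff \<kappa>' \<kappa> (x - y) / (\<kappa>\<^sup>2 - \<kappa>'\<^sup>2) = green_diff \<kappa> \<kappa>' (x - y) / (\<kappa>'\<^sup>2 - \<kappa>\<^sup>2)"
    by (subst green_diff_swap) (metis minus_diff_eq minus_divide_divide minus_minus)
  finally show ?thesis .
qed

lemma green_antimono_spectral:
  assumes "0 < \<kappa>" "\<kappa> \<le> \<kappa>'" "w \<noteq> (0::real^'n)"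
  shows "green \<kappa>' w \<le> green \<kappa> w"
  using green_diff_nn_integral(1)[of \<kappa> \<kappa>' w] assms by (cases "\<kappa> = \<kappa>'") (auto simp: green_diff_def)

text \<open>The convolution identity speaks of two different parameters, so one of the two equal
  factors is first enlarged to the parameter \<kappa> / 2.\<close>

lemma green_square_integral_finite:
  assumes k: "0 < \<kappa>"
  shows "(\<integral>\<^sup>+z. ennreal ((green \<kappa> (z - (y::real^'n)))\<^sup>2) \<partial>lborel) < \<infinity>"
proof -
  have "(\<integral>\<^sup>+z. ennreal ((green \<kappa> (z - y))\<^sup>2) \<partial>lborel) \<le> (\<integral>\<^sup>+z. ennreal (green (\<kappa> / 2) (y - z)) * ennreal (green \<kappa> (z - y)) \<partial>lborel)"
  proof (intro nn_integral_mono_AE, use AE_lborel_singleton[of y] in eventually_elim)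
    case (elim z)
    then have "green \<kappa> (z - y) \<le> green (\<kappa> / 2) (y - z)"
      using k green_antimono_spectral[of "\<kappa> / 2" \<kappa> "y - z"] by (simp add: green_commute)
    then show ?case
      by (simp add: ennreal_mult[symmetric] power2_eq_square mult_right_mono)
  qed
  also have "\<dots> < \<infinity>" using k by (subst green_conv) auto
  finally show ?thesis .
qed

end

section \<open>The free resolvent in \<open>L\<^sup>2\<close>\<close>

definition L2_sq :: "(real^'n \<Rightarrow> complex) \<Rightarrow> ennreal" where
  "L2_sq f = (\<integral>\<^sup>+x. ennreal ((cmod (f x))\<^sup>2) \<partial>lborel)"

lemma L2_iff: "f \<in> L2 \<longleftrightarrow> f \<in> borel_measurable borel \<and> L2_sq (f :: real^'n \<Rightarrow> complex) < \<infinity>"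
  by (auto simp: L2_def L2_sq_def integrable_iff_bounded)

lemma L2_measurable [measurable_dest]: "f \<in> L2 \<Longrightarrow> f \<in> borel_measurable borel"
  by (simp add: L2_def)

lemma L2_norm_sq: "f \<in> L2 \<Longrightarrow> ennreal ((L2_norm f)\<^sup>2) = L2_sq f"
  unfolding L2_def L2_sq_def L2_norm_def
  by (subst nn_integral_eq_integral) (auto simp: Bochner_Integration.integral_nonneg)

lemma L2_norm_nonneg: "0 \<le> L2_norm f"
  unfolding L2_norm_def by (simp add: Bochner_Integration.integral_nonneg)

lemma L2_sq_add_le:
  assumes [measurable]: "f \<in> borel_measurable borel" "g \<in> borel_measurable borel"
  shows "L2_sq (\<lambda>x. f x + g x) \<le> 2 * L2_sq f + 2 * L2_sq (g :: real^'n \<Rightarrow> complex)"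
proof -
  have "(cmod (a + b))\<^sup>2 \<le> 2 * (cmod a)\<^sup>2 + 2 * (cmod b)\<^sup>2" for a b
  proof -
    have "(cmod (a + b))\<^sup>2 \<le> (cmod a + cmod b)\<^sup>2" by (intro power_mono norm_triangle_ineq) simp
    also have "\<dots> \<le> 2 * (cmod a)\<^sup>2 + 2 * (cmod b)\<^sup>2"
      using zero_le_power2[of "cmod a - cmod b"] by (simp add: power2_eq_square algebra_simps)
    finally show ?thesis .
  qed
  then have "L2_sq (\<lambda>x. f x + g x) \<le> (\<integral>\<^sup>+x. ennreal (2 * (cmod (f x))\<^sup>2 + 2 * (cmod (g x))\<^sup>2) \<partial>lborel)"
    unfolding L2_sq_def by (intro nn_integral_mono ennreal_leI)
  also have "\<dots> = (\<integral>\<^sup>+x. 2 * ennreal ((cmod (f x))\<^sup>2) + 2 * ennreal ((cmod (g x))\<^sup>2) \<partial>lborel)"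
    by (simp add: ennreal_mult)
  also have "\<dots> = 2 * L2_sq f + 2 * L2_sq g"
    unfolding L2_sq_def by (simp add: nn_integral_add nn_integral_cmult)
  finally show ?thesis .
qed

lemma L2_sq_cmult:
  assumes [measurable]: "f \<in> borel_measurable borel"
  shows "L2_sq (\<lambda>x. c * f x) = ennreal ((cmod c)\<^sup>2) * L2_sq (f :: real^'n \<Rightarrow> complex)"
  unfolding L2_sq_def by (simp add: norm_mult power_mult_distrib ennreal_mult nn_integral_cmult)

lemma L2_add:
  assumes "f \<in> L2" "g \<in> L2" shows "(\<lambda>x. f x + g x) \<in> L2"
proof -
  have m[measurable]: "f \<in> borel_measurable borel" "g \<in> borel_measurable borel" using assms by (auto simp: L2_iff)
  have "2 * L2_sq f + 2 * L2_sq g < \<infinity>" using assms by (auto simp: L2_iff ennreal_mult_less_top)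
  with L2_sq_add_le[OF m] show ?thesis by (auto simp: L2_iff intro: le_less_trans)
qed

lemma L2_cmult: "f \<in> L2 \<Longrightarrow> (\<lambda>x. c * f x) \<in> L2"
  by (auto simp: L2_iff L2_sq_cmult ennreal_mult_less_top)

lemma L2_zero: "(\<lambda>_. 0) \<in> L2"
  by (simp add: L2_def)

lemma L2_sum: "(\<And>i. i \<in> I \<Longrightarrow> f i \<in> L2) \<Longrightarrow> (\<lambda>x. \<Sum>i\<in>I. f i x) \<in> L2"
  by (induction I rule: infinite_finite_induct) (auto simp: L2_zero L2_add)

lemma L2_diff: "f \<in> L2 \<Longrightarrow> g \<in> L2 \<Longrightarrow> (\<lambda>x. f x - g x) \<in> L2"
  using L2_add[of f "\<lambda>x. (-1) * g x"] L2_cmult[of g "-1"] by simp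

lemma integrable_L2_mult:
  assumes "f \<in> L2" "g \<in> L2" shows "integrable lborel (\<lambda>x. f x * g x)"
proof (rule Bochner_Integration.integrable_bound)
  show "integrable lborel (\<lambda>x. (cmod (f x))\<^sup>2 + (cmod (g x))\<^sup>2)" using assms by (auto simp: L2_def)
  show "(\<lambda>x. f x * g x) \<in> borel_measurable lborel" using assms by (auto simp: L2_def)
  have "a * b \<le> a\<^sup>2 + b\<^sup>2" for a b :: real
    using zero_le_power2[of "a - b"] zero_le_power2[of "a + b"] by (simp add: power2_eq_square algebra_simps)
  then show "AE x in lborel. cmod (f x * g x) \<le> norm ((cmod (f x))\<^sup>2 + (cmod (g x))\<^sup>2)"
    by (simp add: norm_mult)
qed

lemma L2_cauchy_schwarz:
  assumes f: "f \<in> L2" and g: "g \<in> L2"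
  shows "ennreal ((cmod (\<integral>x. f x * g x \<partial>lborel))\<^sup>2) \<le> L2_sq f * L2_sq (g :: real^'n \<Rightarrow> complex)"
proof -
  have [measurable]: "f \<in> borel_measurable borel" "g \<in> borel_measurable borel" using f g by (auto simp: L2_iff)
  have "ennreal (cmod (\<integral>x. f x * g x \<partial>lborel)) \<le> (\<integral>\<^sup>+x. ennreal (cmod (f x)) * ennreal (cmod (g x)) \<partial>lborel)"
    using integral_norm_bound_ennreal[OF integrable_L2_mult[OF f g]] by (simp add: norm_mult ennreal_mult)
  then have "ennreal ((cmod (\<integral>x. f x * g x \<partial>lborel))\<^sup>2) \<le> (\<integral>\<^sup>+x. ennreal (cmod (f x)) * ennreal (cmod (g x)) \<partial>lborel)\<^sup>2"
    by (simp add: power_mono flip: ennreal_power)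
  also have "\<dots> \<le> (\<integral>\<^sup>+x. (ennreal (cmod (f x)))\<^sup>2 \<partial>lborel) * (\<integral>\<^sup>+x. (ennreal (cmod (g x)))\<^sup>2 \<partial>lborel)"
    by (rule Cauchy_Schwarz_nn_integral) simp_all
  finally show ?thesis by (simp add: L2_sq_def ennreal_power)
qed

lemma L2_sq_translate:
  assumes "(f :: real^'n \<Rightarrow> complex) \<in> borel_measurable borel"
  shows "L2_sq (\<lambda>x. f (x - y)) = L2_sq f"
  unfolding L2_sq_def
  using nn_integral_lborel_translate[of "\<lambda>x. ennreal ((cmod (f x))\<^sup>2)" "- y"] assms by simp

lemma L2_sq_reflect:
  assumes "(f :: real^'n \<Rightarrow> complex) \<in> borel_measurable borel"
  shows "L2_sq (\<lambda>x. f (y - x)) = L2_sq f"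
  unfolding L2_sq_def
  using nn_integral_lborel_reflect[of "\<lambda>x. ennreal ((cmod (f x))\<^sup>2)" "y"] assms by simp

lemma integral_lborel_reflect:
  fixes f :: "'a::euclidean_space \<Rightarrow> complex"
  assumes [measurable]: "f \<in> borel_measurable borel"
  shows "(\<integral>x. f (c - x) \<partial>lborel) = (\<integral>x. f x \<partial>lborel)"
proof -
  have "(lborel :: 'a measure) = distr lborel borel (\<lambda>x. c - x)"
    using lborel_affine[of "-1" c] by (simp add: density_1)
  then have "(\<integral>x. f x \<partial>lborel) = (\<integral>x. f x \<partial>(distr lborel borel (\<lambda>x. c - x)))"
    by simp
  also have "\<dots> = (\<integral>x. f (c - x) \<partial>lborel)"
    by (rule integral_distr) auto
  finally show ?thesis by simp
qed

abbreviation cgreen :: "real \<Rightarrow> real^'n \<Rightarrow> complex" where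
  "cgreen \<kappa> x \<equiv> complex_of_real (green \<kappa> x)"

lemma free_resolvent_measurable [measurable]:
  assumes [measurable]: "f \<in> borel_measurable borel"
  shows "free_resolvent \<kappa> (f :: real^'n \<Rightarrow> complex) \<in> borel_measurable borel"
  unfolding free_resolvent_def by measurable

lemma free_resolvent_eq_shifted:
  assumes [measurable]: "f \<in> borel_measurable borel"
  shows "free_resolvent \<kappa> f x = (\<integral>z. cgreen \<kappa> z * f (x - z) \<partial>lborel)"
  unfolding free_resolvent_def
  using integral_lborel_reflect[of "\<lambda>z. cgreen \<kappa> z * f (x - z)" x] by simp

context low_dim
begin

lemma cgreen_L2: "0 < \<kappa> \<Longrightarrow> (\<lambda>x. cgreen \<kappa> (x - (y::real^'n))) \<in> L2"
  using green_square_integral_finite[of \<kappa> y] by (simp add: L2_iff L2_sq_def)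

lemma cgreen_L2': "0 < \<kappa> \<Longrightarrow> (\<lambda>x'. cgreen \<kappa> (x - (x'::real^'n))) \<in> L2"
  using cgreen_L2[of \<kappa> x] by (subst green_commute)

lemma integrable_free_resolvent:
  "0 < \<kappa> \<Longrightarrow> f \<in> L2 \<Longrightarrow> integrable lborel (\<lambda>x'. cgreen \<kappa> (x - (x'::real^'n)) * f x')"
  by (intro integrable_L2_mult cgreen_L2')

lemma free_resolvent_add:
  "0 < \<kappa> \<Longrightarrow> f \<in> L2 \<Longrightarrow> g \<in> L2 \<Longrightarrow>
    free_resolvent \<kappa> (\<lambda>x. f x + g x) (x::real^'n) = free_resolvent \<kappa> f x + free_resolvent \<kappa> g x"
  unfolding free_resolvent_def by (simp add: distrib_left integrable_free_resolvent)

lemma free_resolvent_cmult: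
  "free_resolvent \<kappa> (\<lambda>x. c * f x) (x::real^'n) = c * free_resolvent \<kappa> f x"
  unfolding free_resolvent_def by (simp add: mult.left_commute)

lemma free_resolvent_sum:
  assumes "0 < \<kappa>" and "\<And>i. i \<in> I \<Longrightarrow> f i \<in> L2"
  shows "free_resolvent \<kappa> (\<lambda>x. \<Sum>i\<in>I. f i x) (x::real^'n) = (\<Sum>i\<in>I. free_resolvent \<kappa> (f i) x)"
  unfolding free_resolvent_def using assms by (simp add: sum_distrib_left integrable_free_resolvent)

text \<open>The integral sees f only up to null sets, yet the equality holds at every point. This
  permits evaluating resolvents at the points of Y, themselves a null set.\<close>

lemma free_resolvent_AE_cong:
  assumes "AE x in lborel. f x = g x" and [measurable]: "f \<in> borel_measurable borel" "g \<in> borel_measurable borel"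
  shows "free_resolvent \<kappa> f = free_resolvent \<kappa> (g :: real^'n \<Rightarrow> complex)"
  unfolding free_resolvent_def
  by (intro ext integral_cong_AE) (use assms(1) in auto)

lemma free_resolvent_bound:
  assumes k: "0 < \<kappa>" and f: "f \<in> L2"
  shows "ennreal ((cmod (free_resolvent \<kappa> f (x::real^'n)))\<^sup>2) \<le> L2_sq (cgreen \<kappa> :: real^'n \<Rightarrow> complex) * L2_sq f"
  using L2_cauchy_schwarz[OF cgreen_L2'[OF k, of x] f] L2_sq_reflect[of "cgreen \<kappa>" x]
  by (simp add: free_resolvent_def)

lemma cgreen_L2_sq_finite: "0 < \<kappa> \<Longrightarrow> L2_sq (cgreen \<kappa> :: real^'n \<Rightarrow> complex) < \<infinity>"
  using cgreen_L2[of \<kappa> 0] by (simp add: L2_iff)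

text \<open>This is Schur's test; \<open>1 / \<kappa>\<^sup>2\<close> is the total mass of the kernel.\<close>

lemma green_average_bound:
  assumes k: "0 < \<kappa>" and [measurable]: "(\<lambda>(x, z). F x z) \<in> borel_measurable (borel \<Otimes>\<^sub>M borel)"
  shows "L2_sq (\<lambda>x::real^'n. \<integral>z. cgreen \<kappa> (z::real^'n) * F x z \<partial>lborel)
    \<le> ennreal (1 / \<kappa>\<^sup>2) * (\<integral>\<^sup>+z. ennreal (green \<kappa> z) * L2_sq (\<lambda>x. F x z) \<partial>lborel)"
proof -
  have [measurable]: "(\<lambda>z. F x z) \<in> borel_measurable borel" for x by measurable
  have *: "ennreal ((cmod (\<integral>z. cgreen \<kappa> z * F x z \<partial>lborel))\<^sup>2)
      \<le> ennreal (1 / \<kappa>\<^sup>2) * (\<integral>\<^sup>+z. ennreal (green \<kappa> z) * ennreal ((cmod (F x z))\<^sup>2) \<partial>lborel)" for x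
  proof (cases "integrable lborel (\<lambda>z. cgreen \<kappa> z * F x z)")
    case True
    have s: "ennreal (green \<kappa> z) = (ennreal (sqrt (green \<kappa> z)))\<^sup>2" for z :: "real^'n"
      by (simp add: ennreal_power)
    have "ennreal (cmod (\<integral>z. cgreen \<kappa> z * F x z \<partial>lborel)) \<le> (\<integral>\<^sup>+z. ennreal (green \<kappa> z) * ennreal (cmod (F x z)) \<partial>lborel)"
      using integral_norm_bound_ennreal[OF True] by (simp add: norm_mult ennreal_mult)
    also have "\<dots> = (\<integral>\<^sup>+z. ennreal (sqrt (green \<kappa> z)) * (ennreal (sqrt (green \<kappa> z)) * ennreal (cmod (F x z))) \<partial>lborel)"
      by (subst s) (simp add: power2_eq_square mult.assoc)
    finally have "(ennreal (cmod (\<integral>z. cgreen \<kappa> z * F x z \<partial>lborel)))\<^sup>2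
      \<le> (\<integral>\<^sup>+z. ennreal (sqrt (green \<kappa> z)) * (ennreal (sqrt (green \<kappa> z)) * ennreal (cmod (F x z))) \<partial>lborel)\<^sup>2"
      by (intro power_mono) simp_all
    also have "\<dots> \<le> (\<integral>\<^sup>+z. (ennreal (sqrt (green \<kappa> (z::real^'n))))\<^sup>2 \<partial>lborel) * (\<integral>\<^sup>+z. (ennreal (sqrt (green \<kappa> z)) * ennreal (cmod (F x z)))\<^sup>2 \<partial>lborel)"
      by (rule Cauchy_Schwarz_nn_integral) simp_all
    also have "\<dots> = ennreal (1 / \<kappa>\<^sup>2) * (\<integral>\<^sup>+z. ennreal (green \<kappa> z) * ennreal ((cmod (F x z))\<^sup>2) \<partial>lborel)"
      by (simp only: power_mult_distrib s[symmetric] nn_integral_green[OF card_dim k]) (simp only: ennreal_power norm_ge_zero)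
    finally show ?thesis by (simp only: ennreal_power norm_ge_zero)
  next
    case False
    then show ?thesis by (simp add: not_integrable_integral_eq)
  qed
  have "L2_sq (\<lambda>x::real^'n. \<integral>z. cgreen \<kappa> (z::real^'n) * F x z \<partial>lborel)
    \<le> (\<integral>\<^sup>+x. ennreal (1 / \<kappa>\<^sup>2) * (\<integral>\<^sup>+z. ennreal (green \<kappa> z) * ennreal ((cmod (F x z))\<^sup>2) \<partial>lborel) \<partial>lborel)"
    unfolding L2_sq_def by (intro nn_integral_mono *)
  also have "\<dots> = ennreal (1 / \<kappa>\<^sup>2) * (\<integral>\<^sup>+x. \<integral>\<^sup>+z. ennreal (green \<kappa> z) * ennreal ((cmod (F x z))\<^sup>2) \<partial>lborel \<partial>lborel)"
    by (rule nn_integral_cmult) measurable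
  also have "(\<integral>\<^sup>+x. \<integral>\<^sup>+z. ennreal (green \<kappa> z) * ennreal ((cmod (F x z))\<^sup>2) \<partial>lborel \<partial>lborel)
     = (\<integral>\<^sup>+z. \<integral>\<^sup>+x. ennreal (green \<kappa> z) * ennreal ((cmod (F x z))\<^sup>2) \<partial>lborel \<partial>lborel)"
    by (rule lborel_pair.Fubini') measurable
  also have "\<dots> = (\<integral>\<^sup>+z. ennreal (green \<kappa> z) * L2_sq (\<lambda>x. F x z) \<partial>lborel)"
    unfolding L2_sq_def by (intro nn_integral_cong nn_integral_cmult) measurable
  finally show ?thesis .
qed

text \<open>The resolvent is an average of translates of f with weight \<open>green\<close>, and all
  translates have the same norm.\<close>

lemma free_resolvent_L2_sq:
  assumes k: "0 < \<kappa>" and [measurable]: "f \<in> borel_measurable borel"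
  shows "L2_sq (free_resolvent \<kappa> (f :: real^'n \<Rightarrow> complex)) \<le> (ennreal (1 / \<kappa>\<^sup>2))\<^sup>2 * L2_sq f"
proof -
  have "L2_sq (free_resolvent \<kappa> f) = L2_sq (\<lambda>x. \<integral>z. cgreen \<kappa> z * f (x - z) \<partial>lborel)"
    by (rule arg_cong[where f=L2_sq], rule ext, rule free_resolvent_eq_shifted) simp
  also have "\<dots> \<le> ennreal (1 / \<kappa>\<^sup>2) * (\<integral>\<^sup>+z. ennreal (green \<kappa> (z::real^'n)) * L2_sq (\<lambda>x. f (x - z)) \<partial>lborel)"
    by (rule green_average_bound[OF k]) measurable
  also have "\<dots> = ennreal (1 / \<kappa>\<^sup>2) * (\<integral>\<^sup>+z. ennreal (green \<kappa> (z::real^'n)) * L2_sq f \<partial>lborel)"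
    by (simp add: L2_sq_translate)
  also have "\<dots> = (ennreal (1 / \<kappa>\<^sup>2))\<^sup>2 * L2_sq f"
    by (subst nn_integral_multc) (simp_all add: nn_integral_green[OF card_dim k] power2_eq_square mult.assoc)
  finally show ?thesis .
qed

lemma free_resolvent_L2:
  assumes "0 < \<kappa>" "f \<in> L2" shows "free_resolvent \<kappa> (f :: real^'n \<Rightarrow> complex) \<in> L2"
proof -
  have m: "f \<in> borel_measurable borel" using assms by (simp add: L2_iff)
  have "(ennreal (1 / \<kappa>\<^sup>2))\<^sup>2 * L2_sq f < \<infinity>" using assms by (auto simp: L2_iff ennreal_mult_less_top ennreal_power)
  then show ?thesis using m free_resolvent_L2_sq[OF assms(1) m] by (auto simp: L2_iff intro: le_less_trans)
qed

section \<open>Resolvent identities for kernels and for operators\<close>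

lemma green_conv_nonneg:
  assumes "0 < \<kappa>" "0 < \<kappa>'" "\<kappa> \<noteq> \<kappa>'"
  shows "0 \<le> green_diff \<kappa> \<kappa>' (w::real^'n) / (\<kappa>'\<^sup>2 - \<kappa>\<^sup>2)"
proof (cases "\<kappa> < \<kappa>'")
  case True
  then have "\<kappa>\<^sup>2 < \<kappa>'\<^sup>2" using assms by (simp add: power_strict_mono)
  then show ?thesis using green_diff_nn_integral(1)[OF assms(1) True, of w] by simp
next
  case False
  then have l: "\<kappa>' < \<kappa>" using assms by simp
  then have "\<kappa>'\<^sup>2 < \<kappa>\<^sup>2" using assms by (simp add: power_strict_mono)
  then show ?thesis using green_diff_nn_integral(1)[OF assms(2) l, of w] green_diff_swap[of \<kappa> \<kappa>' w]
    by (simp add: divide_nonneg_neg zero_le_divide_iff)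
qed

text \<open>Multiplying by \<kappa>'^2 - \<kappa>^2 instead of dividing by it makes the case
  \<kappa> = \<kappa>' the trivial equation 0 = 0.\<close>

lemma integral_green_conv:
  assumes "0 < \<kappa>" "0 < \<kappa>'"
  shows "(\<kappa>'\<^sup>2 - \<kappa>\<^sup>2) * (\<integral>z. green \<kappa> (x - z) * green \<kappa>' (z - (y::real^'n)) \<partial>lborel) = green_diff \<kappa> \<kappa>' (x - y)"
proof (cases "\<kappa> = \<kappa>'")
  case True
  then show ?thesis by (simp add: green_diff_def)
next
  case False
  have ne: "\<kappa>'\<^sup>2 - \<kappa>\<^sup>2 \<noteq> 0" using False assms by (simp add: power2_eq_iff)
  have "(\<integral>z. green \<kappa> (x - z) * green \<kappa>' (z - y) \<partial>lborel) = enn2real (\<integral>\<^sup>+z. ennreal (green \<kappa> (x - z) * green \<kappa>' (z - y)) \<partial>lborel)"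
    by (rule integral_eq_nn_integral) simp_all
  also have "\<dots> = green_diff \<kappa> \<kappa>' (x - y) / (\<kappa>'\<^sup>2 - \<kappa>\<^sup>2)"
    using green_conv[OF assms False, of x y] green_conv_nonneg[OF assms False, of "x - y"]
    by (simp add: ennreal_mult)
  finally show ?thesis using ne by simp
qed

lemma free_resolvent_green:
  assumes "0 < \<kappa>" "0 < \<kappa>'"
  shows "complex_of_real (\<kappa>'\<^sup>2 - \<kappa>\<^sup>2) * free_resolvent \<kappa> (\<lambda>x. cgreen \<kappa>' (x - y)) (x::real^'n) = complex_of_real (green_diff \<kappa> \<kappa>' (x - y))"
proof -
  have "free_resolvent \<kappa> (\<lambda>x. cgreen \<kappa>' (x - y)) x = complex_of_real (\<integral>z. green \<kappa> (x - z) * green \<kappa>' (z - y) \<partial>lborel)"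
    unfolding free_resolvent_def by (simp flip: of_real_mult)
  then show ?thesis by (simp only: of_real_mult[symmetric] integral_green_conv[OF assms])
qed

text \<open>After Fubini the kernel identity acts inside the integral against f. Absolute
  integrability follows from the same identity: the kernels are nonnegative, so their convolution is
  almost everywhere a multiple of G_\<kappa> - G_\<kappa>', whose product with an L2 function is
  integrable.\<close>

lemma free_resolvent_identity:
  assumes k: "0 < \<kappa>" "0 < \<kappa>'" and f: "f \<in> L2"
  shows "complex_of_real (\<kappa>'\<^sup>2 - \<kappa>\<^sup>2) * free_resolvent \<kappa> (free_resolvent \<kappa>' f) (x::real^'n)
     = free_resolvent \<kappa> f x - free_resolvent \<kappa>' f x"
proof (cases "\<kappa> = \<kappa>'")
  case True
  then show ?thesis by simp
next
  case False
  have [measurable]: "f \<in> borel_measurable borel" using f by (simp add: L2_iff)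
  define F where "F z w = cgreen \<kappa> (x - z) * (cgreen \<kappa>' (z - w) * f w)" for z w
  have conv: "(\<integral>\<^sup>+z. ennreal (green \<kappa> (x - z) * green \<kappa>' (z - w)) \<partial>lborel) = ennreal (green_diff \<kappa> \<kappa>' (x - w) / (\<kappa>'\<^sup>2 - \<kappa>\<^sup>2))" for w
    using green_conv[OF k False, of x w] by (simp add: ennreal_mult)
  have AEd: "AE w in lborel. green_diff \<kappa> \<kappa>' (x - w) = green \<kappa> (x - w) - green \<kappa>' (x - w)"
    using AE_lborel_singleton[of x] by eventually_elim (simp add: green_diff_def)
  have intd: "integrable lborel (\<lambda>w. (cgreen \<kappa> (x - w) - cgreen \<kappa>' (x - w)) * f w)"
    using k f by (simp add: left_diff_distrib integrable_free_resolvent)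
  have int: "integrable (lborel \<Otimes>\<^sub>M lborel) (case_prod F)"
  proof (rule integrableI_bounded)
    show "case_prod F \<in> borel_measurable (lborel \<Otimes>\<^sub>M lborel)" unfolding F_def by measurable
    have "(\<integral>\<^sup>+p. ennreal (norm (case_prod F p)) \<partial>(lborel \<Otimes>\<^sub>M lborel)) = (\<integral>\<^sup>+w. \<integral>\<^sup>+z. ennreal (norm (F z w)) \<partial>lborel \<partial>lborel)"
      unfolding F_def by (subst lborel_pair.nn_integral_snd[symmetric]) (simp_all add: case_prod_unfold)
    also have "\<dots> = (\<integral>\<^sup>+w. ennreal (green_diff \<kappa> \<kappa>' (x - w) / (\<kappa>'\<^sup>2 - \<kappa>\<^sup>2)) * ennreal (cmod (f w)) \<partial>lborel)"
    proof (rule nn_integral_cong)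
      fix w
      have "(\<integral>\<^sup>+z. ennreal (norm (F z w)) \<partial>lborel) = (\<integral>\<^sup>+z. ennreal (green \<kappa> (x - z) * green \<kappa>' (z - w)) * ennreal (cmod (f w)) \<partial>lborel)"
        unfolding F_def by (simp add: norm_mult ennreal_mult mult.assoc)
      also have "\<dots> = (\<integral>\<^sup>+z. ennreal (green \<kappa> (x - z) * green \<kappa>' (z - w)) \<partial>lborel) * ennreal (cmod (f w))"
        by (rule nn_integral_multc) measurable
      finally show "(\<integral>\<^sup>+z. ennreal (norm (F z w)) \<partial>lborel) = ennreal (green_diff \<kappa> \<kappa>' (x - w) / (\<kappa>'\<^sup>2 - \<kappa>\<^sup>2)) * ennreal (cmod (f w))"
        unfolding conv .
    qed
    also have "\<dots> = (\<integral>\<^sup>+w. ennreal (\<bar>1 / (\<kappa>'\<^sup>2 - \<kappa>\<^sup>2)\<bar>) * ennreal (cmod ((cgreen \<kappa> (x - w) - cgreen \<kappa>' (x - w)) * f w)) \<partial>lborel)"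
    proof (rule nn_integral_cong_AE, use AEd in eventually_elim)
      case (elim w)
      have "green_diff \<kappa> \<kappa>' (x - w) / (\<kappa>'\<^sup>2 - \<kappa>\<^sup>2) = \<bar>1 / (\<kappa>'\<^sup>2 - \<kappa>\<^sup>2)\<bar> * cmod (cgreen \<kappa> (x - w) - cgreen \<kappa>' (x - w))"
        using abs_of_nonneg[OF green_conv_nonneg[OF k False, of "x - w"]]
        unfolding elim of_real_diff[symmetric] norm_of_real by (simp add: abs_divide)
      then show ?case by (simp only:) (simp only: norm_mult ennreal_mult abs_ge_zero norm_ge_zero mult.assoc mult_nonneg_nonneg)
    qed
    also have "\<dots> < \<infinity>"
      using intd by (subst nn_integral_cmult) (auto simp: integrable_iff_bounded ennreal_mult_less_top)
    finally show "(\<integral>\<^sup>+p. ennreal (norm (case_prod F p)) \<partial>(lborel \<Otimes>\<^sub>M lborel)) < \<infinity>" .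
  qed
  have "free_resolvent \<kappa> (free_resolvent \<kappa>' f) x = (\<integral>z. \<integral>w. F z w \<partial>lborel \<partial>lborel)"
    unfolding free_resolvent_def F_def by simp
  also have "\<dots> = (\<integral>w. \<integral>z. F z w \<partial>lborel \<partial>lborel)"
    by (rule lborel_pair.Fubini_integral[OF int, symmetric])
  also have "\<dots> = (\<integral>w. complex_of_real (\<integral>z. green \<kappa> (x - z) * green \<kappa>' (z - w) \<partial>lborel) * f w \<partial>lborel)"
    unfolding F_def by (simp only: mult.assoc[symmetric] integral_mult_left_zero of_real_mult[symmetric] integral_complex_of_real)
  finally have "complex_of_real (\<kappa>'\<^sup>2 - \<kappa>\<^sup>2) * free_resolvent \<kappa> (free_resolvent \<kappa>' f) x
     = (\<integral>w. complex_of_real ((\<kappa>'\<^sup>2 - \<kappa>\<^sup>2) * (\<integral>z. green \<kappa> (x - z) * green \<kappa>' (z - w) \<partial>lborel)) * f w \<partial>lborel)"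
    by (simp only: of_real_mult mult.assoc integral_mult_right_zero)
  also have "\<dots> = (\<integral>w. complex_of_real (green_diff \<kappa> \<kappa>' (x - w)) * f w \<partial>lborel)"
    by (simp only: integral_green_conv[OF k])
  also have "\<dots> = (\<integral>w. (cgreen \<kappa> (x - w) - cgreen \<kappa>' (x - w)) * f w \<partial>lborel)"
  proof (rule integral_cong_AE)
    show "AE w in lborel. complex_of_real (green_diff \<kappa> \<kappa>' (x - w)) * f w = (cgreen \<kappa> (x - w) - cgreen \<kappa>' (x - w)) * f w"
      using AEd by eventually_elim simp
  qed (unfold green_diff_def, measurable)
  also have "\<dots> = free_resolvent \<kappa> f x - free_resolvent \<kappa>' f x"
    using k f by (simp add: free_resolvent_def left_diff_distrib integrable_free_resolvent)
  finally show ?thesis .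
qed

end

section \<open>The quadratic form of the matrix \<open>\<Gamma>\<close>\<close>

lemma K0_integrable: "(x::real) > 0 \<Longrightarrow> integrable lborel (\<lambda>t::real. indicator {0..} t *\<^sub>R exp (- x * cosh t))"
  using set_integrable_K0[of x] by (simp add: set_integrable_def)

text \<open>The integrands are strictly ordered at every t >= 0, so equal integrals would force a
  set of positive measure, here [0, 1], to be null.\<close>

lemma K0_strict_antimono:
  assumes "0 < x" "x < y" shows "macdonald_K0 y < macdonald_K0 x"
proof -
  let ?f = "\<lambda>t. indicator {0..} t *\<^sub>R exp (- x * cosh t) - indicator {0..} t *\<^sub>R exp (- y * cosh t) :: real"
  have le: "exp (- y * cosh t) < exp (- x * cosh t)" for t
    using assms by (simp add: cosh_real_pos)
  have int: "integrable lborel ?f" using assms by (intro Bochner_Integration.integrable_diff K0_integrable) auto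
  have nn: "AE t in lborel. 0 \<le> ?f t"
    using le by (intro AE_I2) (simp add: indicator_def less_imp_le)
  have "(\<integral>t. ?f t \<partial>lborel) \<noteq> 0"
  proof
    assume "(\<integral>t. ?f t \<partial>lborel) = 0"
    then have "AE t in lborel. ?f t = 0" using integral_nonneg_eq_0_iff_AE[OF int nn] by simp
    then have "AE t in lborel. \<not> t \<in> {0..1::real}"
    proof eventually_elim
      case (elim t)
      then show ?case using le[of t] by (auto simp: indicator_def)
    qed
    then have "emeasure lborel {t \<in> space lborel. t \<in> {0..1::real}} = 0" by (rule emeasure_eq_0_AE)
    moreover have "{t \<in> space lborel. t \<in> {0..1::real}} = {0..1}" by auto
    ultimately show False by simp
  qed
  then have "0 < (\<integral>t. ?f t \<partial>lborel)" using integral_nonneg_AE[OF nn] by linarith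
  also have "(\<integral>t. ?f t \<partial>lborel) = macdonald_K0 x - macdonald_K0 y"
    using assms unfolding macdonald_K0_def set_lebesgue_integral_def
    by (intro Bochner_Integration.integral_diff K0_integrable) auto
  finally show ?thesis by simp
qed

lemma exp_scaled_convex: "convex_on UNIV (\<lambda>x::real. exp (- x * c))"
proof (rule convex_on_realI[where f'="\<lambda>x. - c * exp (- x * c)"])
  fix x y :: real assume "x \<le> y"
  show "- c * exp (- x * c) \<le> - c * exp (- y * c)"
  proof (cases "c \<ge> 0")
    case True
    then have "exp (- y * c) \<le> exp (- x * c)" using \<open>x \<le> y\<close> by (simp add: mult_right_mono)
    then show ?thesis using True by (simp add: mult_left_mono)
  next
    case False
    then have "exp (- x * c) \<le> exp (- y * c)" using \<open>x \<le> y\<close> by (simp add: mult_right_mono_neg)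
    then show ?thesis using False by (intro mult_left_mono) auto
  qed
qed (auto intro!: derivative_eq_intros)

text \<open>Each integrand exp (- x * cosh u) is convex in x, and integration over u preserves the
  inequality.\<close>

lemma K0_convex: "convex_on {0<..} macdonald_K0"
proof (rule convex_onI)
  fix t x y :: real
  assume t: "0 < t" "t < 1" and x: "x \<in> {0<..}" and y: "y \<in> {0<..}"
  define z where "z = (1 - t) *\<^sub>R x + t *\<^sub>R y"
  have z: "z > 0" using t x y unfolding z_def by (simp add: add_pos_pos)
  have "macdonald_K0 z \<le> (\<integral>u. (1 - t) * (indicator {0..} u *\<^sub>R exp (- x * cosh u)) + t * (indicator {0..} u *\<^sub>R exp (- y * cosh u)) \<partial>lborel)"
    unfolding macdonald_K0_def set_lebesgue_integral_def
  proof (rule integral_mono)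
    fix u :: real
    have "exp (- z * cosh u) \<le> (1 - t) * exp (- x * cosh u) + t * exp (- y * cosh u)"
      using convex_onD[OF exp_scaled_convex, of t x y "cosh u"] t unfolding z_def by simp
    then show "indicat_real {0..} u *\<^sub>R exp (- z * cosh u) \<le> (1 - t) * (indicator {0..} u *\<^sub>R exp (- x * cosh u)) + t * (indicator {0..} u *\<^sub>R exp (- y * cosh u))"
      by (simp add: indicator_def)
  next
    show "integrable lborel (\<lambda>u. indicator {0..} u *\<^sub>R exp (- z * cosh u))" using z by (rule K0_integrable)
    show "integrable lborel (\<lambda>u. (1 - t) * (indicator {0..} u *\<^sub>R exp (- x * cosh u)) + t * (indicator {0..} u *\<^sub>R exp (- y * cosh u)))"
      using x y by (intro Bochner_Integration.integrable_add integrable_mult_right K0_integrable) auto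
  qed
  also have "\<dots> = (1 - t) * macdonald_K0 x + t * macdonald_K0 y"
    unfolding macdonald_K0_def set_lebesgue_integral_def
    using x y by (subst Bochner_Integration.integral_add) (intro integrable_mult_right K0_integrable | simp)+
  finally show "macdonald_K0 ((1 - t) *\<^sub>R x + t *\<^sub>R y) \<le> (1 - t) * macdonald_K0 x + t * macdonald_K0 y"
    unfolding z_def .
qed (simp add: convex_real_interval)

text \<open>Finite convex functions on open sets are continuous, which replaces a limit argument
  under the integral.\<close>

lemma K0_continuous: "continuous_on {0<..} macdonald_K0"
  by (rule convex_on_continuous[OF _ K0_convex]) simp

lemma continuous_on_green_spectral:
  assumes "x \<noteq> (0 :: real^'n)"
  shows "continuous_on {0<..} (\<lambda>\<kappa>. green \<kappa> x)"
proof (cases "CARD('n) = 2")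
  case True
  have "continuous_on {0<..} (\<lambda>\<kappa>. macdonald_K0 (\<kappa> * norm x))"
    using assms by (intro continuous_on_compose2[OF K0_continuous] continuous_intros) auto
  then show ?thesis unfolding green_def by (auto simp: True intro!: continuous_intros)
next
  case False
  then show ?thesis unfolding green_def using assms by (auto intro!: continuous_intros)
qed

lemma continuous_on_xi: "continuous_on {0<..} (xi TYPE('n::finite))"
  unfolding xi_def by (cases "CARD('n) = 2") (auto intro!: continuous_intros)

definition Gamma_form :: "real \<Rightarrow> ('N::finite \<Rightarrow> real^'n) \<Rightarrow> real \<Rightarrow> real^'N \<Rightarrow> real" where
  "Gamma_form \<alpha> y \<kappa> c = c \<bullet> (Gamma_matrix \<alpha> y \<kappa> *v c)"

definition pair_sum :: "('N::finite \<Rightarrow> real^'n) \<Rightarrow> real \<Rightarrow> real^'N \<Rightarrow> real" where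
  "pair_sum y \<kappa> c = (\<Sum>i\<in>UNIV. \<Sum>j\<in>UNIV - {i}. green \<kappa> (y i - y j) * (c $ i * c $ j))"

lemma Gamma_form_eq:
  "Gamma_form \<alpha> y \<kappa> c = (\<alpha> - xi TYPE('n) \<kappa>) * (norm c)\<^sup>2 - pair_sum (y :: 'N::finite \<Rightarrow> real^'n) \<kappa> c"
proof -
  have "Gamma_form \<alpha> y \<kappa> c = (\<Sum>i\<in>UNIV. \<Sum>j\<in>UNIV. Gamma_matrix \<alpha> y \<kappa> $ i $ j * (c $ i * c $ j))"
    by (simp add: Gamma_form_def inner_vec_def matrix_vector_mult_def sum_distrib_left mult_ac)
  also have "\<dots> = (\<Sum>i\<in>UNIV. (\<alpha> - xi TYPE('n) \<kappa>) * (c $ i)\<^sup>2 - (\<Sum>j\<in>UNIV - {i}. green \<kappa> (y i - y j) * (c $ i * c $ j)))"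
  proof (rule sum.cong[OF refl])
    fix i
    have "(\<Sum>j\<in>UNIV. Gamma_matrix \<alpha> y \<kappa> $ i $ j * (c $ i * c $ j))
      = Gamma_matrix \<alpha> y \<kappa> $ i $ i * (c $ i * c $ i) + (\<Sum>j\<in>UNIV - {i}. Gamma_matrix \<alpha> y \<kappa> $ i $ j * (c $ i * c $ j))"
      by (rule sum.remove) auto
    also have "(\<Sum>j\<in>UNIV - {i}. Gamma_matrix \<alpha> y \<kappa> $ i $ j * (c $ i * c $ j)) = (\<Sum>j\<in>UNIV - {i}. - (green \<kappa> (y i - y j) * (c $ i * c $ j)))"
      by (rule sum.cong) (auto simp: Gamma_matrix_def)
    finally show "(\<Sum>j\<in>UNIV. Gamma_matrix \<alpha> y \<kappa> $ i $ j * (c $ i * c $ j)) = (\<alpha> - xi TYPE('n) \<kappa>) * (c $ i)\<^sup>2 - (\<Sum>j\<in>UNIV - {i}. green \<kappa> (y i - y j) * (c $ i * c $ j))"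
      by (simp add: sum_negf Gamma_matrix_def power2_eq_square)
  qed
  also have "\<dots> = (\<alpha> - xi TYPE('n) \<kappa>) * (norm c)\<^sup>2 - pair_sum y \<kappa> c"
  proof -
    have "(norm c)\<^sup>2 = (\<Sum>i\<in>UNIV. (c $ i)\<^sup>2)"
      by (simp only: power2_norm_eq_inner inner_vec_def) (simp add: power2_eq_square)
    then show ?thesis by (simp add: sum_subtractf pair_sum_def flip: sum_distrib_left)
  qed
  finally show ?thesis .
qed

lemma Gamma_matrix_symmetric: "transpose (Gamma_matrix \<alpha> y \<kappa>) = Gamma_matrix \<alpha> y \<kappa>"
  by (simp add: Gamma_matrix_def transpose_def vec_eq_iff green_commute)

lemma continuous_on_Gamma_form:
  assumes "inj (y :: 'N::finite \<Rightarrow> real^'n)"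
  shows "continuous_on ({0<..} \<times> UNIV) (\<lambda>(\<kappa>, c). Gamma_form \<alpha> y \<kappa> c)"
proof -
  have [continuous_intros]: "continuous_on ({0<..} \<times> UNIV) (\<lambda>p::real \<times> (real^'N). xi TYPE('n) (fst p))"
    by (rule continuous_on_compose2[OF continuous_on_xi]) (auto intro!: continuous_intros)
  have [continuous_intros]: "continuous_on ({0<..} \<times> UNIV) (\<lambda>p::real \<times> (real^'N). green (fst p) (y i - y j))" if "i \<noteq> j" for i j
    by (rule continuous_on_compose2[OF continuous_on_green_spectral])
       (use assms that in \<open>auto intro!: continuous_intros simp: inj_def\<close>)
  show ?thesis
    unfolding Gamma_form_eq pair_sum_def case_prod_unfold
    by (intro continuous_intros) auto
qed

lemma abs_vec_mult_le: "\<bar>c $ i * c $ j\<bar> \<le> (norm (c :: real^'N))\<^sup>2"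
  unfolding abs_mult power2_eq_square by (intro mult_mono component_le_norm_cart) auto

context low_dim
begin

lemma xi_unbounded_below: "\<exists>K>0. \<forall>\<kappa>\<ge>K. xi TYPE('n) \<kappa> \<le> - B"
proof (cases "CARD('n) = 2")
  case True
  define K where "K = 2 * exp (2 * pi * B - euler_mascheroni)"
  have "xi TYPE('n) \<kappa> \<le> - B" if "\<kappa> \<ge> K" for \<kappa>
  proof -
    have "exp (2 * pi * B - euler_mascheroni) \<le> \<kappa> / 2" using that by (simp add: K_def)
    then have "2 * pi * B - euler_mascheroni \<le> ln (\<kappa> / 2)"
      by (metis exp_gt_zero ln_exp ln_mono less_le_trans)
    then show ?thesis by (simp add: xi_def True field_simps)
  qed
  moreover have "K > 0" by (simp add: K_def)
  ultimately show ?thesis by blast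
next
  case False
  have "xi TYPE('n) \<kappa> \<le> - B" if "\<kappa> \<ge> max 1 (4 * pi * B)" for \<kappa>
    using that False by (simp add: xi_def field_simps)
  then show ?thesis by (intro exI[of _ "max 1 (4 * pi * B)"]) auto
qed

text \<open>For \<kappa> >= 1 the values of \<open>green\<close> are bounded by those at \<kappa> =
  1, while the diagonal entry \<alpha> - \<open>xi\<close> tends to infinity.\<close>

lemma Gamma_form_pos_large:
  assumes y: "inj (y :: 'N::finite \<Rightarrow> real^'n)"
  shows "\<exists>K>0. \<forall>\<kappa>\<ge>K. \<forall>c. c \<noteq> 0 \<longrightarrow> Gamma_form \<alpha> y \<kappa> c > 0"
proof -
  define M where "M = (\<Sum>i\<in>UNIV. \<Sum>j\<in>UNIV - {i}. green 1 (y i - y j))"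
  obtain K where K: "K > 0" "\<And>\<kappa>. \<kappa> \<ge> K \<Longrightarrow> xi TYPE('n) \<kappa> \<le> - (M - \<alpha> + 1)"
    using xi_unbounded_below by blast
  have "Gamma_form \<alpha> y \<kappa> c > 0" if k: "\<kappa> \<ge> max 1 K" and c: "c \<noteq> 0" for \<kappa> c
  proof -
    have "pair_sum y \<kappa> c \<le> (\<Sum>i\<in>UNIV. \<Sum>j\<in>UNIV - {i}. green 1 (y i - y j) * (norm c)\<^sup>2)"
      unfolding pair_sum_def
    proof (intro sum_mono)
      fix i j :: 'N assume "j \<in> UNIV - {i}"
      then have "green \<kappa> (y i - y j) \<le> green 1 (y i - y j)"
        using k y by (intro green_antimono_spectral) (auto simp: inj_eq)
      moreover have "c $ i * c $ j \<le> (norm c)\<^sup>2" using abs_vec_mult_le[of c i j] by simp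
      ultimately have "green \<kappa> (y i - y j) * (c $ i * c $ j) \<le> green \<kappa> (y i - y j) * (norm c)\<^sup>2"
        "green \<kappa> (y i - y j) * (norm c)\<^sup>2 \<le> green 1 (y i - y j) * (norm c)\<^sup>2"
        by (auto intro!: mult_left_mono mult_right_mono)
      then show "green \<kappa> (y i - y j) * (c $ i * c $ j) \<le> green 1 (y i - y j) * (norm c)\<^sup>2" by simp
    qed
    also have "\<dots> = M * (norm c)\<^sup>2" by (simp add: M_def sum_distrib_right)
    finally have p: "pair_sum y \<kappa> c \<le> M * (norm c)\<^sup>2" .
    have "M + 1 \<le> \<alpha> - xi TYPE('n) \<kappa>" using K(2)[of \<kappa>] k by simp
    then have "(M + 1) * (norm c)\<^sup>2 \<le> (\<alpha> - xi TYPE('n) \<kappa>) * (norm c)\<^sup>2" by (rule mult_right_mono) simp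
    with p have "(norm c)\<^sup>2 \<le> Gamma_form \<alpha> y \<kappa> c" unfolding Gamma_form_eq by (simp add: distrib_right)
    then show ?thesis using c by (meson less_le_trans zero_less_norm_iff zero_less_power)
  qed
  then show ?thesis using K(1) by (intro exI[of _ "max 1 K"]) auto
qed

end

section \<open>Eigenvalues of the point-interaction Hamiltonian\<close>

text \<open>Failure of positive definiteness rather than singularity of \<Gamma>: one trial vector
  then suffices for membership. The set contains all positive zeros of the determinant, and its
  largest element is such a zero.\<close>

definition nonpos_set :: "real \<Rightarrow> ('N::finite \<Rightarrow> real^'n) \<Rightarrow> real set" where
  "nonpos_set \<alpha> y = {\<kappa>. 0 < \<kappa> \<and> (\<exists>c. c \<noteq> 0 \<and> Gamma_form \<alpha> y \<kappa> c \<le> 0)}"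

lemma Gamma_form_scaleR: "Gamma_form \<alpha> y \<kappa> (r *\<^sub>R c) = r\<^sup>2 * Gamma_form \<alpha> y \<kappa> c"
  by (simp add: Gamma_form_def matrix_vector_mult_scaleR power2_eq_square)

lemma matrix_inv_both:
  fixes A :: "real^'n^'n" assumes "det A \<noteq> 0"
  shows "A ** matrix_inv A = mat 1" "matrix_inv A ** A = mat 1"
proof -
  have "\<exists>B. A ** B = mat 1 \<and> B ** A = mat 1"
    using assms invertible_det_nz[of A] unfolding invertible_def by blast
  from someI_ex[OF this] show "A ** matrix_inv A = mat 1" "matrix_inv A ** A = mat 1"
    unfolding matrix_inv_def by blast+
qed

lemma det_eq_0_iff_kernel: "det (A :: real^'n^'n) = 0 \<longleftrightarrow> (\<exists>c. c \<noteq> 0 \<and> A *v c = 0)"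
proof -
  have "det A \<noteq> 0 \<longleftrightarrow> (\<exists>B. B ** A = mat 1)"
    using invertible_det_nz[of A] invertible_left_inverse[of A] by metis
  also have "\<dots> \<longleftrightarrow> (\<forall>c. A *v c = 0 \<longrightarrow> c = 0)" by (rule matrix_left_invertible_ker)
  finally show ?thesis by blast
qed

lemma det_Gamma_0_imp_nonpos_set:
  assumes "0 < \<kappa>" "det (Gamma_matrix \<alpha> y \<kappa>) = 0" shows "\<kappa> \<in> nonpos_set \<alpha> y"
proof -
  obtain c where "c \<noteq> 0" "Gamma_matrix \<alpha> y \<kappa> *v c = 0" using assms(2) by (auto simp: det_eq_0_iff_kernel)
  then have "Gamma_form \<alpha> y \<kappa> c \<le> 0" by (simp add: Gamma_form_def)
  then show ?thesis using assms(1) \<open>c \<noteq> 0\<close> by (auto simp: nonpos_set_def)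
qed

text \<open>A zero of a nonnegative form is a minimum, so its gradient 2 A c vanishes; otherwise a
  step along - A c would make the form negative.\<close>

lemma psd_zero_imp_kernel:
  fixes A :: "real^'n^'n"
  assumes sym: "transpose A = A" and psd: "\<And>c. 0 \<le> c \<bullet> (A *v c)" and zero: "c \<bullet> (A *v c) = 0"
  shows "A *v c = 0"
proof (rule ccontr)
  assume ne: "A *v c \<noteq> 0"
  define v where "v = A *v c"
  define q where "q = v \<bullet> (A *v v)"
  have q: "0 \<le> q" using psd by (simp add: q_def)
  have vv: "0 < v \<bullet> v" using ne by (simp add: v_def)
  have cAv: "c \<bullet> (A *v v) = v \<bullet> v"
    using dot_lmul_matrix[of c A v] by (metis sym transpose_matrix_vector v_def)
  \<comment> \<open>Close to the minimiser - (v \<bullet> v) / q of the quadratic polynomial in t;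
    the added 1 covers q = 0.\<close>
  define t where "t = - (v \<bullet> v) / (q + 1)"
  have "0 \<le> (c + t *\<^sub>R v) \<bullet> (A *v (c + t *\<^sub>R v))" by (rule psd)
  also have "\<dots> = 2 * t * (v \<bullet> v) + t\<^sup>2 * q"
    using zero by (simp add: matrix_vector_right_distrib matrix_vector_mult_scaleR inner_add_left inner_add_right cAv
        q_def[symmetric] v_def[symmetric] power2_eq_square algebra_simps)
  also have "\<dots> = - (v \<bullet> v)\<^sup>2 * (q + 2) / (q + 1)\<^sup>2"
    using q unfolding t_def by (simp add: divide_simps power2_eq_square) (simp add: algebra_simps)
  also have "\<dots> < 0"
    using q vv by (simp add: divide_neg_pos mult_neg_pos)
  finally show False by simp
qed

context low_dim
begin

text \<open>By homogeneity c may be taken on the unit sphere. As large \<kappa> are excluded, the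
  elements above a given one are the projection of a compact set.\<close>

lemma nonpos_set_has_max:
  assumes y: "inj (y :: 'N::finite \<Rightarrow> real^'n)" and ne: "nonpos_set \<alpha> y \<noteq> {}"
  shows "\<exists>\<kappa>\<in>nonpos_set \<alpha> y. \<forall>\<kappa>'\<in>nonpos_set \<alpha> y. \<kappa>' \<le> \<kappa>"
proof -
  obtain \<kappa>1 where k1: "\<kappa>1 \<in> nonpos_set \<alpha> y" using ne by blast
  obtain K where K: "K > 0" "\<And>\<kappa> c. \<kappa> \<ge> K \<Longrightarrow> c \<noteq> 0 \<Longrightarrow> Gamma_form \<alpha> y \<kappa> c > 0"
    using Gamma_form_pos_large[OF y] by blast
  have bd: "\<kappa> \<le> K" if "\<kappa> \<in> nonpos_set \<alpha> y" for \<kappa>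
    using that K(2)[of \<kappa>] by (force simp: nonpos_set_def)
  have k1p: "0 < \<kappa>1" using k1 by (simp add: nonpos_set_def)
  \<comment> \<open>The lower end \<kappa>1 > 0 keeps D inside the region where the form is known to
    be continuous.\<close>
  define D where "D = {\<kappa>1..K} \<times> sphere (0::real^'N) 1"
  have cD: "compact D" unfolding D_def by (intro compact_Times) auto
  have cont: "continuous_on D (\<lambda>(\<kappa>, c). Gamma_form \<alpha> y \<kappa> c)"
    by (rule continuous_on_subset[OF continuous_on_Gamma_form[OF y]]) (use k1p in \<open>auto simp: D_def\<close>)
  define E where "E = {p \<in> D. (case p of (\<kappa>, c) \<Rightarrow> Gamma_form \<alpha> y \<kappa> c) \<le> 0}"
  have "closedin (top_of_set D) E"
    using continuous_closedin_preimage[OF cont, of "{..0}"] by (simp add: E_def vimage_def Int_def)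
  then have cE: "compact E" using cD closedin_compact by blast
  have sub: "\<kappa> \<in> fst ` E" if h: "\<kappa> \<in> nonpos_set \<alpha> y" "\<kappa>1 \<le> \<kappa>" for \<kappa>
  proof -
    obtain c where c: "c \<noteq> 0" "Gamma_form \<alpha> y \<kappa> c \<le> 0" using h by (auto simp: nonpos_set_def)
    have "Gamma_form \<alpha> y \<kappa> ((1 / norm c) *\<^sub>R c) \<le> 0"
      unfolding Gamma_form_scaleR using c by (simp add: mult_nonneg_nonpos)
    then have "(\<kappa>, (1 / norm c) *\<^sub>R c) \<in> E" using h bd c by (simp add: E_def D_def)
    then show ?thesis by force
  qed
  have sub2: "\<kappa> \<in> nonpos_set \<alpha> y" if h: "\<kappa> \<in> fst ` E" for \<kappa>
  proof -
    obtain c where c: "\<kappa>1 \<le> \<kappa>" "norm c = 1" "Gamma_form \<alpha> y \<kappa> c \<le> 0"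
      using h by (auto simp: E_def D_def)
    then have "c \<noteq> 0" by auto
    then show ?thesis using c k1p by (auto simp: nonpos_set_def)
  qed
  have "compact (fst ` E)" using cE by (intro compact_continuous_image continuous_intros)
  moreover have "fst ` E \<noteq> {}" using sub[OF k1] by auto
  ultimately obtain m where m: "m \<in> fst ` E" "\<And>t. t \<in> fst ` E \<Longrightarrow> t \<le> m"
    using compact_attains_sup by metis
  have "\<kappa>' \<le> m" if "\<kappa>' \<in> nonpos_set \<alpha> y" for \<kappa>'
    using m(2)[OF sub[OF that]] m(2)[OF sub[OF k1]] by linarith
  then show ?thesis using sub2[OF m(1)] by blast
qed

lemma Gamma_form_tendsto:
  assumes y: "inj (y :: 'N::finite \<Rightarrow> real^'n)" and k: "0 < \<kappa>"
  shows "((\<lambda>s. Gamma_form \<alpha> y s c) \<longlongrightarrow> Gamma_form \<alpha> y \<kappa> c) (at \<kappa>)"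
proof -
  have "continuous_on {0<..} (\<lambda>s. case (s, c) of (s, c) \<Rightarrow> Gamma_form \<alpha> y s c)"
    by (rule continuous_on_compose2[OF continuous_on_Gamma_form[OF y]]) (auto intro!: continuous_intros)
  then show ?thesis using k by (simp add: continuous_on_eq_continuous_at isCont_def)
qed

text \<open>To the right of \<kappa> the form is positive, so at \<kappa> it is still nonnegative by
  continuity; a vector on which it is nonpositive there must lie in the kernel.\<close>

lemma det_Gamma_max_nonpos_set:
  assumes y: "inj (y :: 'N::finite \<Rightarrow> real^'n)" and k: "\<kappa> \<in> nonpos_set \<alpha> y"
    and max: "\<And>\<kappa>'. \<kappa>' \<in> nonpos_set \<alpha> y \<Longrightarrow> \<kappa>' \<le> \<kappa>"
  shows "det (Gamma_matrix \<alpha> y \<kappa>) = 0"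
proof -
  have kp: "0 < \<kappa>" using k by (simp add: nonpos_set_def)
  obtain c where c: "c \<noteq> 0" "Gamma_form \<alpha> y \<kappa> c \<le> 0" using k by (auto simp: nonpos_set_def)
  have psd: "0 \<le> Gamma_form \<alpha> y \<kappa> v" for v
  proof (rule tendsto_lowerbound)
    show "((\<lambda>s. Gamma_form \<alpha> y s v) \<longlongrightarrow> Gamma_form \<alpha> y \<kappa> v) (at_right \<kappa>)"
      using Gamma_form_tendsto[OF y kp] by (rule filterlim_mono) (auto simp: at_within_le_at)
    show "\<forall>\<^sub>F s in at_right \<kappa>. 0 \<le> Gamma_form \<alpha> y s v"
    proof (rule eventually_at_rightI[of \<kappa> "\<kappa> + 1"])
      fix s assume s: "s \<in> {\<kappa><..<\<kappa> + 1}"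
      then have "s \<notin> nonpos_set \<alpha> y" using max[of s] by auto
      then show "0 \<le> Gamma_form \<alpha> y s v"
        using s kp by (cases "v = 0") (auto simp: nonpos_set_def Gamma_form_def not_le intro: less_imp_le)
    qed simp
  qed simp
  have "Gamma_matrix \<alpha> y \<kappa> *v c = 0"
    by (rule psd_zero_imp_kernel[OF Gamma_matrix_symmetric])
       (use psd c in \<open>auto simp: Gamma_form_def antisym\<close>)
  then show ?thesis using c by (auto simp: det_eq_0_iff_kernel)
qed

text \<open>Continuity in \<kappa> lets a negative value of the form persist slightly to the right.
  This is the source of strict inequality between eigenvalues.\<close>

lemma nonpos_set_open_right:
  assumes y: "inj (y :: 'N::finite \<Rightarrow> real^'n)" and k: "0 < \<kappa>" and c: "Gamma_form \<alpha> y \<kappa> c < 0"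
  shows "\<exists>\<kappa>'>\<kappa>. \<kappa>' \<in> nonpos_set \<alpha> y"
proof -
  have "\<forall>\<^sub>F s in at \<kappa>. Gamma_form \<alpha> y s c < 0"
    using Gamma_form_tendsto[OF y k] c by (rule order_tendstoD)
  then have "\<forall>\<^sub>F s in at_right \<kappa>. Gamma_form \<alpha> y s c < 0"
    by (rule filter_leD[rotated]) (auto simp: at_within_le_at)
  then obtain b where b: "b > \<kappa>" "\<And>s. \<kappa> < s \<Longrightarrow> s < b \<Longrightarrow> Gamma_form \<alpha> y s c < 0"
    by (auto simp: eventually_at_right_field)
  define s where "s = (\<kappa> + b) / 2"
  have "Gamma_form \<alpha> y s c < 0" "s > \<kappa>" using b by (auto simp: s_def)
  moreover have "c \<noteq> 0" using c by (auto simp: Gamma_form_def)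
  ultimately show ?thesis using k by (intro exI[of _ s]) (auto simp: nonpos_set_def intro!: exI[of _ c])
qed

lemma nonpos_set_nonempty_2d:
  assumes "CARD('n) = 2" shows "nonpos_set \<alpha> (y :: 'N::finite \<Rightarrow> real^'n) \<noteq> {}"
proof -
  \<comment> \<open>Solves \<open>xi\<close> = \<alpha>: the diagonal of \<Gamma> vanishes, and what
    remains is nonpositive on the constant vector.\<close>
  define \<kappa> where "\<kappa> = 2 * exp (- euler_mascheroni - 2 * pi * \<alpha> :: real)"
  have "xi TYPE('n) \<kappa> = \<alpha>" by (simp add: xi_def assms \<kappa>_def)
  moreover have "0 \<le> pair_sum y \<kappa> 1" unfolding pair_sum_def by (intro sum_nonneg) simp
  ultimately have "Gamma_form \<alpha> y \<kappa> 1 \<le> 0" by (simp add: Gamma_form_eq)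
  moreover have "(1::real^'N) \<noteq> 0" by (simp add: vec_eq_iff)
  moreover have "0 < \<kappa>" by (simp add: \<kappa>_def)
  ultimately have "\<kappa> \<in> nonpos_set \<alpha> y" unfolding nonpos_set_def by blast
  then show ?thesis by blast
qed

section \<open>Krein's formula as a linear system for the charges of the point sources\<close>

lemma Gamma_matrix_diff:
  assumes "inj (y :: 'N::finite \<Rightarrow> real^'n)"
  shows "Gamma_matrix \<alpha> y \<kappa>' $ i $ j - Gamma_matrix \<alpha> y \<kappa> $ i $ j = green_diff \<kappa> \<kappa>' (y i - y j)"
  using assms by (auto simp: Gamma_matrix_def green_diff_def inj_eq)

definition point_source :: "real \<Rightarrow> ('N::finite \<Rightarrow> real^'n) \<Rightarrow> ('N \<Rightarrow> complex) \<Rightarrow> real^'n \<Rightarrow> complex" where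
  "point_source \<kappa> y a x = (\<Sum>j\<in>UNIV. a j * cgreen \<kappa> (x - y j))"

lemma point_source_L2: "0 < \<kappa> \<Longrightarrow> point_source \<kappa> y a \<in> L2"
  unfolding point_source_def[abs_def] by (intro L2_sum L2_cmult cgreen_L2)

text \<open>The charges a are characterised by the linear system with matrix \<Gamma>, so that later
  arguments can exhibit them instead of computing with the inverse matrix.\<close>

lemma krein_resolvent_eq:
  assumes det: "det (Gamma_matrix \<alpha> y \<kappa>) \<noteq> 0"
    and a: "\<And>i. (\<Sum>j\<in>UNIV. complex_of_real (Gamma_matrix \<alpha> y \<kappa> $ i $ j) * a j) = free_resolvent \<kappa> f (y i)"
  shows "krein_resolvent \<alpha> y \<kappa> f x = free_resolvent \<kappa> f x + point_source \<kappa> (y :: 'N::finite \<Rightarrow> real^'n) a x"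
proof -
  define G where "G = Gamma_matrix \<alpha> y \<kappa>"
  define B where "B = matrix_inv G"
  have "B ** G = mat 1" unfolding B_def
    using det by (intro matrix_inv_both) (simp add: G_def)
  then have BG: "(\<Sum>k\<in>UNIV. B $ j $ k * G $ k $ l) = (if j = l then 1 else 0)" for j l
    by (simp add: matrix_matrix_mult_def mat_def vec_eq_iff)
  have inv: "(\<Sum>k\<in>UNIV. complex_of_real (B $ j $ k) * free_resolvent \<kappa> f (y k)) = a j" for j
  proof -
    have "(\<Sum>k\<in>UNIV. complex_of_real (B $ j $ k) * free_resolvent \<kappa> f (y k))
      = (\<Sum>k\<in>UNIV. \<Sum>l\<in>UNIV. complex_of_real (B $ j $ k * G $ k $ l) * a l)"
      by (simp add: a[symmetric] G_def[symmetric] sum_distrib_left mult.assoc)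
    also have "\<dots> = (\<Sum>l\<in>UNIV. complex_of_real (\<Sum>k\<in>UNIV. B $ j $ k * G $ k $ l) * a l)"
      by (subst sum.swap) (simp only: of_real_sum sum_distrib_right)
    also have "\<dots> = a j"
      unfolding BG by (simp add: if_distrib[of complex_of_real] if_distrib[of "\<lambda>z. z * _"] cong: if_cong)
    finally show ?thesis .
  qed
  have f: "(\<integral>x'. cgreen \<kappa> (x' - y k) * f x' \<partial>lborel) = free_resolvent \<kappa> f (y k)" for k
    unfolding free_resolvent_def by (simp only: green_commute[of \<kappa> "y k"])
  show ?thesis
    unfolding krein_resolvent_def f B_def[symmetric] G_def[symmetric] point_source_def
    by (simp only: sum_distrib_right[symmetric] inv)
qed

lemma krein_coefficients:
  assumes det: "det (Gamma_matrix \<alpha> (y :: 'N::finite \<Rightarrow> real^'n) \<kappa>) \<noteq> 0"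
  obtains a where "\<And>i. (\<Sum>j\<in>UNIV. complex_of_real (Gamma_matrix \<alpha> y \<kappa> $ i $ j) * a j) = b i"
    and "\<And>j. a j = (\<Sum>k\<in>UNIV. complex_of_real (matrix_inv (Gamma_matrix \<alpha> y \<kappa>) $ j $ k) * b k)"
proof -
  define G where "G = Gamma_matrix \<alpha> y \<kappa>"
  define B where "B = matrix_inv G"
  have "G ** B = mat 1" unfolding B_def
    using det by (intro matrix_inv_both) (simp add: G_def)
  then have GB: "(\<Sum>k\<in>UNIV. G $ j $ k * B $ k $ l) = (if j = l then 1 else 0)" for j l
    by (simp add: matrix_matrix_mult_def mat_def vec_eq_iff)
  define a where "a j = (\<Sum>k\<in>UNIV. complex_of_real (B $ j $ k) * b k)" for j
  have "(\<Sum>j\<in>UNIV. complex_of_real (G $ i $ j) * a j) = b i" for i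
  proof -
    have "(\<Sum>j\<in>UNIV. complex_of_real (G $ i $ j) * a j) = (\<Sum>j\<in>UNIV. \<Sum>k\<in>UNIV. complex_of_real (G $ i $ j * B $ j $ k) * b k)"
      by (simp add: a_def sum_distrib_left mult.assoc)
    also have "\<dots> = (\<Sum>k\<in>UNIV. complex_of_real (\<Sum>j\<in>UNIV. G $ i $ j * B $ j $ k) * b k)"
      by (subst sum.swap) (simp only: of_real_sum sum_distrib_right)
    also have "\<dots> = b i"
      unfolding GB by (simp add: if_distrib[of complex_of_real] if_distrib[of "\<lambda>z. z * _"] cong: if_cong)
    finally show ?thesis .
  qed
  then show ?thesis using that[of a] by (simp add: a_def G_def B_def)
qed

text \<open>The function \<open>R\<^sub>\<kappa> f + \<Sum>\<^sub>j a\<^sub>j G\<^sub>\<kappa>(\<cdot> - y\<^sub>j)\<close> satisfies the boundary conditions at \<open>Y\<close> exactly when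
  \<open>\<Gamma> a\<close> is the vector of the values of \<open>R\<^sub>\<kappa> f\<close> on \<open>Y\<close>. Both eigenfunctions (\<open>f = 0\<close>) and images under
  the resolvent are of this form.\<close>

lemma point_hamiltonian_memI:
  assumes y: "inj (y :: 'N::finite \<Rightarrow> real^'n)" and k: "0 < \<kappa>" and f: "f \<in> L2"
    and a: "\<And>i. (\<Sum>j\<in>UNIV. complex_of_real (Gamma_matrix \<alpha> y \<kappa> $ i $ j) * a j) = free_resolvent \<kappa> f (y i)"
    and \<psi>: "\<psi> = (\<lambda>x. free_resolvent \<kappa> f x + point_source \<kappa> y a x)"
  shows "(\<psi>, \<lambda>x. f x - complex_of_real (\<kappa>\<^sup>2) * \<psi> x) \<in> point_hamiltonian \<alpha> y"
proof -
  have \<psi>L2: "\<psi> \<in> L2" unfolding \<psi> by (intro L2_add free_resolvent_L2 point_source_L2 k f)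
  moreover have "(\<lambda>x. f x - complex_of_real (\<kappa>\<^sup>2) * \<psi> x) \<in> L2" by (intro L2_diff L2_cmult f \<psi>L2)
  moreover have "AE x in lborel. \<psi> x = krein_resolvent \<alpha> y \<kappa>' (\<lambda>x'. f x' - complex_of_real (\<kappa>\<^sup>2) * \<psi> x' + complex_of_real (\<kappa>'\<^sup>2) * \<psi> x') x"
    if k': "0 < \<kappa>'" and det: "det (Gamma_matrix \<alpha> y \<kappa>') \<noteq> 0" for \<kappa>'
  proof -
    define d where "d = complex_of_real (\<kappa>'\<^sup>2 - \<kappa>\<^sup>2)"
    define g where "g = (\<lambda>x'. f x' + d * \<psi> x')"
    have g: "(\<lambda>x'. f x' - complex_of_real (\<kappa>\<^sup>2) * \<psi> x' + complex_of_real (\<kappa>'\<^sup>2) * \<psi> x') = g"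
      by (simp add: g_def d_def algebra_simps)
    \<comment> \<open>The resolvent identities for f and for the sources carry everything from
      \<kappa> to \<kappa>': the terms \<open>free_resolvent \<kappa>' f\<close> cancel, and each
      source leaves a difference of Green functions.\<close>
    have R: "free_resolvent \<kappa>' g x = free_resolvent \<kappa> f x + (\<Sum>j\<in>UNIV. a j * complex_of_real (green_diff \<kappa> \<kappa>' (x - y j)))" for x
    proof -
      have ps: "free_resolvent \<kappa>' (point_source \<kappa> y a) x = (\<Sum>j\<in>UNIV. a j * free_resolvent \<kappa>' (\<lambda>x. cgreen \<kappa> (x - y j)) x)"
        unfolding point_source_def[abs_def]
        by (subst free_resolvent_sum) (use k' in \<open>auto intro!: L2_cmult cgreen_L2[OF k] simp: free_resolvent_cmult\<close>)
      have d: "d * u = - (complex_of_real (\<kappa>\<^sup>2 - \<kappa>'\<^sup>2) * u)" for u by (simp add: d_def algebra_simps)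
      have "free_resolvent \<kappa>' g x = free_resolvent \<kappa>' f x + d * free_resolvent \<kappa>' \<psi> x"
        unfolding g_def using k' f \<psi>L2 by (subst free_resolvent_add) (auto intro: L2_cmult simp: free_resolvent_cmult)
      also have "d * free_resolvent \<kappa>' \<psi> x = d * free_resolvent \<kappa>' (free_resolvent \<kappa> f) x + (\<Sum>j\<in>UNIV. a j * (d * free_resolvent \<kappa>' (\<lambda>x. cgreen \<kappa> (x - y j)) x))"
        unfolding \<psi> using k k' f ps
        by (subst free_resolvent_add) (auto intro!: free_resolvent_L2 point_source_L2 simp: distrib_left sum_distrib_left mult.left_commute)
      also have "d * free_resolvent \<kappa>' (free_resolvent \<kappa> f) x = free_resolvent \<kappa> f x - free_resolvent \<kappa>' f x"
        unfolding d free_resolvent_identity[OF k' k f] by simp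
      also have "(\<Sum>j\<in>UNIV. a j * (d * free_resolvent \<kappa>' (\<lambda>x. cgreen \<kappa> (x - y j)) x)) = (\<Sum>j\<in>UNIV. a j * complex_of_real (green_diff \<kappa> \<kappa>' (x - y j)))"
        unfolding d free_resolvent_green[OF k' k] green_diff_swap[of \<kappa>' \<kappa>] by simp
      finally show ?thesis by simp
    qed
    \<comment> \<open>The same charges solve the system at \<kappa>': the change of \<Gamma> is the
      matrix of \<open>green_diff\<close>, and this is also the change of the right-hand side at the
      points of Y.\<close>
    have "(\<Sum>j\<in>UNIV. complex_of_real (Gamma_matrix \<alpha> y \<kappa>' $ i $ j) * a j) = free_resolvent \<kappa>' g (y i)" for i
      unfolding R a[symmetric] Gamma_matrix_diff[OF y, of \<alpha>, symmetric] sum.distrib[symmetric]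
      by (intro sum.cong) (auto simp: algebra_simps)
    then have kr: "krein_resolvent \<alpha> y \<kappa>' g x = free_resolvent \<kappa>' g x + point_source \<kappa>' y a x" for x
      by (rule krein_resolvent_eq[OF det])
    have "AE x in lborel. \<forall>j. x \<noteq> y j"
      by (simp add: AE_all_countable AE_lborel_singleton)
    then show ?thesis
      unfolding g
    proof eventually_elim
      case (elim x)
      then have e: "cgreen \<kappa> (x - y j) = complex_of_real (green_diff \<kappa> \<kappa>' (x - y j)) + cgreen \<kappa>' (x - y j)" for j
        by (simp add: green_diff_def)
      show ?case unfolding kr R \<psi> point_source_def e
        by (simp only: distrib_left sum.distrib add.assoc)
    qed
  qed
  ultimately show ?thesis by (simp add: point_hamiltonian_def)
qed

lemma point_hamiltonian_memD:
  assumes "(\<psi>, \<phi>) \<in> point_hamiltonian \<alpha> y" "0 < \<kappa>" "det (Gamma_matrix \<alpha> y \<kappa>) \<noteq> 0"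
  shows "AE x in lborel. \<psi> x = krein_resolvent \<alpha> y \<kappa> (\<lambda>x'. \<phi> x' + complex_of_real (\<kappa>\<^sup>2) * \<psi> x') x"
  using assms by (auto simp: point_hamiltonian_def)

lemma det_Gamma_nonzero_large:
  assumes "inj (y :: 'N::finite \<Rightarrow> real^'n)"
  shows "\<exists>K>0. \<forall>\<kappa>\<ge>K. det (Gamma_matrix \<alpha> y \<kappa>) \<noteq> 0"
proof -
  obtain K where K: "K > 0" "\<And>\<kappa> c. \<kappa> \<ge> K \<Longrightarrow> c \<noteq> 0 \<Longrightarrow> Gamma_form \<alpha> y \<kappa> c > 0"
    using Gamma_form_pos_large[OF assms] by blast
  have "det (Gamma_matrix \<alpha> y \<kappa>) \<noteq> 0" if "\<kappa> \<ge> K" for \<kappa>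
    using K(2)[OF that] by (force simp: det_eq_0_iff_kernel Gamma_form_def)
  then show ?thesis using K(1) by blast
qed

text \<open>If \<Gamma> is regular, Krein's formula applied to H \<psi> + \<kappa>^2 \<psi> = 0
  forces \<psi> = 0. If \<Gamma> c = 0, the charges c solve the system for f = 0, and the sources
  they carry form an eigenfunction.\<close>

lemma eigenvalue_iff_det:
  assumes y: "inj (y :: 'N::finite \<Rightarrow> real^'n)" and k: "0 < \<kappa>"
  shows "eigenvalue (point_hamiltonian \<alpha> y) (- \<kappa>\<^sup>2) \<longleftrightarrow> det (Gamma_matrix \<alpha> y \<kappa>) = 0"
proof
  assume "eigenvalue (point_hamiltonian \<alpha> y) (- \<kappa>\<^sup>2)"
  then obtain \<psi> where \<psi>: "(\<psi>, \<lambda>x. complex_of_real (- \<kappa>\<^sup>2) * \<psi> x) \<in> point_hamiltonian \<alpha> y" "\<not> (AE x in lborel. \<psi> x = 0)"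
    by (auto simp: eigenvalue_def eigenfunctions_def)
  show "det (Gamma_matrix \<alpha> y \<kappa>) = 0"
  proof (rule ccontr)
    assume "det (Gamma_matrix \<alpha> y \<kappa>) \<noteq> 0"
    from point_hamiltonian_memD[OF \<psi>(1) k this] \<psi>(2) show False
      by (simp add: krein_resolvent_def free_resolvent_def)
  qed
next
  assume "det (Gamma_matrix \<alpha> y \<kappa>) = 0"
  then obtain c where c: "c \<noteq> 0" "Gamma_matrix \<alpha> y \<kappa> *v c = 0" by (auto simp: det_eq_0_iff_kernel)
  define a where "a = (\<lambda>j. complex_of_real (c $ j))"
  define \<psi> where "\<psi> = (\<lambda>x. free_resolvent \<kappa> (\<lambda>_. 0) x + point_source \<kappa> y a x)"
  have Gc: "(\<Sum>j\<in>UNIV. complex_of_real (Gamma_matrix \<alpha> y \<kappa> $ i $ j) * a j) = 0" for i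
    using arg_cong[OF c(2), of "\<lambda>v. complex_of_real (v $ i)"] by (simp add: matrix_vector_mult_def a_def)
  have "(\<psi>, \<lambda>x. 0 - complex_of_real (\<kappa>\<^sup>2) * \<psi> x) \<in> point_hamiltonian \<alpha> y"
    by (rule point_hamiltonian_memI[OF y k L2_zero _ \<psi>_def]) (simp add: Gc free_resolvent_def)
  then have "\<psi> \<in> eigenfunctions (point_hamiltonian \<alpha> y) (- \<kappa>\<^sup>2)"
    by (simp add: eigenfunctions_def)
  moreover have "\<not> (AE x in lborel. \<psi> x = 0)"
  proof
    \<comment> \<open>If the combination of sources vanished, its resolvent at a large K, evaluated
      on Y, would give \<Gamma>(i\<kappa>) c = \<Gamma>(iK) c. The left side is 0, although
      \<Gamma>(iK) is regular.\<close>
    assume AE0: "AE x in lborel. \<psi> x = 0"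
    obtain K where K: "K > 0" "\<And>\<kappa>. \<kappa> \<ge> K \<Longrightarrow> det (Gamma_matrix \<alpha> y \<kappa>) \<noteq> 0"
      using det_Gamma_nonzero_large[OF y] by blast
    have ps: "\<psi> = point_source \<kappa> y a" by (simp add: \<psi>_def free_resolvent_def)
    have pm: "point_source \<kappa> y a \<in> borel_measurable borel"
      using point_source_L2[OF k, of y a] by (simp add: L2_iff)
    have "free_resolvent K (point_source \<kappa> y a) = free_resolvent K (\<lambda>_. 0)"
      by (rule free_resolvent_AE_cong) (use AE0 pm ps in auto)
    then have z: "free_resolvent K (point_source \<kappa> y a) x = 0" for x by (simp add: free_resolvent_def)
    have "(\<Sum>j\<in>UNIV. complex_of_real (Gamma_matrix \<alpha> y K $ i $ j) * a j) = 0" for i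
    proof -
      have "0 = complex_of_real (\<kappa>\<^sup>2 - K\<^sup>2) * free_resolvent K (point_source \<kappa> y a) (y i)" by (simp add: z)
      also have "\<dots> = (\<Sum>j\<in>UNIV. a j * (complex_of_real (\<kappa>\<^sup>2 - K\<^sup>2) * free_resolvent K (\<lambda>x. cgreen \<kappa> (x - y j)) (y i)))"
        unfolding point_source_def[abs_def]
        by (subst free_resolvent_sum) (use K in \<open>auto intro!: L2_cmult cgreen_L2[OF k] simp: free_resolvent_cmult sum_distrib_left mult.left_commute\<close>)
      also have "\<dots> = (\<Sum>j\<in>UNIV. complex_of_real (Gamma_matrix \<alpha> y \<kappa> $ i $ j) * a j) - (\<Sum>j\<in>UNIV. complex_of_real (Gamma_matrix \<alpha> y K $ i $ j) * a j)"
        unfolding free_resolvent_green[OF K(1) k] Gamma_matrix_diff[OF y, of \<alpha>, symmetric] sum_subtractf[symmetric]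
        by (intro sum.cong) (auto simp: algebra_simps)
      finally show ?thesis by (simp add: Gc)
    qed
    then have "complex_of_real ((Gamma_matrix \<alpha> y K *v c) $ i) = 0" for i
      by (simp add: matrix_vector_mult_def a_def)
    then have "Gamma_matrix \<alpha> y K *v c = 0" by (simp add: vec_eq_iff)
    then have "det (Gamma_matrix \<alpha> y K) = 0" using c(1) by (auto simp: det_eq_0_iff_kernel)
    then show False using K(2)[of K] by simp
  qed
  ultimately show "eigenvalue (point_hamiltonian \<alpha> y) (- \<kappa>\<^sup>2)" by (auto simp: eigenvalue_def)
qed

text \<open>Each negative eigenvalue comes from a positive zero of the determinant, which is at most
  \<kappa>; nonnegative eigenvalues lie above in any case.\<close>

lemma lambda1_eq:
  assumes y: "inj (y :: 'N::finite \<Rightarrow> real^'n)" and k: "\<kappa> \<in> nonpos_set \<alpha> y"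
    and max: "\<And>\<kappa>'. \<kappa>' \<in> nonpos_set \<alpha> y \<Longrightarrow> \<kappa>' \<le> \<kappa>"
  shows "lambda1 \<alpha> y = - \<kappa>\<^sup>2"
  unfolding lambda1_def
proof (rule Least_equality)
  have kp: "0 < \<kappa>" using k by (simp add: nonpos_set_def)
  show "eigenvalue (point_hamiltonian \<alpha> y) (- \<kappa>\<^sup>2)"
    using det_Gamma_max_nonpos_set[OF y k max] eigenvalue_iff_det[OF y kp] by blast
  fix l assume l: "eigenvalue (point_hamiltonian \<alpha> y) l"
  show "- \<kappa>\<^sup>2 \<le> l"
  proof (cases "l < 0")
    case True
    then have p: "0 < sqrt (- l)" "l = - (sqrt (- l))\<^sup>2" by auto
    then have "det (Gamma_matrix \<alpha> y (sqrt (- l))) = 0" using eigenvalue_iff_det[OF y p(1), of \<alpha>] l by simp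
    then have "sqrt (- l) \<le> \<kappa>" using det_Gamma_0_imp_nonpos_set[OF p(1)] max by blast
    then have "(sqrt (- l))\<^sup>2 \<le> \<kappa>\<^sup>2" using p(1) by (intro power_mono) auto
    then show ?thesis using True by simp
  next
    case False
    then show ?thesis by (simp add: order_trans[of _ 0])
  qed
qed

end

section \<open>Resolvent set and multiplicities\<close>

definition bounded_L2 :: "((real^'n \<Rightarrow> complex) \<Rightarrow> (real^'n \<Rightarrow> complex)) \<Rightarrow> bool" where
  "bounded_L2 A \<longleftrightarrow> (\<exists>C\<ge>0. \<forall>f\<in>L2. A f \<in> L2 \<and> L2_sq (A f) \<le> ennreal C * L2_sq f)"

lemma bounded_L2_add:
  assumes "bounded_L2 A" "bounded_L2 B"
  shows "bounded_L2 (\<lambda>f x. A f x + B f (x :: real^'n))"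
proof -
  obtain a b where a: "a \<ge> 0" "\<And>f. f \<in> L2 \<Longrightarrow> A f \<in> L2 \<and> L2_sq (A f) \<le> ennreal a * L2_sq f"
    and b: "b \<ge> 0" "\<And>f. f \<in> L2 \<Longrightarrow> B f \<in> L2 \<and> L2_sq (B f) \<le> ennreal b * L2_sq f"
    using assms unfolding bounded_L2_def by metis
  have "L2_sq (\<lambda>x. A f x + B f x) \<le> ennreal (2 * a + 2 * b) * L2_sq f" if f: "f \<in> L2" for f
  proof -
    have "L2_sq (\<lambda>x. A f x + B f x) \<le> 2 * L2_sq (A f) + 2 * L2_sq (B f)"
      using a(2)[OF f] b(2)[OF f] by (intro L2_sq_add_le) (auto simp: L2_iff)
    also have "\<dots> \<le> 2 * (ennreal a * L2_sq f) + 2 * (ennreal b * L2_sq f)"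
      using a(2)[OF f] b(2)[OF f] by (intro add_mono mult_left_mono) auto
    also have "\<dots> = ennreal (2 * a + 2 * b) * L2_sq f"
      using a b by (simp add: ennreal_plus ennreal_mult distrib_right mult.assoc)
    finally show ?thesis .
  qed
  then show ?thesis unfolding bounded_L2_def using a b
    by (intro exI[of _ "2 * a + 2 * b"]) (auto intro: L2_add)
qed

lemma bounded_L2_sum:
  "finite I \<Longrightarrow> (\<And>i. i \<in> I \<Longrightarrow> bounded_L2 (A i)) \<Longrightarrow> bounded_L2 (\<lambda>f x. \<Sum>i\<in>I. A i f (x :: real^'n))"
proof (induction I rule: finite_induct)
  case empty
  then show ?case by (auto simp: bounded_L2_def L2_zero L2_sq_def intro!: exI[of _ 0])
next
  case (insert i I)
  then show ?case by (simp add: bounded_L2_add)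
qed

text \<open>An eigenfunction and 0 would both solve the equation with right-hand side f = 0, against
  uniqueness.\<close>

lemma eigenvalue_in_spectrum:
  assumes "eigenvalue T l" and zero: "(\<lambda>_. 0, \<lambda>_. 0) \<in> T"
  shows "l \<in> spectrum T"
proof (rule ccontr)
  assume "l \<notin> spectrum T"
  then obtain K where K: "\<And>f. f \<in> L2 \<Longrightarrow> \<exists>\<psi>. (\<psi>, \<lambda>x. f x + complex_of_real l * \<psi> x) \<in> T \<and> L2_norm \<psi> \<le> K * L2_norm f \<and>
        (\<forall>\<psi>'. (\<psi>', \<lambda>x. f x + complex_of_real l * \<psi>' x) \<in> T \<longrightarrow> (AE x in lborel. \<psi>' x = \<psi> x))"
    unfolding spectrum_def resolvent_set_def by blast
  obtain \<psi>0 where u: "\<And>\<psi>'. (\<psi>', \<lambda>x. complex_of_real l * \<psi>' x) \<in> T \<Longrightarrow> (AE x in lborel. \<psi>' x = \<psi>0 x)"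
    using K[OF L2_zero] by auto
  obtain \<psi> where \<psi>: "(\<psi>, \<lambda>x. complex_of_real l * \<psi> x) \<in> T" "\<not> (AE x in lborel. \<psi> x = 0)"
    using assms(1) by (auto simp: eigenvalue_def eigenfunctions_def)
  have "AE x in lborel. \<psi> x = \<psi>0 x" "AE x in lborel. 0 = \<psi>0 x"
    using u[OF \<psi>(1)] u[of "\<lambda>_. 0"] zero by simp_all
  then have "AE x in lborel. \<psi> x = 0" by eventually_elim simp
  then show False using \<psi>(2) by simp
qed

context low_dim
begin

lemma green_integrable: "0 < \<kappa> \<Longrightarrow> integrable lborel (green \<kappa> :: real^'n \<Rightarrow> real)"
  using nn_integral_green[OF card_dim] by (intro integrableI_nonneg) auto

lemma integral_green: "0 < \<kappa> \<Longrightarrow> (\<integral>z. green \<kappa> (z :: real^'n) \<partial>lborel) = 1 / \<kappa>\<^sup>2"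
  using nn_integral_green[OF card_dim, of \<kappa>] by (subst integral_eq_nn_integral) auto

lemma bounded_L2_free_resolvent: "0 < \<kappa> \<Longrightarrow> bounded_L2 (free_resolvent \<kappa> :: (real^'n \<Rightarrow> complex) \<Rightarrow> _)"
  unfolding bounded_L2_def
proof (intro exI[of _ "(1 / \<kappa>\<^sup>2)\<^sup>2"] conjI ballI)
  fix f :: "real^'n \<Rightarrow> complex" assume k: "0 < \<kappa>" and f: "f \<in> L2"
  show "free_resolvent \<kappa> f \<in> L2" using k f by (rule free_resolvent_L2)
  have "f \<in> borel_measurable borel" using f by (simp add: L2_iff)
  from free_resolvent_L2_sq[OF k this] show "L2_sq (free_resolvent \<kappa> f) \<le> ennreal ((1 / \<kappa>\<^sup>2)\<^sup>2) * L2_sq f"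
    by (simp only: ennreal_power zero_le_divide_1_iff zero_le_power2)
qed simp

text \<open>The correction to the free resolvent is a finite sum of rank-one operators, each bounded
  by the Cauchy-Schwarz inequality.\<close>

lemma bounded_L2_krein:
  assumes k: "0 < \<kappa>"
  shows "bounded_L2 (krein_resolvent \<alpha> (y :: 'N::finite \<Rightarrow> real^'n) \<kappa>)"
proof -
  have "bounded_L2 (\<lambda>f x. b * (\<integral>x'. cgreen \<kappa> (x' - y i) * f x' \<partial>lborel) * cgreen \<kappa> (x - y j))" for b :: complex and i j
  proof -
    define M where "M = enn2real (L2_sq (cgreen \<kappa> :: real^'n \<Rightarrow> complex))"
    have M: "L2_sq (cgreen \<kappa> :: real^'n \<Rightarrow> complex) = ennreal M" "M \<ge> 0"
      using cgreen_L2_sq_finite[OF k] by (auto simp: M_def)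
    have "(\<lambda>x. b * (\<integral>x'. cgreen \<kappa> (x' - y i) * f x' \<partial>lborel) * cgreen \<kappa> (x - y j)) \<in> L2 \<and>
      L2_sq (\<lambda>x. b * (\<integral>x'. cgreen \<kappa> (x' - y i) * f x' \<partial>lborel) * cgreen \<kappa> (x - y j)) \<le> ennreal ((cmod b)\<^sup>2 * M * M) * L2_sq f"
      if f: "f \<in> L2" for f
    proof
      define v where "v = free_resolvent \<kappa> f (y i)"
      have v: "(\<integral>x'. cgreen \<kappa> (x' - y i) * f x' \<partial>lborel) = v"
        unfolding v_def free_resolvent_def by (simp only: green_commute[of \<kappa> "y i"])
      show "(\<lambda>x. b * (\<integral>x'. cgreen \<kappa> (x' - y i) * f x' \<partial>lborel) * cgreen \<kappa> (x - y j)) \<in> L2"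
        by (intro L2_cmult cgreen_L2 k)
      have "L2_sq (\<lambda>x. b * v * cgreen \<kappa> (x - y j)) = ennreal ((cmod b)\<^sup>2) * ennreal ((cmod v)\<^sup>2) * ennreal M"
        by (simp add: L2_sq_cmult L2_sq_translate[of "cgreen \<kappa>"] M norm_mult power_mult_distrib ennreal_mult)
      also have "\<dots> \<le> ennreal ((cmod b)\<^sup>2) * (ennreal M * L2_sq f) * ennreal M"
        using free_resolvent_bound[OF k f, of "y i"] by (intro mult_mono) (auto simp: v_def M)
      also have "\<dots> = ennreal ((cmod b)\<^sup>2 * M * M) * L2_sq f"
        using M by (simp add: ennreal_mult mult_ac)
      finally show "L2_sq (\<lambda>x. b * (\<integral>x'. cgreen \<kappa> (x' - y i) * f x' \<partial>lborel) * cgreen \<kappa> (x - y j)) \<le> ennreal ((cmod b)\<^sup>2 * M * M) * L2_sq f"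
        unfolding v .
    qed
    then show ?thesis unfolding bounded_L2_def using M(2) by (intro exI[of _ "(cmod b)\<^sup>2 * M * M"]) auto
  qed
  then show ?thesis
    unfolding krein_resolvent_def[abs_def]
    by (intro bounded_L2_add bounded_L2_free_resolvent k bounded_L2_sum) auto
qed

text \<open>Not immediate from the definition: membership demands Krein's formula at all regular
  parameters, whereas the function is built from a single one.\<close>

lemma krein_resolvent_in_hamiltonian:
  assumes y: "inj (y :: 'N::finite \<Rightarrow> real^'n)" and k: "0 < \<kappa>" and det: "det (Gamma_matrix \<alpha> y \<kappa>) \<noteq> 0" and f: "f \<in> L2"
  shows "(krein_resolvent \<alpha> y \<kappa> f, \<lambda>x. f x - complex_of_real (\<kappa>\<^sup>2) * krein_resolvent \<alpha> y \<kappa> f x) \<in> point_hamiltonian \<alpha> y"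
proof -
  obtain a where a: "\<And>i. (\<Sum>j\<in>UNIV. complex_of_real (Gamma_matrix \<alpha> y \<kappa> $ i $ j) * a j) = free_resolvent \<kappa> f (y i)"
    using krein_coefficients[OF det, of "\<lambda>i. free_resolvent \<kappa> f (y i)"] by blast
  show ?thesis
    by (rule point_hamiltonian_memI[OF y k f a]) (simp_all add: krein_resolvent_eq[OF det a] fun_eq_iff)
qed

lemma zero_in_hamiltonian: "(\<lambda>_. 0, \<lambda>_. 0) \<in> point_hamiltonian \<alpha> (y :: 'N::finite \<Rightarrow> real^'n)"
  by (simp add: point_hamiltonian_def L2_zero krein_resolvent_def free_resolvent_def)

lemma L2_norm_le_of_sq:
  assumes "f \<in> L2" "g \<in> L2" "C \<ge> 0" and le: "L2_sq g \<le> ennreal C * L2_sq (f :: real^'n \<Rightarrow> complex)"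
  shows "L2_norm g \<le> sqrt C * L2_norm f"
proof -
  have "ennreal ((L2_norm g)\<^sup>2) \<le> ennreal C * ennreal ((L2_norm f)\<^sup>2)"
    using le assms by (simp add: L2_norm_sq)
  then have "(L2_norm g)\<^sup>2 \<le> (sqrt C * L2_norm f)\<^sup>2"
    using assms by (simp add: power_mult_distrib flip: ennreal_mult)
  then show ?thesis by (rule power2_le_imp_le) (simp add: L2_norm_nonneg assms)
qed

lemma det_nonzero_imp_resolvent_set:
  assumes y: "inj (y :: 'N::finite \<Rightarrow> real^'n)" and k: "0 < \<kappa>" and det: "det (Gamma_matrix \<alpha> y \<kappa>) \<noteq> 0"
  shows "- \<kappa>\<^sup>2 \<in> resolvent_set (point_hamiltonian \<alpha> y)"
proof -
  obtain C where C: "C \<ge> 0" "\<And>f. f \<in> L2 \<Longrightarrow> krein_resolvent \<alpha> y \<kappa> f \<in> L2 \<and> L2_sq (krein_resolvent \<alpha> y \<kappa> f) \<le> ennreal C * L2_sq f"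
    using bounded_L2_krein[OF k, of \<alpha> y] unfolding bounded_L2_def by blast
  have "\<exists>\<psi>. (\<psi>, \<lambda>x. f x + complex_of_real (- \<kappa>\<^sup>2) * \<psi> x) \<in> point_hamiltonian \<alpha> y \<and> L2_norm \<psi> \<le> sqrt C * L2_norm f \<and>
        (\<forall>\<psi>'. (\<psi>', \<lambda>x. f x + complex_of_real (- \<kappa>\<^sup>2) * \<psi>' x) \<in> point_hamiltonian \<alpha> y \<longrightarrow> (AE x in lborel. \<psi>' x = \<psi> x))"
    if f: "f \<in> L2" for f
  proof (intro exI[of _ "krein_resolvent \<alpha> y \<kappa> f"] conjI allI impI)
    show "(krein_resolvent \<alpha> y \<kappa> f, \<lambda>x. f x + complex_of_real (- \<kappa>\<^sup>2) * krein_resolvent \<alpha> y \<kappa> f x) \<in> point_hamiltonian \<alpha> y"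
      using krein_resolvent_in_hamiltonian[OF y k det f] by simp
    show "L2_norm (krein_resolvent \<alpha> y \<kappa> f) \<le> sqrt C * L2_norm f"
      using C f by (intro L2_norm_le_of_sq) auto
    fix \<psi>' assume "(\<psi>', \<lambda>x. f x + complex_of_real (- \<kappa>\<^sup>2) * \<psi>' x) \<in> point_hamiltonian \<alpha> y"
    from point_hamiltonian_memD[OF this k det] show "AE x in lborel. \<psi>' x = krein_resolvent \<alpha> y \<kappa> f x"
      by simp
  qed
  then show ?thesis unfolding resolvent_set_def by blast
qed

text \<open>Eigenfunctions are combinations of the N sources with parameter \<kappa>. Krein's
  formula is used at a regular K, as \<Gamma>(i\<kappa>) may be singular. After subtraction of
  sources at \<kappa> with the same charges, the remainder \<phi> satisfies the free eigenvalue
  equation in resolvent form and must vanish.\<close>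

lemma finite_multiplicity_negative:
  assumes y: "inj (y :: 'N::finite \<Rightarrow> real^'n)" and k: "0 < \<kappa>"
  shows "finite_multiplicity (point_hamiltonian \<alpha> y) (- \<kappa>\<^sup>2)"
proof -
  define u where "u = (\<lambda>j x. cgreen \<kappa> (x - y j))"
  define B where "B = range u"
  obtain K where K: "K > 0" "det (Gamma_matrix \<alpha> y K) \<noteq> 0"
    using det_Gamma_nonzero_large[OF y] by blast
  have "\<exists>c. AE x in lborel. \<psi> x = (\<Sum>b\<in>B. c b * b x)"
    if h: "\<psi> \<in> eigenfunctions (point_hamiltonian \<alpha> y) (- \<kappa>\<^sup>2)" for \<psi>
  proof -
    define d where "d = complex_of_real (K\<^sup>2 - \<kappa>\<^sup>2)"
    have mem: "(\<psi>, \<lambda>x. complex_of_real (- \<kappa>\<^sup>2) * \<psi> x) \<in> point_hamiltonian \<alpha> y"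
      using h by (simp add: eigenfunctions_def)
    have \<psi>L2: "\<psi> \<in> L2" using mem by (simp add: point_hamiltonian_def)
    have e: "(\<lambda>x'. complex_of_real (- \<kappa>\<^sup>2) * \<psi> x' + complex_of_real (K\<^sup>2) * \<psi> x') = (\<lambda>x. d * \<psi> x)"
      by (simp add: d_def algebra_simps)
    obtain a where a: "\<And>i. (\<Sum>j\<in>UNIV. complex_of_real (Gamma_matrix \<alpha> y K $ i $ j) * a j) = free_resolvent K (\<lambda>x. d * \<psi> x) (y i)"
      using krein_coefficients[OF K(2), of "\<lambda>i. free_resolvent K (\<lambda>x. d * \<psi> x) (y i)"] by blast
    have eq: "AE x in lborel. \<psi> x = d * free_resolvent K \<psi> x + point_source K y a x"
      using point_hamiltonian_memD[OF mem K] unfolding e krein_resolvent_eq[OF K(2) a] free_resolvent_cmult .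
    define \<phi> where "\<phi> = (\<lambda>x. \<psi> x - point_source \<kappa> y a x)"
    have \<phi>L2: "\<phi> \<in> L2" unfolding \<phi>_def by (intro L2_diff \<psi>L2 point_source_L2 k)
    have d: "d * w = - (complex_of_real (\<kappa>\<^sup>2 - K\<^sup>2) * w)" for w by (simp add: d_def algebra_simps)
    have R: "d * free_resolvent K \<phi> x = d * free_resolvent K \<psi> x - (\<Sum>j\<in>UNIV. a j * complex_of_real (green_diff \<kappa> K (x - y j)))" for x
    proof -
      have "free_resolvent K \<phi> x = free_resolvent K \<psi> x + (-1) * free_resolvent K (point_source \<kappa> y a) x"
      proof -
        have "\<phi> = (\<lambda>x. \<psi> x + (-1) * point_source \<kappa> y a x)" by (simp add: \<phi>_def)
        then show ?thesis
          using free_resolvent_add[OF K(1) \<psi>L2 L2_cmult[OF point_source_L2[OF k, of y a], of "-1"], of x]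
          by (simp only: free_resolvent_cmult)
      qed
      moreover have "free_resolvent K (point_source \<kappa> y a) x = (\<Sum>j\<in>UNIV. a j * free_resolvent K (\<lambda>x. cgreen \<kappa> (x - y j)) x)"
        unfolding point_source_def[abs_def]
        by (subst free_resolvent_sum) (use K in \<open>auto intro!: L2_cmult cgreen_L2[OF k] simp: free_resolvent_cmult\<close>)
      ultimately have "d * free_resolvent K \<phi> x = d * free_resolvent K \<psi> x - (\<Sum>j\<in>UNIV. a j * (d * free_resolvent K (\<lambda>x. cgreen \<kappa> (x - y j)) x))"
        by (simp add: right_diff_distrib distrib_left sum_distrib_left mult.left_commute sum_negf)
      then show ?thesis
        unfolding d free_resolvent_green[OF K(1) k] green_diff_swap[of K \<kappa>] by simp
    qed
    have AEy: "AE x in lborel. \<forall>j. x \<noteq> y j"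
      by (simp add: AE_all_countable AE_lborel_singleton)
    have fixp: "AE x in lborel. \<phi> x = d * free_resolvent K \<phi> x"
      using eq AEy
    proof eventually_elim
      case (elim x)
      then have g: "cgreen \<kappa> (x - y j) = complex_of_real (green_diff \<kappa> K (x - y j)) + cgreen K (x - y j)" for j
        by (simp add: green_diff_def)
      have "\<phi> x = d * free_resolvent K \<psi> x + point_source K y a x - point_source \<kappa> y a x"
        by (simp only: \<phi>_def elim(1)[symmetric])
      also have "\<dots> = d * free_resolvent K \<phi> x"
        unfolding R point_source_def g by (simp add: distrib_left sum.distrib)
      finally show ?case .
    qed
    \<comment> \<open>Applying the resolvent at \<kappa> to \<phi> = d R_K \<phi> and using the
      resolvent identity leaves R_K \<phi> = 0.\<close>
    have "free_resolvent \<kappa> \<phi> = free_resolvent \<kappa> (\<lambda>x. d * free_resolvent K \<phi> x)"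
      using fixp \<phi>L2 L2_cmult[OF free_resolvent_L2[OF K(1) \<phi>L2], of d]
      by (intro free_resolvent_AE_cong) (auto simp: L2_iff)
    then have "free_resolvent \<kappa> \<phi> x = free_resolvent \<kappa> \<phi> x - free_resolvent K \<phi> x" for x
      using free_resolvent_identity[OF k K(1) \<phi>L2, of x] by (simp add: free_resolvent_cmult d_def)
    then have "free_resolvent K \<phi> x = 0" for x by (simp add: algebra_simps)
    with fixp have "AE x in lborel. \<psi> x = point_source \<kappa> y a x" by (simp add: \<phi>_def)
    moreover have "point_source \<kappa> y a x = (\<Sum>b\<in>B. (\<Sum>j | u j = b. a j) * b x)" for x
    proof -
      have "point_source \<kappa> y a x = (\<Sum>j\<in>UNIV. a j * u j x)" by (simp add: point_source_def u_def)
      also have "\<dots> = (\<Sum>b\<in>u ` UNIV. \<Sum>j | j \<in> UNIV \<and> u j = b. a j * u j x)" by (rule sum.image_gen) simp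
      also have "\<dots> = (\<Sum>b\<in>B. (\<Sum>j | u j = b. a j) * b x)"
        unfolding B_def by (intro sum.cong) (auto simp: sum_distrib_right intro!: sum.cong)
      finally show ?thesis .
    qed
    ultimately show ?thesis by (intro exI[of _ "\<lambda>b. \<Sum>j | u j = b. a j"]) simp
  qed
  moreover have "finite B" "B \<subseteq> L2" unfolding B_def u_def using cgreen_L2[OF k] by auto
  ultimately show ?thesis unfolding finite_multiplicity_def by blast
qed

text \<open>The Fourier transform of an even real function is real, so only the cosine integral
  counts; it is the integral with 1 + cos minus the total mass.\<close>

lemma integral_green_cis:
  assumes \<kappa>: "0 < \<kappa>" and b: "b \<in> Basis"
  shows "(\<integral>z. cgreen \<kappa> (z :: real^'n) * cis (- (k * (z \<bullet> b))) \<partial>lborel) = complex_of_real (1 / (\<kappa>\<^sup>2 + k\<^sup>2))" (is "?I = _")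
proof -
  have [measurable]: "cis \<in> borel_measurable borel"
    by (intro borel_measurable_continuous_onI continuous_intros)
  have int: "integrable lborel (\<lambda>z. cgreen \<kappa> (z :: real^'n) * cis (c * (z \<bullet> b)))" for c
    by (rule Bochner_Integration.integrable_bound[OF green_integrable[OF \<kappa>]]) (auto simp: norm_mult)
  have intc: "integrable lborel (\<lambda>z. green \<kappa> (z :: real^'n) * cos (k * (z \<bullet> b)))"
    by (rule Bochner_Integration.integrable_bound[OF green_integrable[OF \<kappa>]]) (auto simp: abs_mult intro!: mult_left_le)
  have cosge: "0 \<le> 1 + cos u" for u :: real using cos_ge_minus_one[of u] by linarith
  have "?I = (\<integral>z. cgreen \<kappa> (0 - z) * cis (- (k * ((0 - z) \<bullet> b))) \<partial>lborel)"
    by (rule integral_lborel_reflect[symmetric]) measurable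
  also have "\<dots> = (\<integral>z. cnj (cgreen \<kappa> (z :: real^'n) * cis (- (k * (z \<bullet> b)))) \<partial>lborel)"
    by (simp add: green_minus cis_cnj)
  also have "\<dots> = cnj ?I" by (rule Bochner_Integration.integral_cnj)
  finally have "Im ?I = 0" by (metis Reals_cnj_iff complex_is_Real_iff)
  moreover have "Re ?I = 1 / (\<kappa>\<^sup>2 + k\<^sup>2)"
  proof -
    have "Re ?I = (\<integral>z. Re (cgreen \<kappa> (z :: real^'n) * cis (- (k * (z \<bullet> b)))) \<partial>lborel)"
      by (rule integral_Re[symmetric]) (use int[of "- k"] in simp)
    also have "\<dots> = (\<integral>z. green \<kappa> (z :: real^'n) * cos (k * (z \<bullet> b)) \<partial>lborel)" by simp
    also have "\<dots> = (\<integral>z. green \<kappa> (z :: real^'n) * (1 + cos (k * (z \<bullet> b))) \<partial>lborel) - (\<integral>z. green \<kappa> (z :: real^'n) \<partial>lborel)"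
      using intc green_integrable[OF \<kappa>] by (simp add: distrib_left)
    also have "(\<integral>z. green \<kappa> (z :: real^'n) * (1 + cos (k * (z \<bullet> b))) \<partial>lborel) = 1 / \<kappa>\<^sup>2 + 1 / (\<kappa>\<^sup>2 + k\<^sup>2)"
      using cosge by (subst integral_eq_nn_integral) (auto simp: nn_integral_green_cos[OF card_dim \<kappa> b] simp del: ennreal_plus)
    finally show ?thesis using integral_green[OF \<kappa>] by simp
  qed
  ultimately show ?thesis by (simp add: complex_eq_iff)
qed

end

section \<open>Approximate eigenfunctions at positive energies\<close>

text \<open>The constant 8 makes the square a multiple of \<open>heat s\<close>, so that the L2 norm
  is known.\<close>

definition wide_gauss :: "real \<Rightarrow> real^'n \<Rightarrow> real" where
  "wide_gauss s x = exp (- (norm x)\<^sup>2 / (8 * s))"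

lemma wide_gauss_measurable [measurable]: "wide_gauss s \<in> borel_measurable borel"
  unfolding wide_gauss_def[abs_def] by measurable

text \<open>The parallelogram law about the midpoint x - z / 2 splits off an overlap factor that
  depends on z alone.\<close>

lemma wide_gauss_mult:
  assumes s: "s > 0"
  shows "wide_gauss s (x - z) * wide_gauss s x = exp (- (norm z)\<^sup>2 / (16 * s)) * (wide_gauss s (x - (1/2) *\<^sub>R z))\<^sup>2"
proof -
  have "(norm (x - z))\<^sup>2 + (norm x)\<^sup>2 = (norm z)\<^sup>2 / 2 + 2 * (norm (x - (1/2) *\<^sub>R z))\<^sup>2"
    by (simp add: power2_norm_eq_inner inner_diff_left inner_diff_right inner_commute field_simps)
  then have "- (norm (x - z))\<^sup>2 / (8 * s) + - (norm x)\<^sup>2 / (8 * s)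
     = - (norm z)\<^sup>2 / (16 * s) + (- (norm (x - (1/2) *\<^sub>R z))\<^sup>2 / (8 * s) + - (norm (x - (1/2) *\<^sub>R z))\<^sup>2 / (8 * s))"
  proof -
    assume a: "(norm (x - z))\<^sup>2 + (norm x)\<^sup>2 = (norm z)\<^sup>2 / 2 + 2 * (norm (x - (1/2) *\<^sub>R z))\<^sup>2"
    then have e: "(norm z)\<^sup>2 = 2 * (norm x)\<^sup>2 + 2 * (norm (x - z))\<^sup>2 - 4 * (norm (x - (1/2) *\<^sub>R z))\<^sup>2" by simp
    show ?thesis unfolding e using s by (simp add: field_simps)
  qed
  then show ?thesis by (simp only: wide_gauss_def mult_exp_exp power2_eq_square)
qed

lemma wide_gauss_square_integral:
  assumes s: "s > 0"
  shows "integrable lborel (\<lambda>x. (wide_gauss s (x - z :: real^'n))\<^sup>2)"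
    and "(\<integral>x. (wide_gauss s (x - z :: real^'n))\<^sup>2 \<partial>lborel) = sqrt (4 * pi * s) ^ CARD('n)"
proof -
  let ?A = "sqrt (4 * pi * s) ^ CARD('n)"
  have e: "(wide_gauss s x)\<^sup>2 = ?A * heat s x" for x :: "real^'n"
  proof -
    have "(wide_gauss s x)\<^sup>2 = exp (- (norm x)\<^sup>2 / (4 * s))"
      using s by (simp add: wide_gauss_def power2_eq_square mult_exp_exp)
    then show ?thesis using s by (simp add: heat_def)
  qed
  have "(\<integral>\<^sup>+x. ennreal ((wide_gauss s (x - z))\<^sup>2) \<partial>lborel) = (\<integral>\<^sup>+x. ennreal ((wide_gauss s (x :: real^'n))\<^sup>2) \<partial>lborel)"
    using nn_integral_lborel_translate[of "\<lambda>x. ennreal ((wide_gauss s (x :: real^'n))\<^sup>2)" "- z"] by simp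
  also have "\<dots> = (\<integral>\<^sup>+x. ennreal ?A * ennreal (heat s (x :: real^'n)) \<partial>lborel)"
    using s by (simp add: e ennreal_mult)
  also have "\<dots> = ennreal ?A * (\<integral>\<^sup>+x. ennreal (heat s (x :: real^'n)) \<partial>lborel)"
    by (rule nn_integral_cmult) measurable
  also have "\<dots> = ennreal ?A" by (simp add: nn_integral_heat[OF s])
  finally have n: "(\<integral>\<^sup>+x. ennreal ((wide_gauss s (x - z))\<^sup>2) \<partial>lborel) = ennreal ?A" .
  show "integrable lborel (\<lambda>x. (wide_gauss s (x - z :: real^'n))\<^sup>2)"
    using n by (intro integrableI_nonneg) auto
  show "(\<integral>x. (wide_gauss s (x - z :: real^'n))\<^sup>2 \<partial>lborel) = ?A"
    using n s by (subst integral_eq_nn_integral) auto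
qed

text \<open>Both copies have the same norm, so the squared distance is governed by their overlap exp
  (- |z|^2 / (16 s)).\<close>

lemma wide_gauss_shift_diff:
  assumes s: "s > 0"
  shows "(\<integral>\<^sup>+x. ennreal ((wide_gauss s (x :: real^'n) - wide_gauss s (x - z))\<^sup>2) \<partial>lborel)
    = ennreal (2 * sqrt (4 * pi * s) ^ CARD('n) * (1 - exp (- (norm z)\<^sup>2 / (16 * s))))"
proof -
  let ?e = "exp (- (norm z)\<^sup>2 / (16 * s))"
  have e: "(wide_gauss s x - wide_gauss s (x - z))\<^sup>2 = (wide_gauss s (x - 0))\<^sup>2 + (wide_gauss s (x - z))\<^sup>2 - 2 * ?e * (wide_gauss s (x - (1/2) *\<^sub>R z))\<^sup>2" for x :: "real^'n"
    using wide_gauss_mult[OF s, of x z] by (simp add: power2_eq_square algebra_simps)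
  note i = wide_gauss_square_integral[OF s, where 'n='n]
  have "integrable lborel (\<lambda>x :: real^'n. (wide_gauss s x - wide_gauss s (x - z))\<^sup>2)"
    unfolding e by (intro Bochner_Integration.integrable_diff Bochner_Integration.integrable_add integrable_mult_right i(1))
  moreover have "(\<integral>x. (wide_gauss s (x :: real^'n) - wide_gauss s (x - z))\<^sup>2 \<partial>lborel) = 2 * sqrt (4 * pi * s) ^ CARD('n) * (1 - ?e)"
    unfolding e using i(1)
    by (subst Bochner_Integration.integral_diff, (intro Bochner_Integration.integrable_add integrable_mult_right i(1))+,
        subst Bochner_Integration.integral_add) (simp_all add: i(2)[of 0, simplified] i(2) algebra_simps i(1)[of 0, simplified])
  ultimately show ?thesis by (subst nn_integral_eq_integral) auto
qed

lemma borel_measurable_cis [measurable]: "cis \<in> borel_measurable borel"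
  by (intro borel_measurable_continuous_onI continuous_intros)

text \<open>A plane wave of energy k^2 under a Gaussian envelope of width of order sqrt s; for s
  tending to infinity this gives the Weyl sequence.\<close>

definition wave :: "real \<Rightarrow> real^'n \<Rightarrow> real \<Rightarrow> real^'n \<Rightarrow> complex" where
  "wave k b s x = cis (k * (x \<bullet> b)) * complex_of_real (wide_gauss s x)"

lemma wave_measurable [measurable]: "wave k b s \<in> borel_measurable borel"
  unfolding wave_def[abs_def] by measurable

lemma cmod_wave: "cmod (wave k b s x) = wide_gauss s x"
  by (simp add: wave_def norm_mult wide_gauss_def)

lemma L2_sq_wave:
  assumes s: "s > 0" shows "L2_sq (wave k b s :: real^'n \<Rightarrow> complex) = ennreal (sqrt (4 * pi * s) ^ CARD('n))"
  unfolding L2_sq_def cmod_wave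
  using wide_gauss_square_integral[OF s, of "0 :: real^'n"] by (subst nn_integral_eq_integral) auto

lemma wave_L2: "s > 0 \<Longrightarrow> (wave k b s :: real^'n \<Rightarrow> complex) \<in> L2"
  by (simp add: L2_iff L2_sq_wave)

context low_dim
begin

text \<open>A pure plane wave is reproduced by the free resolvent with the factor 1 / (\<kappa>^2 +
  k^2). The error therefore stems from the envelope alone: it averages the changes of the envelope
  under shifts by z with weight \<open>green\<close>.\<close>

lemma wave_approx_eigenfunction:
  assumes \<kappa>: "0 < \<kappa>" and b: "b \<in> Basis" and s: "s > 0"
  shows "L2_sq (\<lambda>x::real^'n. complex_of_real (1 / (\<kappa>\<^sup>2 + k\<^sup>2)) * wave k b s x - free_resolvent \<kappa> (wave k b s) x)
    \<le> ennreal (2 / \<kappa>\<^sup>2 * sqrt (4 * pi * s) ^ CARD('n) * (\<integral>z. green \<kappa> z * (1 - exp (- (norm (z::real^'n))\<^sup>2 / (16 * s))) \<partial>lborel))"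
proof -
  define F where "F x z = cis (k * ((x - z) \<bullet> b)) * complex_of_real (wide_gauss s x - wide_gauss s (x - z))" for x z :: "real^'n"
  have [measurable]: "(\<lambda>(x, z). F x z) \<in> borel_measurable (borel \<Otimes>\<^sub>M borel)" unfolding F_def by measurable
  have eq: "complex_of_real (1 / (\<kappa>\<^sup>2 + k\<^sup>2)) * wave k b s x - free_resolvent \<kappa> (wave k b s) x = (\<integral>z. cgreen \<kappa> z * F x z \<partial>lborel)" for x
  proof -
    have "free_resolvent \<kappa> (wave k b s) x = (\<integral>z. cgreen \<kappa> z * wave k b s (x - z) \<partial>lborel)"
      by (rule free_resolvent_eq_shifted) simp
    moreover have "complex_of_real (1 / (\<kappa>\<^sup>2 + k\<^sup>2)) * wave k b s x = (\<integral>z. (cgreen \<kappa> z * cis (- (k * (z \<bullet> b)))) * wave k b s x \<partial>lborel)"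
      by (simp only: integral_mult_left_zero integral_green_cis[OF \<kappa> b])
    moreover have i1: "integrable lborel (\<lambda>z. (cgreen \<kappa> z * cis (- (k * (z \<bullet> b)))) * wave k b s x)"
      by (rule integrable_mult_left, rule Bochner_Integration.integrable_bound[OF green_integrable[OF \<kappa>]]) (auto simp: norm_mult)
    moreover have i2: "integrable lborel (\<lambda>z. cgreen \<kappa> z * wave k b s (x - z))"
      by (rule Bochner_Integration.integrable_bound[OF green_integrable[OF \<kappa>]])
        (auto simp: norm_mult cmod_wave wide_gauss_def s less_imp_le intro!: mult_left_le)
    moreover have "cgreen \<kappa> z * F x z = (cgreen \<kappa> z * cis (- (k * (z \<bullet> b)))) * wave k b s x - cgreen \<kappa> z * wave k b s (x - z)" for z
    proof -
      have "cis (k * ((x - z) \<bullet> b)) = cis (- (k * (z \<bullet> b))) * cis (k * (x \<bullet> b))"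
        by (simp add: cis_mult inner_diff_left algebra_simps)
      moreover have "F x z = cis (k * ((x - z) \<bullet> b)) * complex_of_real (wide_gauss s x) - wave k b s (x - z)"
        by (simp add: F_def wave_def right_diff_distrib)
      ultimately show ?thesis by (simp add: wave_def right_diff_distrib mult.assoc)
    qed
    ultimately show ?thesis by simp
  qed
  have "L2_sq (\<lambda>x::real^'n. complex_of_real (1 / (\<kappa>\<^sup>2 + k\<^sup>2)) * wave k b s x - free_resolvent \<kappa> (wave k b s) x)
    \<le> ennreal (1 / \<kappa>\<^sup>2) * (\<integral>\<^sup>+z. ennreal (green \<kappa> z) * L2_sq (\<lambda>x. F x z) \<partial>lborel)"
    unfolding eq by (rule green_average_bound[OF \<kappa>]) measurable
  also have "(\<integral>\<^sup>+z. ennreal (green \<kappa> z) * L2_sq (\<lambda>x. F x z) \<partial>lborel)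
    = (\<integral>\<^sup>+z. ennreal (2 * sqrt (4 * pi * s) ^ CARD('n) * (green \<kappa> z * (1 - exp (- (norm (z::real^'n))\<^sup>2 / (16 * s))))) \<partial>lborel)"
  proof (rule nn_integral_cong)
    fix z :: "real^'n"
    have "L2_sq (\<lambda>x. F x z) = ennreal (2 * sqrt (4 * pi * s) ^ CARD('n) * (1 - exp (- (norm z)\<^sup>2 / (16 * s))))"
      unfolding L2_sq_def wide_gauss_shift_diff[OF s, symmetric]
      by (simp only: F_def norm_mult norm_cis norm_of_real mult_1 power2_abs)
    then show "ennreal (green \<kappa> z) * L2_sq (\<lambda>x. F x z) = ennreal (2 * sqrt (4 * pi * s) ^ CARD('n) * (green \<kappa> z * (1 - exp (- (norm (z::real^'n))\<^sup>2 / (16 * s)))))"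
      using s by (simp add: mult_ac flip: ennreal_mult')
  qed
  also have "\<dots> = ennreal (\<integral>z. 2 * sqrt (4 * pi * s) ^ CARD('n) * (green \<kappa> z * (1 - exp (- (norm (z::real^'n))\<^sup>2 / (16 * s)))) \<partial>lborel)"
  proof (rule nn_integral_eq_integral)
    show "integrable lborel (\<lambda>z. 2 * sqrt (4 * pi * s) ^ CARD('n) * (green \<kappa> z * (1 - exp (- (norm (z::real^'n))\<^sup>2 / (16 * s)))))"
      using s by (intro integrable_mult_right Bochner_Integration.integrable_bound[OF green_integrable[OF \<kappa>]])
        (auto simp: abs_mult intro!: mult_left_le AE_I2)
  qed (use s in \<open>auto intro!: AE_I2 mult_nonneg_nonneg\<close>)
  finally show ?thesis
    using \<kappa> by (simp add: mult.assoc flip: ennreal_mult')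
qed

text \<open>At a fixed distance z a wide envelope hardly changes, and \<open>green\<close> itself is
  an integrable majorant.\<close>

lemma green_defect_tendsto:
  assumes \<kappa>: "0 < \<kappa>"
  shows "(\<lambda>n::nat. (\<integral>z. green \<kappa> z * (1 - exp (- (norm (z::real^'n))\<^sup>2 / (16 * real (Suc n)))) \<partial>lborel)) \<longlonglongrightarrow> 0"
proof -
  have "(\<lambda>n::nat. (\<integral>z. green \<kappa> z * (1 - exp (- (norm (z::real^'n))\<^sup>2 / (16 * real (Suc n)))) \<partial>lborel)) \<longlonglongrightarrow> integral\<^sup>L (lborel :: (real^'n) measure) (\<lambda>_. 0)"
  proof (rule integral_dominated_convergence[where w="green \<kappa>"])
    show "integrable lborel (green \<kappa> :: real^'n \<Rightarrow> real)" by (rule green_integrable[OF \<kappa>])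
    show "AE z in lborel. (\<lambda>n. green \<kappa> z * (1 - exp (- (norm (z::real^'n))\<^sup>2 / (16 * real (Suc n))))) \<longlonglongrightarrow> 0"
    proof (rule AE_I2)
      fix z :: "real^'n"
      have "(\<lambda>n. green \<kappa> z * (1 - exp (- ((norm z)\<^sup>2 / 16) * inverse (real (Suc n))))) \<longlonglongrightarrow> green \<kappa> z * (1 - exp (- ((norm z)\<^sup>2 / 16) * 0))"
        by (intro tendsto_intros LIMSEQ_inverse_real_of_nat)
      moreover have "- ((norm z)\<^sup>2 / 16) * inverse r = - (norm z)\<^sup>2 / (16 * r)" for r
        by (cases "r = 0") (simp_all add: field_simps)
      ultimately show "(\<lambda>n. green \<kappa> z * (1 - exp (- (norm z)\<^sup>2 / (16 * real (Suc n))))) \<longlonglongrightarrow> 0"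
        by (simp only: mult_zero_right exp_zero diff_self)
    qed
    show "AE z in lborel. norm (green \<kappa> z * (1 - exp (- (norm (z::real^'n))\<^sup>2 / (16 * real (Suc n))))) \<le> green \<kappa> z" for n
      by (auto simp: abs_mult intro!: mult_left_le AE_I2)
  qed measurable
  then show ?thesis by simp
qed

text \<open>In contrast to the L2 bound, this one does not grow with the width of a wave; it keeps
  the charges that a wave induces on Y bounded.\<close>

lemma free_resolvent_sup_bound:
  assumes \<kappa>: "0 < \<kappa>" and f: "f \<in> L2" and le: "\<And>x. cmod (f x) \<le> 1"
  shows "cmod (free_resolvent \<kappa> f (x :: real^'n)) \<le> 1 / \<kappa>\<^sup>2"
proof -
  have m: "f \<in> borel_measurable borel" using f by (simp add: L2_iff)
  have i: "integrable lborel (\<lambda>z. green \<kappa> (z :: real^'n))" by (rule green_integrable[OF \<kappa>])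
  have "cmod (free_resolvent \<kappa> f x) = cmod (\<integral>z. cgreen \<kappa> z * f (x - z) \<partial>lborel)"
    by (simp add: free_resolvent_eq_shifted[OF m])
  also have "\<dots> \<le> (\<integral>z. green \<kappa> (z :: real^'n) \<partial>lborel)"
    by (rule Bochner_Integration.integral_norm_bound_integral)
      (use m i le in \<open>auto simp: norm_mult intro!: AE_I2 mult_left_le Bochner_Integration.integrable_bound[OF i]\<close>)
  finally show ?thesis by (simp add: integral_green[OF \<kappa>])
qed

end

section \<open>The discrete spectrum and the critical coupling\<close>

lemma L2_norm_AE_cong:
  assumes "AE x in lborel. f x = g x" "f \<in> L2" "g \<in> L2"
  shows "L2_norm f = L2_norm g"
  unfolding L2_norm_def
  by (rule arg_cong[where f=sqrt], rule integral_cong_AE) (use assms in \<open>auto simp: L2_def\<close>)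

lemma L2_sq_mono:
  "(\<And>x. cmod (f x) \<le> cmod (g x)) \<Longrightarrow> L2_sq f \<le> L2_sq g"
  unfolding L2_sq_def by (intro nn_integral_mono ennreal_leI power_mono) auto

context low_dim
begin

text \<open>Krein's resolvent is applied to a wave g of energy m. The point sources contribute an L2
  error bounded uniformly in the width, and the free part an error small relative to the squared
  norm \<open>A s\<close> of g. If m were in the resolvent set, \<open>A s\<close> would be at most
  a small multiple of itself plus a constant, although it tends to infinity.\<close>

lemma positive_in_spectrum:
  assumes y: "inj (y :: 'N::finite \<Rightarrow> real^'n)" and m: "m > 0"
  shows "m \<in> spectrum (point_hamiltonian \<alpha> y)"
proof (rule ccontr)
  assume "m \<notin> spectrum (point_hamiltonian \<alpha> y)"
  then obtain K where K: "\<And>f. f \<in> L2 \<Longrightarrow> \<exists>\<psi>. (\<psi>, \<lambda>x. f x + complex_of_real m * \<psi> x) \<in> point_hamiltonian \<alpha> y \<and> L2_norm \<psi> \<le> K * L2_norm f \<and>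
        (\<forall>\<psi>'. (\<psi>', \<lambda>x. f x + complex_of_real m * \<psi>' x) \<in> point_hamiltonian \<alpha> y \<longrightarrow> (AE x in lborel. \<psi>' x = \<psi> x))"
    unfolding spectrum_def resolvent_set_def by blast
  obtain \<kappa> where \<kappa>: "\<kappa> > 0" and det: "det (Gamma_matrix \<alpha> y \<kappa>) \<noteq> 0"
    using det_Gamma_nonzero_large[OF y] by blast
  define k where "k = sqrt m"
  define \<mu> where "\<mu> = \<kappa>\<^sup>2 + k\<^sup>2"
  have \<mu>: "\<mu> > 0" "\<mu> = \<kappa>\<^sup>2 + m" using \<kappa> m by (auto simp: \<mu>_def k_def add_pos_pos)
  obtain b :: "real^'n" where b: "b \<in> Basis" using nonempty_Basis by blast
  define B where "B = matrix_inv (Gamma_matrix \<alpha> y \<kappa>)"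
  \<comment> \<open>Bounds for the charges that do not depend on the width s, since |g| <=
    1.\<close>
  define \<beta> where "\<beta> j = (\<Sum>i\<in>UNIV. \<bar>B $ j $ i\<bar>) / \<kappa>\<^sup>2" for j
  define H where "H = point_source \<kappa> y (\<lambda>j. complex_of_real (\<beta> j))"
  define C where "C = enn2real (L2_sq H)"
  have HC: "L2_sq H = ennreal C" "C \<ge> 0"
    using point_source_L2[OF \<kappa>, of y] by (auto simp: C_def H_def L2_iff)
  define A where "A s = sqrt (4 * pi * s) ^ CARD('n)" for s
  define E where "E s = (\<integral>z. green \<kappa> z * (1 - exp (- (norm (z::real^'n))\<^sup>2 / (16 * s))) \<partial>lborel)" for s
  have E0: "E s \<ge> 0" if "s > 0" for s
    unfolding E_def by (intro Bochner_Integration.integral_nonneg mult_nonneg_nonneg) (use that in auto)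
  define D where "D = 2 + 2 * \<mu>\<^sup>2 * K\<^sup>2"
  have D: "D \<ge> 0" by (simp add: D_def)
  have main: "A s \<le> D * (\<mu>\<^sup>2 * (4 / \<kappa>\<^sup>2 * A s * E s + 2 * C))" if s: "s > 0" for s
  proof -
    have A0: "A s \<ge> 0" using s by (simp add: A_def)
    define g where "g = (wave k b s :: real^'n \<Rightarrow> complex)"
    define \<psi> where "\<psi> = krein_resolvent \<alpha> y \<kappa> g"
    \<comment> \<open>This is (H - m) \<psi>, because H \<psi> = g - \<kappa>^2 \<psi> and \<mu> =
      \<kappa>^2 + m. It is small relative to g, as \<psi> is close to g / \<mu>.\<close>
    define f where "f = (\<lambda>x. g x - complex_of_real \<mu> * \<psi> x)"
    have gL2: "g \<in> L2" using wave_L2[OF s] by (simp add: g_def)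
    have mem: "(\<psi>, \<lambda>x. g x - complex_of_real (\<kappa>\<^sup>2) * \<psi> x) \<in> point_hamiltonian \<alpha> y"
      unfolding \<psi>_def by (rule krein_resolvent_in_hamiltonian[OF y \<kappa> det gL2])
    have \<psi>L2: "\<psi> \<in> L2" using mem by (simp add: point_hamiltonian_def)
    have fL2: "f \<in> L2" unfolding f_def by (intro L2_diff L2_cmult gL2 \<psi>L2)
    have mem': "(\<psi>, \<lambda>x. f x + complex_of_real m * \<psi> x) \<in> point_hamiltonian \<alpha> y"
      using mem by (simp add: f_def \<mu>(2) algebra_simps)
    have [measurable]: "f \<in> borel_measurable borel" "\<psi> \<in> borel_measurable borel" "g \<in> borel_measurable borel"
      using fL2 \<psi>L2 gL2 by (auto simp: L2_iff)
    have \<psi>f: "L2_sq \<psi> \<le> ennreal (K\<^sup>2) * L2_sq f"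
    proof -
      obtain \<psi>0 where \<psi>0: "(\<psi>0, \<lambda>x. f x + complex_of_real m * \<psi>0 x) \<in> point_hamiltonian \<alpha> y" "L2_norm \<psi>0 \<le> K * L2_norm f"
        "\<And>\<psi>'. (\<psi>', \<lambda>x. f x + complex_of_real m * \<psi>' x) \<in> point_hamiltonian \<alpha> y \<Longrightarrow> (AE x in lborel. \<psi>' x = \<psi>0 x)"
        using K[OF fL2] by blast
      have "\<psi>0 \<in> L2" using \<psi>0(1) by (simp add: point_hamiltonian_def)
      then have "L2_norm \<psi> \<le> K * L2_norm f"
        using L2_norm_AE_cong[OF \<psi>0(3)[OF mem'] \<psi>L2] \<psi>0(2) by simp
      then have "(L2_norm \<psi>)\<^sup>2 \<le> K\<^sup>2 * (L2_norm f)\<^sup>2"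
        unfolding power_mult_distrib[symmetric] by (intro power_mono L2_norm_nonneg)
      then have "ennreal ((L2_norm \<psi>)\<^sup>2) \<le> ennreal (K\<^sup>2) * ennreal ((L2_norm f)\<^sup>2)"
        by (subst ennreal_mult[symmetric]) (simp_all only: ennreal_leI zero_le_power2)
      then show ?thesis by (simp only: L2_norm_sq \<psi>L2 fL2)
    qed
    obtain a where a: "\<And>i. (\<Sum>j\<in>UNIV. complex_of_real (Gamma_matrix \<alpha> y \<kappa> $ i $ j) * a j) = free_resolvent \<kappa> g (y i)"
      and aB: "\<And>j. a j = (\<Sum>i\<in>UNIV. complex_of_real (B $ j $ i) * free_resolvent \<kappa> g (y i))"
      using krein_coefficients[OF det, of "\<lambda>i. free_resolvent \<kappa> g (y i)"] unfolding B_def by blast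
    have \<psi>eq: "\<psi> x = free_resolvent \<kappa> g x + point_source \<kappa> y a x" for x
      unfolding \<psi>_def by (rule krein_resolvent_eq[OF det a])
    have g1: "cmod (g x) \<le> 1" for x using s by (simp add: g_def cmod_wave wide_gauss_def)
    have a\<beta>: "cmod (a j) \<le> \<beta> j" for j
    proof -
      have "cmod (a j) \<le> (\<Sum>i\<in>UNIV. \<bar>B $ j $ i\<bar> * (1 / \<kappa>\<^sup>2))"
        unfolding aB using free_resolvent_sup_bound[OF \<kappa> gL2 g1]
        by (intro sum_norm_le) (auto simp: norm_mult simp del: times_divide_eq_right intro!: mult_left_mono)
      then show ?thesis by (simp add: \<beta>_def sum_divide_distrib)
    qed
    have corr: "L2_sq (point_source \<kappa> y a) \<le> ennreal C"
      unfolding HC(1)[symmetric]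
    proof (rule L2_sq_mono)
      fix x
      have "cmod (point_source \<kappa> y a x) \<le> (\<Sum>j\<in>UNIV. \<beta> j * green \<kappa> (x - y j))"
        unfolding point_source_def using a\<beta> by (intro sum_norm_le) (auto simp: norm_mult intro!: mult_right_mono)
      also have "\<dots> \<le> cmod (H x)"
      proof -
        have "H x = complex_of_real (\<Sum>j\<in>UNIV. \<beta> j * green \<kappa> (x - y j))" by (simp add: H_def point_source_def)
        then show ?thesis by (simp only: norm_of_real abs_ge_self)
      qed
      finally show "cmod (point_source \<kappa> y a x) \<le> cmod (H x)" .
    qed
    have psm: "point_source \<kappa> y a \<in> borel_measurable borel"
      using point_source_L2[OF \<kappa>, of y a] by (simp add: L2_iff)
    define r where "r = (\<lambda>x. complex_of_real (1 / \<mu>) * g x - free_resolvent \<kappa> g x)"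
    have r: "L2_sq r \<le> ennreal (2 / \<kappa>\<^sup>2 * A s * E s)"
      using wave_approx_eigenfunction[OF \<kappa> b s, of k] unfolding r_def g_def \<mu>_def A_def E_def .
    have [measurable]: "r \<in> borel_measurable borel" unfolding r_def by measurable
    have "f = (\<lambda>x. complex_of_real \<mu> * r x + complex_of_real (- \<mu>) * point_source \<kappa> y a x)"
      using \<mu>(1) by (auto simp: f_def r_def \<psi>eq algebra_simps)
    then have "L2_sq f \<le> 2 * L2_sq (\<lambda>x. complex_of_real \<mu> * r x) + 2 * L2_sq (\<lambda>x. complex_of_real (- \<mu>) * point_source \<kappa> y a x)"
      using psm by (simp only:) (intro L2_sq_add_le, measurable)
    also have "\<dots> = 2 * (ennreal (\<mu>\<^sup>2) * L2_sq r) + 2 * (ennreal (\<mu>\<^sup>2) * L2_sq (point_source \<kappa> y a))"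
      using psm by (simp add: L2_sq_cmult del: of_real_minus)
    also have "\<dots> \<le> 2 * (ennreal (\<mu>\<^sup>2) * ennreal (2 / \<kappa>\<^sup>2 * A s * E s)) + 2 * (ennreal (\<mu>\<^sup>2) * ennreal C)"
      using r corr by (intro add_mono mult_left_mono) auto
    also have "\<dots> = ennreal (\<mu>\<^sup>2 * (4 / \<kappa>\<^sup>2 * A s * E s + 2 * C))"
    proof -
      have "2 * ennreal u = ennreal (2 * u)" if "u \<ge> 0" for u using that by (simp add: ennreal_mult)
      moreover have "0 \<le> 2 / \<kappa>\<^sup>2 * A s * E s" using A0 E0[OF s] by simp
      ultimately have "2 * (ennreal (\<mu>\<^sup>2) * ennreal (2 / \<kappa>\<^sup>2 * A s * E s)) + 2 * (ennreal (\<mu>\<^sup>2) * ennreal C)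
         = ennreal (2 * (\<mu>\<^sup>2 * (2 / \<kappa>\<^sup>2 * A s * E s)) + 2 * (\<mu>\<^sup>2 * C))"
        using HC(2) by (simp only: ennreal_mult[symmetric] ennreal_plus[symmetric] zero_le_power2 mult_nonneg_nonneg zero_le_numeral)
      also have "2 * (\<mu>\<^sup>2 * (2 / \<kappa>\<^sup>2 * A s * E s)) + 2 * (\<mu>\<^sup>2 * C) = \<mu>\<^sup>2 * (4 / \<kappa>\<^sup>2 * A s * E s + 2 * C)"
        by (simp add: algebra_simps)
      finally show ?thesis .
    qed
    finally have f\<Phi>: "L2_sq f \<le> ennreal (\<mu>\<^sup>2 * (4 / \<kappa>\<^sup>2 * A s * E s + 2 * C))" (is "_ \<le> ennreal ?\<Phi>") .
    have \<Phi>: "0 \<le> ?\<Phi>" using A0 E0[OF s] HC(2) by simp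
    have geq: "g = (\<lambda>x. f x + complex_of_real \<mu> * \<psi> x)" by (simp add: f_def)
    have "ennreal (A s) = L2_sq g" unfolding g_def L2_sq_wave[OF s] A_def ..
    also have "\<dots> \<le> 2 * L2_sq f + 2 * L2_sq (\<lambda>x. complex_of_real \<mu> * \<psi> x)"
      by (subst geq, rule L2_sq_add_le) measurable
    also have "\<dots> = 2 * L2_sq f + 2 * (ennreal (\<mu>\<^sup>2) * L2_sq \<psi>)"
      by (simp add: L2_sq_cmult)
    also have "\<dots> \<le> 2 * L2_sq f + 2 * (ennreal (\<mu>\<^sup>2) * (ennreal (K\<^sup>2) * L2_sq f))"
      using \<psi>f by (intro add_mono mult_left_mono) auto
    also have "\<dots> = ennreal D * L2_sq f"
    proof -
      have "ennreal D = 2 + 2 * (ennreal (\<mu>\<^sup>2) * ennreal (K\<^sup>2))"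
        unfolding D_def by (subst ennreal_plus) (simp_all add: ennreal_mult mult.assoc)
      then show ?thesis by (simp add: distrib_right mult.assoc)
    qed
    also have "\<dots> \<le> ennreal D * ennreal ?\<Phi>" using f\<Phi> by (intro mult_left_mono) auto
    also have "\<dots> = ennreal (D * ?\<Phi>)" using D \<Phi> by (simp add: ennreal_mult)
    finally show ?thesis using D \<Phi> by (subst (asm) ennreal_le_iff) (auto intro: mult_nonneg_nonneg)
  qed
  define c1 where "c1 = D * \<mu>\<^sup>2 * (4 / \<kappa>\<^sup>2)"
  define c2 where "c2 = D * \<mu>\<^sup>2 * (2 * C)"
  have main': "A s * (1 - c1 * E s) \<le> c2" if "s > 0" for s
    using main[OF that] by (simp add: c1_def c2_def algebra_simps)
  have c2: "c2 \<ge> 0" using D HC(2) by (simp add: c2_def)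
  have "(\<lambda>n. c1 * E (real (Suc n))) \<longlonglongrightarrow> c1 * 0"
    unfolding E_def by (intro tendsto_mult tendsto_const green_defect_tendsto[OF \<kappa>])
  then have "\<forall>\<^sub>F n in sequentially. c1 * E (real (Suc n)) < 1 / 2"
    by (rule order_tendstoD) simp
  \<comment> \<open>Chosen to give A >= 2 * c2 + 1, which contradicts the estimate A / 2 <= c2
    reached below.\<close>
  moreover obtain n0 :: nat where n0: "(2 * c2 + 1)\<^sup>2 \<le> real n0" using real_arch_simple by blast
  ultimately have "\<forall>\<^sub>F n in sequentially. c1 * E (real (Suc n)) < 1 / 2 \<and> n0 \<le> n"
    by (intro eventually_conj eventually_ge_at_top)
  then obtain n where n: "c1 * E (real (Suc n)) < 1 / 2" "n0 \<le> n"
    by (metis (mono_tags, lifting) eventually_sequentially order_refl)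
  have "2 * c2 + 1 \<le> sqrt (4 * pi * real (Suc n))"
  proof (rule real_le_rsqrt)
    have p: "1 * real (Suc n) \<le> (4 * pi) * real (Suc n)" using pi_ge_two by (intro mult_right_mono) auto
    have "real n0 \<le> 1 * real (Suc n)" using n(2) by simp
    from order_trans[OF order_trans[OF n0 this] p] show "(2 * c2 + 1)\<^sup>2 \<le> 4 * pi * real (Suc n)" .
  qed
  also have "\<dots> \<le> A (real (Suc n))"
  proof -
    have "1 \<le> sqrt (4 * pi * real (Suc n))" using calculation c2 by linarith
    then show ?thesis unfolding A_def by (intro self_le_power) auto
  qed
  finally have AA: "2 * c2 + 1 \<le> A (real (Suc n))" .
  have "A (real (Suc n)) * (1 / 2) \<le> A (real (Suc n)) * (1 - c1 * E (real (Suc n)))"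
    using n(1) AA c2 by (intro mult_left_mono) auto
  also have "\<dots> \<le> c2" by (rule main') simp
  finally show False using AA by simp
qed

text \<open>Points of the discrete spectrum are isolated in the spectrum, so this confines the
  discrete spectrum to negative energies.\<close>

lemma nonneg_islimpt_spectrum:
  assumes y: "inj (y :: 'N::finite \<Rightarrow> real^'n)" and l: "l \<ge> 0"
  shows "l islimpt spectrum (point_hamiltonian \<alpha> y)"
proof -
  have "l islimpt {l<..<l + 1}" by (rule islimpt_greaterThanLessThan1) simp
  then show ?thesis
    by (rule islimpt_subset) (use positive_in_spectrum[OF y] l in auto)
qed

text \<open>In dimension three the entries of \<Gamma> extend to entire functions of \<kappa>. The
  determinant is not identically zero, because \<Gamma> is regular for large \<kappa>.\<close>

lemma det_Gamma_zeros_isolated: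
  assumes d3: "CARD('n) = 3" and y: "inj (y :: 'N::finite \<Rightarrow> real^'n)" and k: "det (Gamma_matrix \<alpha> y \<kappa>) = 0"
  obtains r where "r > 0" "\<And>s. s \<noteq> \<kappa> \<Longrightarrow> \<bar>s - \<kappa>\<bar> < r \<Longrightarrow> det (Gamma_matrix \<alpha> y s) \<noteq> 0"
proof -
  define M :: "complex \<Rightarrow> complex^'N^'N" where
    "M z = (\<chi> i j. if i = j then of_real \<alpha> + z / of_real (4 * pi) else - exp (- z * of_real (norm (y i - y j))) / of_real (4 * pi * norm (y i - y j)))" for z
  have Mr: "M (of_real s) $ i $ j = of_real (Gamma_matrix \<alpha> y s $ i $ j)" for s i j
    by (simp add: M_def Gamma_matrix_def green_def xi_def d3 exp_of_real[symmetric])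
  have det: "det (M (of_real s)) = of_real (det (Gamma_matrix \<alpha> y s))" for s
    unfolding det_def Mr by simp
  have hol: "(\<lambda>z. det (M z)) holomorphic_on UNIV"
  proof -
    have "(\<lambda>z. M z $ i $ j) holomorphic_on UNIV" for i j
      using y by (cases "i = j") (auto simp: M_def inj_eq intro!: holomorphic_intros)
    then show ?thesis unfolding det_def by (intro holomorphic_intros)
  qed
  obtain K where K: "det (Gamma_matrix \<alpha> y K) \<noteq> 0" using det_Gamma_nonzero_large[OF y] by blast
  obtain r where r: "r > 0" "\<And>z. z \<in> ball (of_real \<kappa>) r - {of_real \<kappa>} \<Longrightarrow> det (M z) \<noteq> 0"
    using isolated_zeros[OF hol, of "of_real \<kappa>" "of_real K"] k K unfolding det by auto
  have "det (Gamma_matrix \<alpha> y s) \<noteq> 0" if "s \<noteq> \<kappa>" "\<bar>s - \<kappa>\<bar> < r" for s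
    using r(2)[of "of_real s"] that unfolding det
    by (auto simp: dist_norm norm_minus_commute simp flip: of_real_diff)
  then show ?thesis using that r(1) by blast
qed

lemma discrete_spectrum_nonempty_iff:
  assumes d3: "CARD('n) = 3" and y: "inj (y :: 'N::finite \<Rightarrow> real^'n)"
  shows "discrete_spectrum (point_hamiltonian \<alpha> y) \<noteq> {} \<longleftrightarrow> nonpos_set \<alpha> y \<noteq> {}"
proof
  assume "discrete_spectrum (point_hamiltonian \<alpha> y) \<noteq> {}"
  then obtain l where l: "\<not> l islimpt spectrum (point_hamiltonian \<alpha> y)" "eigenvalue (point_hamiltonian \<alpha> y) l"
    by (auto simp: discrete_spectrum_def)
  have "l < 0" using nonneg_islimpt_spectrum[OF y] l(1) by (meson not_le)
  then have p: "0 < sqrt (- l)" "l = - (sqrt (- l))\<^sup>2" by auto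
  then have "det (Gamma_matrix \<alpha> y (sqrt (- l))) = 0" using eigenvalue_iff_det[OF y p(1), of \<alpha>] l(2) by simp
  then show "nonpos_set \<alpha> y \<noteq> {}" using det_Gamma_0_imp_nonpos_set[OF p(1)] by blast
next
  assume "nonpos_set \<alpha> y \<noteq> {}"
  then obtain \<kappa> where \<kappa>: "\<kappa> \<in> nonpos_set \<alpha> y" "\<And>\<kappa>'. \<kappa>' \<in> nonpos_set \<alpha> y \<Longrightarrow> \<kappa>' \<le> \<kappa>"
    using nonpos_set_has_max[OF y] by blast
  have kp: "\<kappa> > 0" using \<kappa>(1) by (simp add: nonpos_set_def)
  have det: "det (Gamma_matrix \<alpha> y \<kappa>) = 0" by (rule det_Gamma_max_nonpos_set[OF y \<kappa>])
  have ev: "eigenvalue (point_hamiltonian \<alpha> y) (- \<kappa>\<^sup>2)" using eigenvalue_iff_det[OF y kp] det by blast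
  have "\<not> - \<kappa>\<^sup>2 islimpt spectrum (point_hamiltonian \<alpha> y)"
  proof -
    obtain r where r: "r > 0" "\<And>s. s \<noteq> \<kappa> \<Longrightarrow> \<bar>s - \<kappa>\<bar> < r \<Longrightarrow> det (Gamma_matrix \<alpha> y s) \<noteq> 0"
      using det_Gamma_zeros_isolated[OF d3 y det] by blast
    \<comment> \<open>Energies l near - \<kappa>^2 correspond to parameters sqrt (- l) near
      \<kappa>. There, \<kappa> itself excepted, \<Gamma> is regular, so these l belong to the
      resolvent set.\<close>
    have "((\<lambda>l. sqrt (- l)) \<longlongrightarrow> sqrt (- (- \<kappa>\<^sup>2))) (at (- \<kappa>\<^sup>2))" by (intro tendsto_intros)
    then have "\<forall>\<^sub>F l in at (- \<kappa>\<^sup>2). dist (sqrt (- l)) \<kappa> < r"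
      using kp r(1) by (auto dest: tendstoD)
    moreover have "\<forall>\<^sub>F l in at (- \<kappa>\<^sup>2). l < 0"
      using kp by (intro order_tendstoD(2)[OF tendsto_ident_at]) simp
    moreover have "\<forall>\<^sub>F l in at (- \<kappa>\<^sup>2). l \<noteq> - \<kappa>\<^sup>2" by (simp add: eventually_at_filter)
    ultimately have "\<forall>\<^sub>F l in at (- \<kappa>\<^sup>2). l \<notin> spectrum (point_hamiltonian \<alpha> y)"
    proof eventually_elim
      case (elim l)
      have p: "0 < sqrt (- l)" "l = - (sqrt (- l))\<^sup>2" using elim(2) by auto
      have "sqrt (- l) \<noteq> \<kappa>" using p(2) elim(3) by auto
      then have "det (Gamma_matrix \<alpha> y (sqrt (- l))) \<noteq> 0" using r(2) elim(1) by (simp add: dist_real_def)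
      then have "l \<in> resolvent_set (point_hamiltonian \<alpha> y)"
        using det_nonzero_imp_resolvent_set[OF y p(1), of \<alpha>] p(2) by simp
      then show ?case by (simp add: spectrum_def)
    qed
    then show ?thesis by (simp add: islimpt_iff_eventually)
  qed
  then have "- \<kappa>\<^sup>2 \<in> discrete_spectrum (point_hamiltonian \<alpha> y)"
    using ev eigenvalue_in_spectrum[OF ev zero_in_hamiltonian] finite_multiplicity_negative[OF y kp]
    by (simp add: discrete_spectrum_def)
  then show "discrete_spectrum (point_hamiltonian \<alpha> y) \<noteq> {}" by blast
qed

section \<open>Dependence on the coupling and the critical value in dimension three\<close>

lemma nonpos_set_antimono: "\<alpha>' \<le> \<alpha> \<Longrightarrow> nonpos_set \<alpha> (y :: 'N::finite \<Rightarrow> real^'n) \<subseteq> nonpos_set \<alpha>' y"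
proof
  fix \<kappa> assume le: "\<alpha>' \<le> \<alpha>" and "\<kappa> \<in> nonpos_set \<alpha> y"
  then obtain c where c: "0 < \<kappa>" "c \<noteq> 0" "Gamma_form \<alpha> y \<kappa> c \<le> 0" by (auto simp: nonpos_set_def)
  have "\<alpha>' * (norm c)\<^sup>2 \<le> \<alpha> * (norm c)\<^sup>2" using le by (intro mult_right_mono) auto
  then have "Gamma_form \<alpha>' y \<kappa> c \<le> 0" using c(3) by (simp add: Gamma_form_eq algebra_simps)
  then show "\<kappa> \<in> nonpos_set \<alpha>' y" using c by (auto simp: nonpos_set_def)
qed

text \<open>In dimension three - \<open>xi\<close> is positive and the Green function is at most 1 /
  (4 pi r), whatever \<kappa>; a coupling above this sum makes the form positive for every \<kappa>
  > 0.\<close>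

lemma nonpos_set_alpha_bounded:
  assumes d3: "CARD('n) = 3" and ne: "nonpos_set \<alpha> (y :: 'N::finite \<Rightarrow> real^'n) \<noteq> {}"
  shows "\<alpha> \<le> (\<Sum>i\<in>UNIV. \<Sum>j\<in>UNIV - {i}. 1 / (4 * pi * norm (y i - y j)))" (is "_ \<le> ?M")
proof (rule ccontr)
  assume "\<not> \<alpha> \<le> ?M"
  then have gt: "?M < \<alpha>" by simp
  obtain \<kappa> c where c: "0 < \<kappa>" "c \<noteq> 0" "Gamma_form \<alpha> y \<kappa> c \<le> 0" using ne by (auto simp: nonpos_set_def)
  have "pair_sum y \<kappa> c \<le> (\<Sum>i\<in>UNIV. \<Sum>j\<in>UNIV - {i}. 1 / (4 * pi * norm (y i - y j)) * (norm c)\<^sup>2)"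
    unfolding pair_sum_def
  proof (intro sum_mono)
    fix i j :: 'N
    have "green \<kappa> (y i - y j) \<le> 1 / (4 * pi * norm (y i - y j))"
      using c(1) by (simp add: green_def d3 divide_right_mono)
    moreover have "c $ i * c $ j \<le> (norm c)\<^sup>2" using abs_vec_mult_le[of c i j] by simp
    ultimately have "green \<kappa> (y i - y j) * (c $ i * c $ j) \<le> green \<kappa> (y i - y j) * (norm c)\<^sup>2"
      "green \<kappa> (y i - y j) * (norm c)\<^sup>2 \<le> 1 / (4 * pi * norm (y i - y j)) * (norm c)\<^sup>2"
      by (auto intro!: mult_left_mono mult_right_mono simp del: times_divide_eq_left)
    then show "green \<kappa> (y i - y j) * (c $ i * c $ j) \<le> 1 / (4 * pi * norm (y i - y j)) * (norm c)\<^sup>2" by linarith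
  qed
  also have "\<dots> = ?M * (norm c)\<^sup>2" by (simp add: sum_distrib_right)
  finally have "pair_sum y \<kappa> c \<le> ?M * (norm c)\<^sup>2" .
  moreover have "?M * (norm c)\<^sup>2 < (\<alpha> - xi TYPE('n) \<kappa>) * (norm c)\<^sup>2"
    using gt c d3 by (intro mult_strict_right_mono) (auto simp: xi_def intro: less_le_trans)
  ultimately show False using c(3) by (simp add: Gamma_form_eq)
qed

text \<open>Halving \<kappa> lowers - \<open>xi\<close> by \<kappa> / (8 pi), which is the room for
  raising \<alpha>, and does not decrease the Green function. Openness is what makes the bound by
  the critical value strict.\<close>

lemma nonpos_set_alpha_open:
  assumes d3: "CARD('n) = 3" and y: "inj (y :: 'N::finite \<Rightarrow> real^'n)" and ne: "nonpos_set \<alpha> y \<noteq> {}"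
  shows "\<exists>\<alpha>'>\<alpha>. nonpos_set \<alpha>' y \<noteq> {}"
proof -
  obtain \<kappa> c where c: "0 < \<kappa>" "c \<noteq> 0" "Gamma_form \<alpha> y \<kappa> c \<le> 0" using ne by (auto simp: nonpos_set_def)
  \<comment> \<open>Absolute values keep the norm and do not raise the form; with nonnegative
    entries the off-diagonal sum is monotone in the Green function.\<close>
  define v :: "real^'N" where "v = (\<chi> i. \<bar>c $ i\<bar>)"
  have nv: "norm v = norm c" by (simp add: v_def norm_vec_def L2_set_def)
  have "v \<noteq> 0" using nv c(2) by auto
  have p1: "pair_sum y \<kappa> c \<le> pair_sum y \<kappa> v"
    unfolding pair_sum_def v_def
    by (intro sum_mono mult_left_mono) (auto simp flip: abs_mult)
  have p2: "pair_sum y \<kappa> v \<le> pair_sum y (\<kappa> / 2) v"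
    unfolding pair_sum_def
  proof (intro sum_mono mult_right_mono)
    fix i j :: 'N assume "j \<in> UNIV - {i}"
    then show "green \<kappa> (y i - y j) \<le> green (\<kappa> / 2) (y i - y j)"
      using c(1) y by (intro green_antimono_spectral) (auto simp: inj_eq)
  qed (simp add: v_def)
  define \<alpha>' where "\<alpha>' = \<alpha> + \<kappa> / (8 * pi)"
  have "\<alpha>' - xi TYPE('n) (\<kappa> / 2) = \<alpha> - xi TYPE('n) \<kappa>" using d3 by (simp add: \<alpha>'_def xi_def field_simps)
  then have "Gamma_form \<alpha>' y (\<kappa> / 2) v \<le> 0" using p1 p2 c(3) by (simp add: Gamma_form_eq nv)
  then have "\<kappa> / 2 \<in> nonpos_set \<alpha>' y" using c(1) \<open>v \<noteq> 0\<close> by (auto simp: nonpos_set_def)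
  then show ?thesis using c(1) by (intro exI[of _ \<alpha>']) (auto simp: \<alpha>'_def)
qed

text \<open>The couplings with nonempty discrete spectrum form a nonempty, downward closed, open set
  that is bounded above, hence an open half-line; this gives the definite description in
  \<open>alpha_crit_of\<close> its meaning.\<close>

lemma alpha_crit_of_iff:
  assumes d3: "CARD('n) = 3" and y: "inj (y :: 'N::finite \<Rightarrow> real^'n)"
  shows "nonpos_set \<alpha> y \<noteq> {} \<longleftrightarrow> \<alpha> < alpha_crit_of y"
proof -
  define S where "S = {\<alpha>. nonpos_set \<alpha> y \<noteq> {}}"
  have bdd: "bdd_above S" unfolding S_def using nonpos_set_alpha_bounded[OF d3] by (intro bdd_aboveI) blast
  have "0 \<le> pair_sum y 1 1" unfolding pair_sum_def by (intro sum_nonneg) simp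
  then have "Gamma_form (xi TYPE('n) 1) y 1 1 \<le> 0" by (simp add: Gamma_form_eq)
  moreover have "(1::real^'N) \<noteq> 0" by (simp add: vec_eq_iff)
  ultimately have "1 \<in> nonpos_set (xi TYPE('n) 1) y"
    unfolding nonpos_set_def by (intro CollectI conjI exI[of _ 1]) simp_all
  then have ne: "S \<noteq> {}" unfolding S_def by blast
  have iff: "nonpos_set \<alpha> y \<noteq> {} \<longleftrightarrow> \<alpha> < Sup S" for \<alpha>
  proof
    assume "nonpos_set \<alpha> y \<noteq> {}"
    then obtain \<alpha>' where "\<alpha> < \<alpha>'" "\<alpha>' \<in> S" using nonpos_set_alpha_open[OF d3 y] by (auto simp: S_def)
    then show "\<alpha> < Sup S" using bdd by (meson cSup_upper less_le_trans)
  next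
    assume "\<alpha> < Sup S"
    then obtain \<alpha>' where "\<alpha>' \<in> S" "\<alpha> < \<alpha>'" using ne bdd by (auto simp: less_cSup_iff)
    then show "nonpos_set \<alpha> y \<noteq> {}" using nonpos_set_antimono[of \<alpha> \<alpha>' y] by (auto simp: S_def)
  qed
  have "alpha_crit_of y = Sup S"
    unfolding alpha_crit_of_def discrete_spectrum_nonempty_iff[OF d3 y] iff
  proof (rule the_equality)
    fix c assume "\<forall>\<alpha>. (\<alpha> < Sup S) = (\<alpha> < c)"
    then show "c = Sup S" by (metis less_irrefl linorder_less_linear)
  qed simp
  then show ?thesis using iff by simp
qed

lemma nonpos_set_nonempty_below_alpha_crit:
  assumes y: "inj (y :: 'N::finite \<Rightarrow> real^'n)" and "range y \<subseteq> C" and lt: "ereal \<alpha> < alpha_crit TYPE('N) C"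
  shows "nonpos_set \<alpha> y \<noteq> {}"
proof (cases "CARD('n) = 2")
  case True
  then show ?thesis by (rule nonpos_set_nonempty_2d)
next
  case False
  then have d3: "CARD('n) = 3" using card_dim by simp
  have "alpha_crit TYPE('N) C \<le> ereal (alpha_crit_of y)"
    using False assms unfolding alpha_crit_def by (auto intro!: INF_lower simp: configurations_def)
  then have "\<alpha> < alpha_crit_of y" using lt by (metis less_ereal.simps(1) less_le_trans)
  then show ?thesis using alpha_crit_of_iff[OF d3 y] by blast
qed

end

section \<open>Energies of point sets on a circle\<close>

definition green_profile :: "'n::finite itself \<Rightarrow> real \<Rightarrow> real \<Rightarrow> real" where
  "green_profile _ \<kappa> r = (if CARD('n) = 2 then macdonald_K0 (\<kappa> * r) / (2 * pi) else exp (- \<kappa> * r) / (4 * pi * r))"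

lemma green_eq_profile: "green \<kappa> (x :: real^'n) = green_profile TYPE('n) \<kappa> (norm x)"
  by (simp add: green_def green_profile_def)

lemma green_profile_strict_antimono:
  assumes k: "0 < \<kappa>" and r: "0 < r" "r < s"
  shows "green_profile TYPE('n::finite) \<kappa> s < green_profile TYPE('n) \<kappa> r"
proof (cases "CARD('n) = 2")
  case True
  then show ?thesis using K0_strict_antimono[of "\<kappa> * r" "\<kappa> * s"] k r by (simp add: green_profile_def divide_strict_right_mono)
next
  case False
  have "exp (- \<kappa> * s) / (4 * pi * s) < exp (- \<kappa> * r) / (4 * pi * r)"
    using k r by (intro frac_less2) auto
  then show ?thesis using False by (simp add: green_profile_def)
qed

lemma yukawa_convex:
  assumes k: "0 < \<kappa>" shows "convex_on {0<..} (\<lambda>r::real. exp (- \<kappa> * r) / r)"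
proof (rule f''_ge0_imp_convex)
  fix r :: real assume r: "r \<in> {0<..}"
  show "DERIV (\<lambda>r. exp (- \<kappa> * r) / r) r :> - exp (- \<kappa> * r) * (\<kappa> / r + 1 / r\<^sup>2)"
    using r by (auto intro!: derivative_eq_intros simp: field_simps power2_eq_square)
  show "DERIV (\<lambda>r. - exp (- \<kappa> * r) * (\<kappa> / r + 1 / r\<^sup>2)) r :> exp (- \<kappa> * r) * (\<kappa>\<^sup>2 / r + 2 * \<kappa> / r\<^sup>2 + 2 / r ^ 3)"
    using r by (auto intro!: derivative_eq_intros simp: field_simps power2_eq_square power3_eq_cube)
  show "0 \<le> exp (- \<kappa> * r) * (\<kappa>\<^sup>2 / r + 2 * \<kappa> / r\<^sup>2 + 2 / r ^ 3)"
    using r k by simp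
qed (simp add: convex_real_interval)

lemma green_profile_convex:
  assumes k: "0 < \<kappa>" shows "convex_on {0<..} (green_profile TYPE('n::finite) \<kappa>)"
proof (cases "CARD('n) = 2")
  case True
  have "convex_on {0<..} (\<lambda>r. macdonald_K0 (\<kappa> * r))"
  proof (rule convex_onI)
    fix t x y :: real assume t: "0 < t" "t < 1" and "x \<in> {0<..}" "y \<in> {0<..}"
    then show "macdonald_K0 (\<kappa> * ((1 - t) *\<^sub>R x + t *\<^sub>R y)) \<le> (1 - t) * macdonald_K0 (\<kappa> * x) + t * macdonald_K0 (\<kappa> * y)"
      using convex_onD[OF K0_convex, of t "\<kappa> * x" "\<kappa> * y"] k by (simp add: algebra_simps)
  qed (simp add: convex_real_interval)
  then have "convex_on {0<..} (\<lambda>r. (1 / (2 * pi)) * macdonald_K0 (\<kappa> * r))" by (intro convex_on_cmul) auto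
  then show ?thesis using True by (simp add: green_profile_def[abs_def])
next
  case False
  have "convex_on {0<..} (\<lambda>r. (1 / (4 * pi)) * (exp (- \<kappa> * r) / r))"
    by (intro convex_on_cmul yukawa_convex k) auto
  then show ?thesis using False by (simp add: green_profile_def[abs_def])
qed

text \<open>On the unit circle 2 * sin (\<theta> / 2) is the chord that subtends the angle
  \<theta>.\<close>

definition arc_energy :: "(real \<Rightarrow> real) \<Rightarrow> real \<Rightarrow> real" where
  "arc_energy g \<theta> = g (2 * sin (\<theta> / 2))"

lemma sin_half_pos: "\<theta> \<in> {0<..<2 * pi} \<Longrightarrow> 0 < sin (\<theta> / 2)"
  by (intro sin_gt_zero) auto

lemma sin_half_concave: "convex_on {0<..<2 * pi} (\<lambda>\<theta>. - sin (\<theta> / 2))"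
proof (rule f''_ge0_imp_convex)
  fix \<theta> :: real assume \<theta>: "\<theta> \<in> {0<..<2 * pi}"
  show "DERIV (\<lambda>\<theta>. - sin (\<theta> / 2)) \<theta> :> - cos (\<theta> / 2) / 2" by (auto intro!: derivative_eq_intros)
  show "DERIV (\<lambda>\<theta>. - cos (\<theta> / 2) / 2) \<theta> :> sin (\<theta> / 2) / 4" by (auto intro!: derivative_eq_intros)
  show "0 \<le> sin (\<theta> / 2) / 4" using sin_half_pos[OF \<theta>] by simp
qed (simp add: convex_real_interval)

text \<open>The chord is concave in the angle, and g is decreasing and convex in the chord.\<close>

lemma arc_energy_convex:
  assumes anti: "\<And>r s. 0 < r \<Longrightarrow> r < s \<Longrightarrow> g s < g r" and conv: "convex_on {0<..} g"
  shows "convex_on {0<..<2 * pi} (arc_energy g)"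
proof (rule convex_onI)
  fix t x y :: real assume t: "0 < t" "t < 1" and x: "x \<in> {0<..<2 * pi}" and y: "y \<in> {0<..<2 * pi}"
  define z where "z = (1 - t) *\<^sub>R x + t *\<^sub>R y"
  define w where "w = (1 - t) *\<^sub>R (2 * sin (x / 2)) + t *\<^sub>R (2 * sin (y / 2))"
  have w: "0 < w" unfolding w_def using t sin_half_pos[OF x] sin_half_pos[OF y] by (simp add: add_pos_pos)
  have "w \<le> 2 * sin (z / 2)"
    using convex_onD[OF sin_half_concave, of t x y] t x y by (simp add: w_def z_def algebra_simps)
  then have "g (2 * sin (z / 2)) \<le> g w"
    using anti[OF w, of "2 * sin (z / 2)"] by (cases "w = 2 * sin (z / 2)") auto
  also have "g w \<le> (1 - t) * g (2 * sin (x / 2)) + t * g (2 * sin (y / 2))"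
    unfolding w_def using t sin_half_pos[OF x] sin_half_pos[OF y] by (intro convex_onD[OF conv]) auto
  finally show "arc_energy g ((1 - t) *\<^sub>R x + t *\<^sub>R y) \<le> (1 - t) * arc_energy g x + t * arc_energy g y"
    by (simp add: arc_energy_def z_def)
qed (simp add: convex_real_interval)

text \<open>Strictness comes from the chord: the mean of the two chords is the chord of the mean
  angle times cos ((x - y) / 4) < 1, and g decreases strictly.\<close>

lemma arc_energy_midpoint_less:
  assumes anti: "\<And>r s. 0 < r \<Longrightarrow> r < s \<Longrightarrow> g s < g r" and conv: "convex_on {0<..} g"
    and x: "x \<in> {0<..<2 * pi}" and y: "y \<in> {0<..<2 * pi}" and ne: "x \<noteq> y"
  shows "2 * arc_energy g ((x + y) / 2) < arc_energy g x + arc_energy g y"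
proof -
  define w where "w = (1 - 1 / 2) *\<^sub>R (2 * sin (x / 2)) + (1 / 2) *\<^sub>R (2 * sin (y / 2))"
  have w: "0 < w" unfolding w_def using sin_half_pos[OF x] sin_half_pos[OF y] by simp
  have "w = 2 * sin ((x + y) / 4) * cos ((x - y) / 4)"
    using sin_plus_sin[of "x / 2" "y / 2"] by (simp add: w_def diff_divide_distrib add_divide_distrib)
  moreover have "cos ((x - y) / 4) < 1"
  proof -
    have "\<bar>x - y\<bar> < 2 * pi" using x y by auto
    then have "\<bar>(x - y) / 4\<bar> \<le> pi" by simp
    then have "cos \<bar>(x - y) / 4\<bar> < cos 0" using ne by (intro cos_monotone_0_pi) auto
    then show ?thesis by (simp only: cos_abs_real cos_zero)
  qed
  moreover have "0 < sin ((x + y) / 4)" using sin_half_pos[of "(x + y) / 2"] x y by simp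
  ultimately have "w < 2 * sin ((x + y) / 2 / 2)" by (simp add: mult_less_cancel_left2)
  then have "g (2 * sin ((x + y) / 2 / 2)) < g w" using anti[OF w] by blast
  also have "g w \<le> (1 - 1 / 2) * g (2 * sin (x / 2)) + 1 / 2 * g (2 * sin (y / 2))"
    unfolding w_def using sin_half_pos[OF x] sin_half_pos[OF y] by (intro convex_onD[OF conv]) auto
  finally show ?thesis by (simp add: arc_energy_def)
qed

section \<open>Jensen's inequality for equal weights\<close>

lemma jensen_uniform:
  fixes f :: "real \<Rightarrow> real"
  assumes conv: "convex_on S f" and N: "N > 0" and \<theta>: "\<And>i. i < N \<Longrightarrow> \<theta> i \<in> S" and sum: "(\<Sum>i<N. \<theta> i) = real N * m"
  shows "real N * f m \<le> (\<Sum>i<N. f (\<theta> i))"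
proof -
  have "f (\<Sum>i<N. (1 / real N) *\<^sub>R \<theta> i) \<le> (\<Sum>i<N. (1 / real N) * f (\<theta> i))"
    using N \<theta> by (intro convex_on_sum[OF _ _ conv]) auto
  also have "(\<Sum>i<N. (1 / real N) *\<^sub>R \<theta> i) = m"
    using sum N by (simp flip: sum_divide_distrib)
  finally show ?thesis using N by (simp add: field_simps flip: sum_divide_distrib)
qed

text \<open>Replacing two different entries by their mean keeps the sum and lowers the energy.\<close>

lemma jensen_uniform_strict:
  fixes f :: "real \<Rightarrow> real"
  assumes conv: "convex_on S f" and mid: "\<And>x y. x \<in> S \<Longrightarrow> y \<in> S \<Longrightarrow> x \<noteq> y \<Longrightarrow> 2 * f ((x + y) / 2) < f x + f y"
    and S: "convex S" and \<theta>: "\<And>i. i < N \<Longrightarrow> \<theta> i \<in> S" and sum: "(\<Sum>i<N. \<theta> i) = real N * m"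
    and p: "p < N" "\<theta> p \<noteq> m"
  shows "real N * f m < (\<Sum>i<N. f (\<theta> i))"
proof -
  have "\<exists>q<N. \<theta> q \<noteq> \<theta> p"
  proof (rule ccontr)
    assume "\<not> (\<exists>q<N. \<theta> q \<noteq> \<theta> p)"
    then have "(\<Sum>i<N. \<theta> i) = (\<Sum>i<N. \<theta> p)" by (intro sum.cong) auto
    then show False using sum p by simp
  qed
  then obtain q where q: "q < N" "\<theta> q \<noteq> \<theta> p" by blast
  have pq: "p \<noteq> q" using q by auto
  define c where "c = (\<theta> p + \<theta> q) / 2"
  define \<theta>' where "\<theta>' = \<theta>(p := c, q := c)"
  have c: "c \<in> S"
    using convexD[OF S, of "\<theta> p" "\<theta> q" "1/2" "1/2"] \<theta> p q by (simp add: c_def field_simps)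
  have split: "(\<Sum>i<N. h i) = h p + h q + (\<Sum>i\<in>{..<N} - {p, q}. h i)" for h :: "nat \<Rightarrow> real"
  proof -
    have "(\<Sum>i<N. h i) = h p + (\<Sum>i\<in>{..<N} - {p}. h i)" using p by (intro sum.remove) auto
    also have "(\<Sum>i\<in>{..<N} - {p}. h i) = h q + (\<Sum>i\<in>{..<N} - {p} - {q}. h i)" using q pq by (intro sum.remove) auto
    also have "{..<N} - {p} - {q} = {..<N} - {p, q}" by auto
    finally show ?thesis by simp
  qed
  have rest: "(\<Sum>i\<in>{..<N} - {p, q}. h (\<theta>' i)) = (\<Sum>i\<in>{..<N} - {p, q}. h (\<theta> i))" for h :: "real \<Rightarrow> real"
    by (intro sum.cong) (auto simp: \<theta>'_def)
  have "(\<Sum>i<N. \<theta>' i) = real N * m"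
    using sum pq unfolding split[of \<theta>'] split[of \<theta>] rest[of "\<lambda>x. x"] by (simp add: \<theta>'_def c_def field_simps)
  moreover have "\<theta>' i \<in> S" if "i < N" for i using \<theta>[OF that] c by (simp add: \<theta>'_def)
  ultimately have "real N * f m \<le> (\<Sum>i<N. f (\<theta>' i))"
    using p by (intro jensen_uniform[OF conv]) auto
  also have "\<dots> < (\<Sum>i<N. f (\<theta> i))"
    using mid[of "\<theta> p" "\<theta> q"] \<theta> p q pq unfolding split[of "\<lambda>i. f (\<theta>' i)"] split[of "\<lambda>i. f (\<theta> i)"] rest[of f]
    by (simp add: \<theta>'_def c_def)
  finally show ?thesis .
qed

section \<open>Chords and the cyclic order of points on the circle\<close>

lemma norm_circle_point_diff:
  assumes "orthonormal_pair u v"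
  shows "norm (circle_point p u v a - circle_point p u v b) = 2 * \<bar>sin ((a - b) / 2)\<bar>"
proof -
  have uu: "u \<bullet> u = 1" "v \<bullet> v = 1" "u \<bullet> v = 0" "v \<bullet> u = 0"
    using assms by (auto simp: orthonormal_pair_def norm_eq_1 inner_commute)
  have "circle_point p u v a - circle_point p u v b = (cos a - cos b) *\<^sub>R u + (sin a - sin b) *\<^sub>R v"
    by (simp add: circle_point_def scaleR_left_diff_distrib)
  then have "(norm (circle_point p u v a - circle_point p u v b))\<^sup>2 = (cos a - cos b)\<^sup>2 + (sin a - sin b)\<^sup>2"
    by (simp only: power2_norm_eq_inner) (simp add: inner_add_left inner_add_right uu power2_eq_square)
  also have "\<dots> = 2 - 2 * cos (a - b)"
    using sin_cos_squared_add[of a] sin_cos_squared_add[of b] by (simp add: cos_diff power2_eq_square algebra_simps)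
  also have "\<dots> = (2 * \<bar>sin ((a - b) / 2)\<bar>)\<^sup>2"
  proof -
    have "2 * ((a - b) / 2) = a - b" by simp
    then have "cos (a - b) = 1 - 2 * (sin ((a - b) / 2))\<^sup>2" by (metis cos_double_sin)
    then show ?thesis by (simp add: power_mult_distrib)
  qed
  finally show ?thesis by (rule power2_eq_imp_eq) auto
qed

text \<open>A cyclic enumeration lists the angles of the points of \<open>Y\<close> in increasing order, continued to
  all of \<open>\<nat>\<close> by going around the circle again and again.\<close>

definition cyclic_enum :: "(real \<Rightarrow> real^'n) \<Rightarrow> nat \<Rightarrow> (nat \<Rightarrow> real) \<Rightarrow> (real^'n) set \<Rightarrow> bool" where
  "cyclic_enum cp N \<tau> Y \<longleftrightarrow> strict_mono \<tau> \<and> (\<forall>m. \<tau> (m + N) = \<tau> m + 2 * pi) \<and> (\<lambda>i. cp (\<tau> i)) ` {..<N} = Y"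

lemma circle_point_periodic: "circle_point p u v (t + 2 * pi) = circle_point p u v t"
  by (simp add: circle_point_def)

text \<open>Since the sorted angles lie in [0, 2 pi), the step from the last one to the first one of
  the next turn is an increase as well.\<close>

lemma cyclic_enum_exists:
  assumes Y: "Y \<subseteq> range (circle_point p u v)" "finite Y" "card Y = N" and N: "N > 0"
  obtains \<tau> where "cyclic_enum (circle_point p u v) N \<tau> Y"
proof -
  let ?cp = "circle_point p u v"
  have "\<exists>t\<in>{0..<2 * pi}. ?cp t = z" if z: "z \<in> Y" for z
  proof -
    obtain s where s: "z = ?cp s" using Y z by blast
    obtain t where "0 \<le> t" "t < 2 * pi" "cos s = cos t" "sin s = sin t"
      using sincos_total_2pi[of "cos s" "sin s"] by (metis sin_cos_squared_add3 power2_eq_square add.commute)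
    then show ?thesis using s by (intro bexI[of _ t]) (auto simp: circle_point_def)
  qed
  then obtain h where h: "\<And>z. z \<in> Y \<Longrightarrow> h z \<in> {0..<2 * pi}" "\<And>z. z \<in> Y \<Longrightarrow> ?cp (h z) = z" by metis
  have inj: "inj_on h Y" by (metis h(2) inj_onI)
  define ts where "ts = sorted_list_of_set (h ` Y)"
  have fin: "finite (h ` Y)" using Y by simp
  have ts: "set ts = h ` Y" "length ts = N" "sorted_wrt (<) ts"
    using fin Y inj by (auto simp: ts_def card_image)
  define \<tau> where "\<tau> m = ts ! (m mod N) + 2 * pi * real (m div N)" for m
  have rng: "ts ! i \<in> {0..<2 * pi}" if "i < N" for i
    using h(1) ts that nth_mem[of i ts] by auto
  have "\<tau> m < \<tau> (Suc m)" for m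
  proof (cases "Suc (m mod N) = N")
    case True
    then have e: "Suc m mod N = 0" "Suc m div N = Suc (m div N)" by (simp_all add: mod_Suc div_Suc)
    have "ts ! (m mod N) < 2 * pi" "0 \<le> ts ! 0" using rng[of "m mod N"] rng[of 0] N by auto
    then show ?thesis unfolding \<tau>_def e by (simp add: algebra_simps)
  next
    case False
    then have e: "Suc m mod N = Suc (m mod N)" "Suc m div N = m div N" by (simp_all add: mod_Suc div_Suc)
    have "Suc (m mod N) < N" using False N by (metis Suc_lessI mod_less_divisor)
    then have "ts ! (m mod N) < ts ! Suc (m mod N)"
      using ts sorted_wrt_nth_less[of "(<)" ts "m mod N" "Suc (m mod N)"] by simp
    then show ?thesis unfolding \<tau>_def e by simp
  qed
  then have "strict_mono \<tau>" by (simp add: strict_mono_Suc_iff)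
  moreover have "\<tau> (m + N) = \<tau> m + 2 * pi" for m
    using N by (simp add: \<tau>_def algebra_simps)
  moreover have "(\<lambda>i. ?cp (\<tau> i)) ` {..<N} = Y"
  proof -
    have "(\<lambda>i. ?cp (\<tau> i)) ` {..<N} = ?cp ` ((!) ts ` {..<N})"
      unfolding image_image by (intro image_cong) (auto simp: \<tau>_def)
    also have "(!) ts ` {..<N} = h ` Y" using ts by (auto simp: set_conv_nth)
    also have "?cp ` h ` Y = Y" using h(2) by (force simp: image_image)
    finally show ?thesis .
  qed
  ultimately show ?thesis using that by (auto simp: cyclic_enum_def)
qed

lemma cyclic_enum_gap:
  assumes e: "cyclic_enum cp N \<tau> Y" and k: "0 < k" "k < N"
  shows "\<tau> (i + k) - \<tau> i \<in> {0<..<2 * pi}"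
proof -
  have sm: "strict_mono \<tau>" and p: "\<tau> (i + N) = \<tau> i + 2 * pi" using e by (simp_all add: cyclic_enum_def)
  have "\<tau> i < \<tau> (i + k)" "\<tau> (i + k) < \<tau> (i + N)"
    using k by (auto simp only: strict_mono_less[OF sm])
  then show ?thesis unfolding p by simp
qed

text \<open>Raising k by one replaces \<tau> k by \<tau> (k + N) in the sum, so that the sum grows
  by exactly one full turn.\<close>

lemma cyclic_enum_gap_sum:
  assumes e: "cyclic_enum cp N \<tau> Y"
  shows "(\<Sum>i<N. \<tau> (i + k) - \<tau> i) = 2 * pi * real k"
proof (induction k)
  case (Suc k)
  have "(\<Sum>i<N. \<tau> (i + Suc k)) = (\<Sum>i<Suc N. \<tau> (i + k)) - \<tau> k"
    by (subst sum.lessThan_Suc_shift) simp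
  also have "\<dots> = (\<Sum>i<N. \<tau> (i + k)) + 2 * pi"
  proof -
    have "\<tau> (N + k) = \<tau> k + 2 * pi" using e by (metis add.commute cyclic_enum_def)
    then show ?thesis by simp
  qed
  finally show ?case using Suc by (simp add: sum_subtractf algebra_simps)
qed simp

text \<open>Angles at N consecutive indices differ by less than a full turn, so the points are
  distinct; periodicity keeps them in Y, and counting gives surjectivity.\<close>

lemma cyclic_enum_bij:
  assumes e: "cyclic_enum (circle_point p u v) N \<tau> Y" and o: "orthonormal_pair u v" and c: "card Y = N" and N: "N > 0"
  shows "bij_betw (\<lambda>k. circle_point p u v (\<tau> (i + k))) {..<N} Y"
proof -
  let ?P = "\<lambda>m. circle_point p u v (\<tau> m)"
  have per: "?P (m + N * q) = ?P m" for m q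
  proof (induction q)
    case (Suc q)
    have "?P (m + N * Suc q) = ?P ((m + N * q) + N)" by (simp add: algebra_simps)
    also have "\<dots> = ?P (m + N * q)" using e by (simp add: cyclic_enum_def circle_point_periodic)
    finally show ?case using Suc by simp
  qed simp
  have "?P m \<in> Y" for m
  proof -
    have "?P m = ?P (m mod N)" using per[of "m mod N" "m div N"] by simp
    also have "\<dots> \<in> Y" using e N by (auto simp: cyclic_enum_def)
    finally show ?thesis .
  qed
  moreover have "inj_on (\<lambda>k. ?P (i + k)) {..<N}"
  proof (rule linorder_inj_onI)
    fix k l assume kl: "k < l" "k \<in> {..<N}" "l \<in> {..<N}"
    then have "\<tau> (i + k + (l - k)) - \<tau> (i + k) \<in> {0<..<2 * pi}" by (intro cyclic_enum_gap[OF e]) auto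
    then have "0 < sin ((\<tau> (i + l) - \<tau> (i + k)) / 2)" using kl by (intro sin_half_pos) simp
    then have "norm (?P (i + l) - ?P (i + k)) \<noteq> 0" by (simp add: norm_circle_point_diff[OF o])
    then show "?P (i + k) \<noteq> ?P (i + l)" by auto
  qed auto
  moreover have "finite Y" using c N by (metis card_gt_0_iff)
  ultimately have "inj_on (\<lambda>k. ?P (i + k)) {..<N} \<and> (\<lambda>k. ?P (i + k)) ` {..<N} = Y"
    using c by (intro conjI card_subset_eq) (auto simp: card_image)
  then show ?thesis by (simp add: bij_betw_def)
qed

lemma cyclic_enum_row_sum:
  assumes e: "cyclic_enum (circle_point p u v) N \<tau> Y" and o: "orthonormal_pair u v" and c: "card Y = N" and N: "N > 0"
  shows "(\<Sum>b\<in>Y - {circle_point p u v (\<tau> i)}. g (norm (circle_point p u v (\<tau> i) - b))) = (\<Sum>k\<in>{1..<N}. arc_energy g (\<tau> (i + k) - \<tau> i))"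
proof -
  let ?P = "\<lambda>m. circle_point p u v (\<tau> m)"
  have bij: "bij_betw (\<lambda>k. ?P (i + k)) {..<N} Y" by (rule cyclic_enum_bij[OF e o c N])
  then have "bij_betw (\<lambda>k. ?P (i + k)) ({..<N} - {0}) (Y - {?P i})"
  proof (rule bij_betw_DiffI)
    show "bij_betw (\<lambda>k. ?P (i + k)) {0} {?P i}" by (simp add: bij_betw_def)
    show "{?P i} \<subseteq> Y" using bij_betwE[OF bij] N by force
  qed (use N in auto)
  moreover have "{..<N} - {0} = {1..<N}" by auto
  ultimately have bij': "bij_betw (\<lambda>k. ?P (i + k)) {1..<N} (Y - {?P i})" by simp
  have "(\<Sum>b\<in>Y - {?P i}. g (norm (?P i - b))) = (\<Sum>k\<in>{1..<N}. g (norm (?P i - ?P (i + k))))"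
    by (rule sum.reindex_bij_betw[OF bij', symmetric])
  also have "\<dots> = (\<Sum>k\<in>{1..<N}. arc_energy g (\<tau> (i + k) - \<tau> i))"
  proof (rule sum.cong[OF refl])
    fix k assume "k \<in> {1..<N}"
    then have "0 < sin ((\<tau> (i + k) - \<tau> i) / 2)" by (intro sin_half_pos cyclic_enum_gap[OF e]) auto
    then show "g (norm (?P i - ?P (i + k))) = arc_energy g (\<tau> (i + k) - \<tau> i)"
      by (subst norm_minus_commute) (simp add: norm_circle_point_diff[OF o] arc_energy_def)
  qed
  finally show ?thesis .
qed

text \<open>Ordered pairs are grouped by cyclic distance k, with angles measured in the positive
  direction, so that each unordered pair occurs once with k and once with N - k.\<close>

lemma cyclic_enum_pair_sum:
  assumes e: "cyclic_enum (circle_point p u v) N \<tau> Y" and o: "orthonormal_pair u v" and c: "card Y = N" and N: "N > 0"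
  shows "(\<Sum>a\<in>Y. \<Sum>b\<in>Y - {a}. g (norm (a - b))) = (\<Sum>k\<in>{1..<N}. \<Sum>i<N. arc_energy g (\<tau> (i + k) - \<tau> i))"
proof -
  have "bij_betw (\<lambda>k. circle_point p u v (\<tau> (0 + k))) {..<N} Y" by (rule cyclic_enum_bij[OF e o c N])
  then have "(\<Sum>a\<in>Y. \<Sum>b\<in>Y - {a}. g (norm (a - b))) = (\<Sum>i<N. \<Sum>b\<in>Y - {circle_point p u v (\<tau> i)}. g (norm (circle_point p u v (\<tau> i) - b)))"
    by (subst sum.reindex_bij_betw[symmetric]) auto
  also have "\<dots> = (\<Sum>i<N. \<Sum>k\<in>{1..<N}. arc_energy g (\<tau> (i + k) - \<tau> i))"
    by (simp only: cyclic_enum_row_sum[OF e o c N])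
  finally show ?thesis by (subst (asm) sum.swap)
qed

lemma regular_cyclic_enum:
  assumes "N > 0"
  shows "cyclic_enum (circle_point p u v) N (\<lambda>m. 2 * pi * real m / real N) ((\<lambda>k. circle_point p u v (2 * pi * real k / real N)) ` {..<N})"
  using assms by (auto simp: cyclic_enum_def strict_mono_def divide_strict_right_mono add_divide_distrib distrib_left)

text \<open>The witness rotates the plane of u and v about p by the angle - s and fixes the
  orthogonal complement, so it is an isometry in any dimension.\<close>

lemma rotation_congruent:
  fixes u v :: "real^'n"
  assumes o: "orthonormal_pair u v"
  shows "congruent_sets ((\<lambda>k. circle_point p u v (s + t k)) ` I) ((\<lambda>k. circle_point p u v (t k)) ` I)"
proof -
  have uu: "u \<bullet> u = 1" "v \<bullet> v = 1" "u \<bullet> v = 0" "v \<bullet> u = 0"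
    using o by (auto simp: orthonormal_pair_def norm_eq_1 inner_commute)
  define L where "L w = w + ((w \<bullet> u) * (cos s - 1) + (w \<bullet> v) * sin s) *\<^sub>R u + ((w \<bullet> v) * (cos s - 1) - (w \<bullet> u) * sin s) *\<^sub>R v" for w :: "real^'n"
  have normL: "norm (L w) = norm w" for w
  proof -
    define a where "a = w \<bullet> u"
    define b where "b = w \<bullet> v"
    define A where "A = a * (cos s - 1) + b * sin s"
    define B where "B = b * (cos s - 1) - a * sin s"
    have wu: "u \<bullet> w = a" "v \<bullet> w = b" "w \<bullet> u = a" "w \<bullet> v = b" by (simp_all add: a_def b_def inner_commute)
    have "(norm (L w))\<^sup>2 = (norm w)\<^sup>2 + 2 * A * a + 2 * B * b + A\<^sup>2 + B\<^sup>2"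
      unfolding L_def power2_norm_eq_inner wu A_def[symmetric] B_def[symmetric]
      by (simp add: inner_add_left inner_add_right uu wu power2_eq_square algebra_simps)
    moreover have "2 * A * a + 2 * B * b + A\<^sup>2 + B\<^sup>2 = 0"
      using sin_cos_squared_add[of s] unfolding A_def B_def by algebra
    ultimately have "(norm (L w))\<^sup>2 = (norm w)\<^sup>2" by simp
    then show ?thesis by (rule power2_eq_imp_eq) auto
  qed
  have Ldiff: "L x - L z = L (x - z)" for x z
    by (simp add: L_def inner_diff_left scaleR_left_diff_distrib scaleR_left_distrib left_diff_distrib)
  define f where "f x = p + L (x - p)" for x
  have "dist (f x) (f z) = dist x z" for x z
    by (simp add: f_def dist_norm Ldiff normL)
  moreover have "f (circle_point p u v (s + r)) = circle_point p u v r" for r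
  proof -
    have "cos (s + r) + (cos (s + r) * (cos s - 1) + sin (s + r) * sin s) = cos ((s + r) - s)"
      by (simp only: cos_diff) (simp add: algebra_simps)
    moreover have "sin (s + r) + (sin (s + r) * (cos s - 1) - cos (s + r) * sin s) = sin ((s + r) - s)"
      by (simp only: sin_diff) (simp add: algebra_simps)
    moreover have "L (c *\<^sub>R u + d *\<^sub>R v) = (c + (c * (cos s - 1) + d * sin s)) *\<^sub>R u + (d + (d * (cos s - 1) - c * sin s)) *\<^sub>R v" for c d
      by (simp add: L_def inner_add_left uu scaleR_left_distrib)
    moreover have "circle_point p u v (s + r) - p = cos (s + r) *\<^sub>R u + sin (s + r) *\<^sub>R v"
      by (simp add: circle_point_def)
    ultimately show ?thesis
      by (simp add: f_def circle_point_def add.assoc)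
  qed
  ultimately show ?thesis unfolding congruent_sets_def by (intro exI[of _ f]) (auto simp: image_image)
qed

section \<open>Optimality of the regular polygon\<close>

lemma norm_one_vec_sq: "(norm (1 :: real^'N))\<^sup>2 = real CARD('N)"
  by (simp only: power2_norm_eq_inner inner_vec_def) simp

lemma pair_sum_one_eq:
  assumes "inj (y :: 'N::finite \<Rightarrow> real^'n)"
  shows "pair_sum y \<kappa> 1 = (\<Sum>a\<in>range y. \<Sum>b\<in>range y - {a}. green_profile TYPE('n) \<kappa> (norm (a - b)))"
proof -
  have row: "(\<Sum>j\<in>UNIV - {i}. green \<kappa> (y i - y j)) = (\<Sum>b\<in>range y - {y i}. green_profile TYPE('n) \<kappa> (norm (y i - b)))" for i
  proof -
    have "range y - {y i} = y ` (UNIV - {i})" using assms by (auto simp: inj_eq)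
    then show ?thesis
      using assms by (simp add: sum.reindex inj_on_subset green_eq_profile)
  qed
  show ?thesis unfolding pair_sum_def using assms by (simp add: sum.reindex row)
qed

text \<open>The inequality c_i c_j <= (c_i^2 + c_j^2) / 2, weighted with nonnegative entries, leaves
  only row and column sums, and symmetry makes all of them R. Constant vectors give
  equality.\<close>

lemma pair_sum_le_of_row_sums:
  assumes "\<And>i. (\<Sum>j\<in>UNIV - {i}. green \<kappa> (y i - y j)) = R"
  shows "pair_sum (y :: 'N::finite \<Rightarrow> real^'n) \<kappa> c \<le> R * (norm c)\<^sup>2"
proof -
  define G where "G i j = (if i = j then 0 else green \<kappa> (y i - y j))" for i j
  have Gsum: "(\<Sum>j\<in>UNIV - {i}. green \<kappa> (y i - y j) * h j) = (\<Sum>j\<in>UNIV. G i j * h j)" for i and h :: "'N \<Rightarrow> real"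
    unfolding G_def by (rule sum.mono_neutral_cong_left) auto
  have row: "(\<Sum>j\<in>UNIV. G i j) = R" for i using Gsum[of i "\<lambda>_. 1"] assms[of i] by simp
  have col: "(\<Sum>i\<in>UNIV. G i j) = R" for j
  proof -
    have "(\<Sum>i\<in>UNIV. G i j) = (\<Sum>i\<in>UNIV. G j i)" by (intro sum.cong) (auto simp: G_def green_commute)
    then show ?thesis using row by simp
  qed
  have nc: "(norm c)\<^sup>2 = (\<Sum>i\<in>UNIV. (c $ i)\<^sup>2)"
    by (simp only: power2_norm_eq_inner inner_vec_def) (simp add: power2_eq_square)
  have "pair_sum y \<kappa> c = (\<Sum>i\<in>UNIV. \<Sum>j\<in>UNIV. G i j * (c $ i * c $ j))"
    unfolding pair_sum_def Gsum ..
  also have "\<dots> \<le> (\<Sum>i\<in>UNIV. \<Sum>j\<in>UNIV. G i j * ((c $ i)\<^sup>2 / 2 + (c $ j)\<^sup>2 / 2))"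
  proof (intro sum_mono mult_left_mono)
    fix i j
    show "c $ i * c $ j \<le> (c $ i)\<^sup>2 / 2 + (c $ j)\<^sup>2 / 2"
      using zero_le_power2[of "c $ i - c $ j"] by (simp add: power2_eq_square algebra_simps)
    show "0 \<le> G i j" by (simp add: G_def)
  qed
  also have "\<dots> = (\<Sum>i\<in>UNIV. (c $ i)\<^sup>2 / 2 * (\<Sum>j\<in>UNIV. G i j)) + (\<Sum>j\<in>UNIV. (c $ j)\<^sup>2 / 2 * (\<Sum>i\<in>UNIV. G i j))"
  proof -
    have "(\<Sum>i\<in>UNIV. \<Sum>j\<in>UNIV. G i j * ((c $ j)\<^sup>2 / 2)) = (\<Sum>j\<in>UNIV. \<Sum>i\<in>UNIV. G i j * ((c $ j)\<^sup>2 / 2))"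
      by (rule sum.swap)
    moreover have "(\<Sum>j\<in>A. H j * a) = a * (\<Sum>j\<in>A. H j)" for A and H :: "'N \<Rightarrow> real" and a
      by (simp add: sum_distrib_left mult.commute)
    ultimately show ?thesis by (simp only: distrib_left sum.distrib)
  qed
  also have "\<dots> = R * (norm c)\<^sup>2"
    unfolding row col nc by (simp add: sum_distrib_left sum.distrib[symmetric] field_simps)
  finally show ?thesis .
qed

text \<open>An isometry between the two sets induces a permutation of the indices that preserves all
  distances, and trial vectors are transported along it.\<close>

lemma nonpos_set_congruent_subset:
  assumes y: "inj (y :: 'N::finite \<Rightarrow> real^'n)" and yt: "inj (yt :: 'N \<Rightarrow> real^'n)"
    and cong: "congruent_sets (range y) (range yt)"
  shows "nonpos_set \<alpha> y \<subseteq> nonpos_set \<alpha> yt"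
proof
  fix \<kappa> assume "\<kappa> \<in> nonpos_set \<alpha> y"
  then obtain c where c: "0 < \<kappa>" "c \<noteq> 0" "Gamma_form \<alpha> y \<kappa> c \<le> 0" by (auto simp: nonpos_set_def)
  obtain f where f: "\<And>x z. dist (f x) (f z) = dist x (z :: real^'n)" "f ` range y = range yt"
    using cong by (auto simp: congruent_sets_def)
  define \<sigma> where "\<sigma> i = inv yt (f (y i))" for i
  have \<sigma>: "yt (\<sigma> i) = f (y i)" for i
    unfolding \<sigma>_def using f(2) by (intro f_inv_into_f) auto
  have "inj \<sigma>"
  proof (rule injI)
    fix i j assume "\<sigma> i = \<sigma> j"
    then have "f (y i) = f (y j)" using \<sigma> by metis
    then have "dist (y i) (y j) = 0" using f(1)[of "y i" "y j"] by simp
    then show "i = j" using y by (simp add: inj_eq)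
  qed
  then have bij: "bij \<sigma>" by (simp add: finite_UNIV_inj_surj bij_def)
  define c' :: "real^'N" where "c' = (\<chi> j. c $ inv \<sigma> j)"
  have c'\<sigma>: "c' $ \<sigma> i = c $ i" for i using bij by (simp add: c'_def bij_is_inj)
  have gr: "green \<kappa> (yt (\<sigma> i) - yt (\<sigma> j)) = green \<kappa> (y i - y j)" for i j
    using f(1)[of "y i" "y j"] by (simp add: green_eq_profile \<sigma> dist_norm)
  have "(norm c')\<^sup>2 = (norm c)\<^sup>2"
    using sum.reindex_bij_betw[OF bij, of "\<lambda>j. c' $ j * c' $ j"]
    by (simp only: power2_norm_eq_inner inner_vec_def) (simp add: c'\<sigma>)
  moreover have "pair_sum yt \<kappa> c' = pair_sum y \<kappa> c"
  proof -
    have "pair_sum yt \<kappa> c' = (\<Sum>i\<in>UNIV. \<Sum>j\<in>UNIV - {\<sigma> i}. green \<kappa> (yt (\<sigma> i) - yt j) * (c' $ \<sigma> i * c' $ j))"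
      unfolding pair_sum_def by (rule sum.reindex_bij_betw[OF bij, symmetric])
    also have "\<dots> = (\<Sum>i\<in>UNIV. \<Sum>j\<in>UNIV - {i}. green \<kappa> (yt (\<sigma> i) - yt (\<sigma> j)) * (c' $ \<sigma> i * c' $ \<sigma> j))"
    proof (rule sum.cong[OF refl])
      fix i
      have b: "bij_betw \<sigma> (UNIV - {i}) (UNIV - {\<sigma> i})"
        by (rule bij_betw_DiffI[OF bij]) (auto simp: bij_betw_def)
      show "(\<Sum>j\<in>UNIV - {\<sigma> i}. green \<kappa> (yt (\<sigma> i) - yt j) * (c' $ \<sigma> i * c' $ j))
         = (\<Sum>j\<in>UNIV - {i}. green \<kappa> (yt (\<sigma> i) - yt (\<sigma> j)) * (c' $ \<sigma> i * c' $ \<sigma> j))"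
        by (rule sum.reindex_bij_betw[OF b, symmetric])
    qed
    also have "\<dots> = pair_sum y \<kappa> c" unfolding gr c'\<sigma> pair_sum_def ..
    finally show ?thesis .
  qed
  ultimately have "Gamma_form \<alpha> yt \<kappa> c' \<le> 0" using c(3) by (simp add: Gamma_form_eq)
  moreover have "c' \<noteq> 0" using c(2) c'\<sigma> by (metis vec_eq_iff zero_index)
  ultimately show "\<kappa> \<in> nonpos_set \<alpha> yt" using c(1) by (auto simp: nonpos_set_def)
qed

text \<open>With R the common row sum, N * R is the pair sum of the polygon at the constant vector,
  so two pair sums are being compared.\<close>

lemma pair_sum_regular_le:
  fixes y yt :: "'N::finite \<Rightarrow> real^'n"
  assumes k: "0 < \<kappa>" and N2: "CARD('N) \<ge> 2" and reg: "regular_polygon_in C CARD('N) (range yt)" and yt: "inj yt"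
    and y: "inj y" and sub: "range y \<subseteq> C"
  shows "\<exists>R. (\<forall>i. (\<Sum>j\<in>UNIV - {i}. green \<kappa> (yt i - yt j)) = R) \<and> real CARD('N) * R \<le> pair_sum y \<kappa> 1 \<and>
    (\<not> congruent_sets (range y) (range yt) \<longrightarrow> real CARD('N) * R < pair_sum y \<kappa> 1)"
proof -
  let ?N = "CARD('N)"
  define g where "g = green_profile TYPE('n) \<kappa>"
  have anti: "\<And>r s. 0 < r \<Longrightarrow> r < s \<Longrightarrow> g s < g r" and conv: "convex_on {0<..} g"
    using green_profile_strict_antimono[OF k] green_profile_convex[OF k] by (auto simp: g_def)
  have N0: "?N > 0" by simp
  obtain p u v where o: "orthonormal_pair u v" and C: "C = range (circle_point p u v)"
    and Z: "range yt = (\<lambda>k. circle_point p u v (2 * pi * real k / real ?N)) ` {..<?N}"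
    using reg by (auto simp: regular_polygon_in_def)
  let ?cp = "circle_point p u v"
  define t where "t m = 2 * pi * real m / real ?N" for m :: nat
  have et: "cyclic_enum ?cp ?N t (range yt)"
    using regular_cyclic_enum[OF N0, of p u v] unfolding Z t_def .
  have cards: "card (range yt) = ?N" "card (range y) = ?N" using yt y by (simp_all add: card_image)
  obtain \<tau> where e: "cyclic_enum ?cp ?N \<tau> (range y)"
    using cyclic_enum_exists[of "range y" p u v ?N] sub cards by (auto simp: C)
  define F where "F = arc_energy g"
  define R where "R = (\<Sum>k\<in>{1..<?N}. F (2 * pi * real k / real ?N))"
  have row: "(\<Sum>j\<in>UNIV - {i}. green \<kappa> (yt i - yt j)) = R" for i
  proof -
    have "yt i \<in> range yt" by simp
    then obtain l where l: "yt i = ?cp (t l)" unfolding Z t_def by auto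
    have "range yt - {yt i} = yt ` (UNIV - {i})" using yt by (auto simp: inj_eq)
    then have "(\<Sum>j\<in>UNIV - {i}. green \<kappa> (yt i - yt j)) = (\<Sum>b\<in>range yt - {yt i}. g (norm (yt i - b)))"
      using yt by (simp add: sum.reindex inj_on_subset green_eq_profile g_def)
    also have "\<dots> = (\<Sum>k\<in>{1..<?N}. F (t (l + k) - t l))"
      unfolding l F_def by (rule cyclic_enum_row_sum[OF et o cards(1) N0])
    \<comment> \<open>On the polygon the gap between the indices l and l + k is independent of
      l.\<close>
    also have "\<dots> = R"
      unfolding R_def t_def by (simp add: add_divide_distrib distrib_left)
    finally show ?thesis .
  qed
  have ps: "pair_sum y \<kappa> 1 = (\<Sum>k\<in>{1..<?N}. \<Sum>i<?N. F (\<tau> (i + k) - \<tau> i))"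
    unfolding pair_sum_one_eq[OF y] F_def g_def[symmetric] by (rule cyclic_enum_pair_sum[OF e o cards(2) N0])
  have NR: "real ?N * R = (\<Sum>k\<in>{1..<?N}. real ?N * F (2 * pi * real k / real ?N))"
    by (simp add: R_def sum_distrib_left)
  have Fconv: "convex_on {0<..<2 * pi} F" unfolding F_def by (rule arc_energy_convex[OF anti conv])
  have mean: "(\<Sum>i<?N. \<tau> (i + k) - \<tau> i) = real ?N * (2 * pi * real k / real ?N)" for k
    unfolding cyclic_enum_gap_sum[OF e] by simp
  have le: "real ?N * F (2 * pi * real k / real ?N) \<le> (\<Sum>i<?N. F (\<tau> (i + k) - \<tau> i))" if "k \<in> {1..<?N}" for k
    using that by (intro jensen_uniform[OF Fconv N0 _ mean] cyclic_enum_gap[OF e]) auto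
  have "real ?N * R \<le> pair_sum y \<kappa> 1" unfolding ps NR by (intro sum_mono le)
  moreover have "real ?N * R < pair_sum y \<kappa> 1" if nc: "\<not> congruent_sets (range y) (range yt)"
  proof -
    \<comment> \<open>Nearest neighbours, k = 1, decide strictness: if all consecutive gaps equal 2
      pi / N, then Y is the polygon turned by \<tau> 0.\<close>
    have "\<exists>i<?N. \<tau> (i + 1) - \<tau> i \<noteq> 2 * pi * real 1 / real ?N"
    proof (rule ccontr)
      assume "\<not> (\<exists>i<?N. \<tau> (i + 1) - \<tau> i \<noteq> 2 * pi * real 1 / real ?N)"
      then have step: "\<tau> (Suc i) = \<tau> i + 2 * pi / real ?N" if "i < ?N" for i using that by force
      have ti: "\<tau> i = \<tau> 0 + t i" if "i < ?N" for i
        using that by (induction i) (auto simp: step t_def add_divide_distrib distrib_left)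
      have "range y = (\<lambda>i. ?cp (\<tau> i)) ` {..<?N}"
        using e by (simp add: cyclic_enum_def)
      also have "\<dots> = (\<lambda>i. ?cp (\<tau> 0 + t i)) ` {..<?N}"
        by (intro image_cong refl arg_cong[where f="?cp"] ti) (simp only: lessThan_iff)
      finally have "range y = (\<lambda>i. ?cp (\<tau> 0 + t i)) ` {..<?N}" .
      moreover have "range yt = (\<lambda>i. ?cp (t i)) ` {..<?N}" unfolding Z t_def ..
      ultimately show False using nc rotation_congruent[OF o, of p "\<tau> 0" t "{..<?N}"] by simp
    qed
    then obtain i where i: "i < ?N" "\<tau> (i + 1) - \<tau> i \<noteq> 2 * pi * real 1 / real ?N" by blast
    have "real ?N * F (2 * pi * real 1 / real ?N) < (\<Sum>i<?N. F (\<tau> (i + 1) - \<tau> i))"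
    proof (rule jensen_uniform_strict[OF Fconv _ _ _ mean i])
      show "2 * F ((x + z) / 2) < F x + F z" if "x \<in> {0<..<2 * pi}" "z \<in> {0<..<2 * pi}" "x \<noteq> z" for x z
        unfolding F_def using that by (intro arc_energy_midpoint_less[OF anti conv])
      show "\<tau> (i + 1) - \<tau> i \<in> {0<..<2 * pi}" for i
        using N2 by (intro cyclic_enum_gap[OF e]) auto
    qed (simp add: convex_real_interval)
    then show ?thesis unfolding ps NR
      using N2 by (intro sum_strict_mono_ex1) (auto intro!: le bexI[of _ 1])
  qed
  ultimately show ?thesis using row by blast
qed

theorem theorem3p1:
  fixes C :: "(real^'n) set"
    and y yt :: "'N::finite \<Rightarrow> real^'n"
    and \<alpha> :: real
  assumes "CARD('n) = 2 \<or> CARD('n) = 3"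
    and "CARD('N) \<ge> 2"
    and "is_unit_circle C"
    and "inj yt" and "regular_polygon_in C CARD('N) (range yt)"
    and "inj y" and "range y \<subseteq> C"
    and "ereal \<alpha> < alpha_crit TYPE('N) C"
  shows "lambda1 \<alpha> y \<le> lambda1 \<alpha> yt \<and>
         (lambda1 \<alpha> y < lambda1 \<alpha> yt \<longleftrightarrow> \<not> congruent_sets (range y) (range yt))"
proof -
  interpret low_dim "TYPE('n)" by standard (rule assms(1))
  note y = \<open>inj y\<close> and yt = \<open>inj yt\<close>
  have subt: "range yt \<subseteq> C" using assms(5) by (auto simp: regular_polygon_in_def)
  obtain K where K: "K \<in> nonpos_set \<alpha> y" "\<And>s. s \<in> nonpos_set \<alpha> y \<Longrightarrow> s \<le> K"
    using nonpos_set_has_max[OF y nonpos_set_nonempty_below_alpha_crit[OF y assms(7,8)]] by blast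
  obtain Kt where Kt: "Kt \<in> nonpos_set \<alpha> yt" "\<And>s. s \<in> nonpos_set \<alpha> yt \<Longrightarrow> s \<le> Kt"
    using nonpos_set_has_max[OF yt nonpos_set_nonempty_below_alpha_crit[OF yt subt assms(8)]] by blast
  have l: "lambda1 \<alpha> y = - K\<^sup>2" "lambda1 \<alpha> yt = - Kt\<^sup>2"
    using lambda1_eq[OF y K] lambda1_eq[OF yt Kt] by auto
  obtain c where c: "0 < Kt" "c \<noteq> 0" "Gamma_form \<alpha> yt Kt c \<le> 0" using Kt(1) by (auto simp: nonpos_set_def)
  obtain R where R: "\<And>i. (\<Sum>j\<in>UNIV - {i}. green Kt (yt i - yt j)) = R" "real CARD('N) * R \<le> pair_sum y Kt 1"
    "\<not> congruent_sets (range y) (range yt) \<Longrightarrow> real CARD('N) * R < pair_sum y Kt 1"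
    using pair_sum_regular_le[OF c(1) assms(2,5) yt y assms(7)] by blast
  \<comment> \<open>The row sum bound turns the existence of some vector c with nonpositive form
    into a condition on R alone, the one that the constant vector would give.\<close>
  have "(\<alpha> - xi TYPE('n) Kt) * (norm c)\<^sup>2 \<le> R * (norm c)\<^sup>2"
    using c(3) pair_sum_le_of_row_sums[where c=c, OF R(1)] by (simp add: Gamma_form_eq)
  then have "\<alpha> - xi TYPE('n) Kt \<le> R" using c(2) by simp
  then have "(\<alpha> - xi TYPE('n) Kt) * real CARD('N) \<le> R * real CARD('N)" by (rule mult_right_mono) simp
  then have form: "Gamma_form \<alpha> y Kt 1 \<le> real CARD('N) * R - pair_sum y Kt 1"
    unfolding Gamma_form_eq norm_one_vec_sq by (simp add: mult.commute)
  have one: "(1 :: real^'N) \<noteq> 0" by (simp add: vec_eq_iff)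
  have "Gamma_form \<alpha> y Kt 1 \<le> 0" using form R(2) by simp
  then have "Kt \<in> nonpos_set \<alpha> y" using c(1) one unfolding nonpos_set_def by blast
  then have KtK: "Kt \<le> K" by (rule K(2))
  have strict: "Kt < K" if "\<not> congruent_sets (range y) (range yt)"
  proof -
    have "Gamma_form \<alpha> y Kt 1 < 0" using form R(3)[OF that] by simp
    then show ?thesis using nonpos_set_open_right[OF y c(1)] K(2) by (meson less_le_trans)
  qed
  \<comment> \<open>Congruence transports K into the set of the polygon, which gives K <= Kt; the
    reverse inequality holds for every Y.\<close>
  have eq: "K = Kt" if "congruent_sets (range y) (range yt)"
    using nonpos_set_congruent_subset[OF y yt that] K(1) Kt(2) KtK by (meson antisym subsetD)
  have "Kt\<^sup>2 \<le> K\<^sup>2" using KtK c(1) by (intro power_mono) auto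
  moreover have "Kt\<^sup>2 < K\<^sup>2" if "\<not> congruent_sets (range y) (range yt)"
    using strict[OF that] c(1) by (intro power_strict_mono) auto
  ultimately show ?thesis unfolding l using eq by auto
qed

end
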